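(* Let $(H,X)$ be a finite transitive permutation group such that $H$ is perfect, and assume that ( * ) $|X|\ge 2$, $H$ is non-abelian, and there are points of $X$ in the same orbit of $H=H'$ with different stabilizers. Fix letters $x,y\in X$ and permutations $\tau,\pi\in H$ with $\tau(x)=y$, $\pi(x)=x$ and $\pi(y)\neq y$. Let $H=\langle h_1,\ldots,h_m\rangle$, let $\mathcal{T}$ be the rooted tree whose $n$-th level is $X^n$, and let $W=\ldots\wr H\wr H\le\operatorname{Aut}\mathcal{T}$ be the infinite permutational wreath power of $H$. Regard each $h_i$ as the automorphism of $\mathcal{T}$ whose vertex permutation at the root is $h_i$ and whose other vertex permutations are trivial, and let $g_i\in\operatorname{Aut}\mathcal{T}$ ($1\le i\le m$) be the automorphism whose vertex permutation is $h_i$ at each of the vertices $x,\,yx,\,yyx,\,yyyx,\ldots$ (that is, at $y^{k-1}x$ for all $k\geq 1$) and is trivial at every other vertex; equivalently, $g_i$ is defined recursively by $g_i(yu)=y\,g_i(u)$, $g_i(xu)=x\,h_i(u)$, and $g_i(v)=v$ for all other vertices $v$. Then the finitely generated group $$G=\langle h_1,\ldots,h_m,g_1,\ldots,g_m\rangle$$ is a dense subgroup of the profinite group $W$, it is a branch group, and it has maximal subgroups of infinite index. If $H$ is nontrivial and perfect but $(H,X)$ does not satisfy ( * ), one takes $(H\wr H, X\times X)$ in place of $(H,X)$ in this construction; its infinite wreath power is again $W$.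
   Context: All actions are faithful: a permutation group $(H,X)$ is a group $H$ acting faithfully on a set $X$; it is finite transitive if $X$ is finite and $H$ acts transitively on $X$. A group is perfect if it equals its commutator subgroup $H'$. For permutation groups $(G,X)$ and $(K,Y)$ the permutational wreath product $K\wr G$ is the semidirect product $K^{|X|}\rtimes G$, where $G$ permutes the copies of $K$, with its natural action on $X\times Y$. The rooted tree $\mathcal{T}$ with $n$-th level $\mathcal{T}_n=X^n$ ($\mathcal{T}_0$ consists of the root) has each $v\in\mathcal{T}_n$ connected to $vz\in\mathcal{T}_{n+1}$ for all $z\in X$; $\operatorname{Aut}\mathcal{T}$ is the group of its root-preserving automorphisms, a profinite group as the inverse limit of its restrictions to the finite truncations of $\mathcal{T}$. For $g\in\operatorname{Aut}\mathcal{T}$ and a vertex $v$, the vertex permutation of $g$ at $v$ is the permutation of $X$ obtained from the map $vX\to g(v)X$ induced by $g$ by forgetting the prefixes $v$ and $g(v)$; an automorphism is determined by its vertex permutations. The infinite wreath power $W=\ldots\wr H\wr H$, the inverse limit of the iterated permutational wreath products $H\wr\ldots\wr H\wr H$ ($n$ factors, acting on $X^n$), is identified with the closed subgroup of $\operatorname{Aut}\mathcal{T}$ of all automorphisms whose vertex permutations all belong to $H$. For a vertex $v$, $\mathcal{T}_v$ denotes the subtree of vertices $u$ such that the geodesic from $u$ to the root passes through $v$. For a subgroup $G\le\operatorname{Aut}\mathcal{T}$, the rigid vertex stabilizer $\mathrm{RiSt}_G(v)$ is the subgroup of all $g\in G$ whose vertex permutations at all vertices outside $\mathcal{T}_v$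 are trivial, and the rigid level stabilizer $\mathrm{RiSt}_G(n)$ is the subgroup generated by $\mathrm{RiSt}_G(v)$ for $v\in\mathcal{T}_n$. The group $G$ is called branch if it acts transitively on every level $\mathcal{T}_n$ and every $\mathrm{RiSt}_G(n)$ has finite index in $G$. A maximal subgroup is a proper subgroup not contained in any other proper subgroup. *)

theory Defs
  imports
    "HOL-Analysis.Function_Topology"
    "HOL-Algebra.Generated_Groups"
    "HOL-Algebra.Group_Action"
    "HOL-Library.Sublist"
begin

section \<open>Permutation groups\<close>

definition finite_transitive_perm_group ::
    "('g, 'b) monoid_scheme \<Rightarrow> 'x set \<Rightarrow> ('g \<Rightarrow> 'x \<Rightarrow> 'x) \<Rightarrow> bool" where
  "finite_transitive_perm_group H X \<phi> \<longleftrightarrow>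
     faithful_action H X \<phi> \<and> finite X \<and> transitive_action H X \<phi>"

definition perfect_group :: "('g, 'b) monoid_scheme \<Rightarrow> bool" where
  "perfect_group H \<longleftrightarrow> group H \<and> derived H (carrier H) = carrier H"

text \<open>This condition is used for perfect groups only, so the orbits of the commutator
  subgroup are the orbits of the group.\<close>

definition condition_star ::
    "('g, 'b) monoid_scheme \<Rightarrow> 'x set \<Rightarrow> ('g \<Rightarrow> 'x \<Rightarrow> 'x) \<Rightarrow> bool" where
  "condition_star H X \<phi> \<longleftrightarrow>
     card X \<ge> 2 \<and> \<not> comm_group H \<and>
     (\<exists>a\<in>X. \<exists>b\<in>orbit H \<phi> a. stabilizer H \<phi> a \<noteq> stabilizer H \<phi> b)"

text \<open>The wreath product of \<open>K\<close> by \<open>(G, X)\<close>: the pair \<open>(k, g)\<close> stands for the product of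
  \<open>k \<in> K\<^sup>X\<close> and \<open>g \<in> G\<close> (so \<open>g\<close> acts first), and \<open>g\<close> moves the copy of \<open>K\<close> at \<open>z\<close> to the copy
  at \<open>g z\<close>.\<close>

definition wreath ::
    "('k, 'c) monoid_scheme \<Rightarrow> ('g, 'b) monoid_scheme \<Rightarrow> 'x set \<Rightarrow> ('g \<Rightarrow> 'x \<Rightarrow> 'x)
      \<Rightarrow> (('x \<Rightarrow> 'k) \<times> 'g) monoid" where
  "wreath K G X \<phi> =
     \<lparr>carrier = (X \<rightarrow>\<^sub>E carrier K) \<times> carrier G,
      mult = (\<lambda>(k, g) (k', g').
                (\<lambda>z\<in>X. k z \<otimes>\<^bsub>K\<^esub> k' (\<phi> (inv\<^bsub>G\<^esub> g) z), g \<otimes>\<^bsub>G\<^esub> g')),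
      one = (\<lambda>z\<in>X. \<one>\<^bsub>K\<^esub>, \<one>\<^bsub>G\<^esub>)\<rparr>"

definition wreath_action ::
    "'x set \<Rightarrow> ('g \<Rightarrow> 'x \<Rightarrow> 'x) \<Rightarrow> 'y set \<Rightarrow> ('k \<Rightarrow> 'y \<Rightarrow> 'y)
      \<Rightarrow> (('x \<Rightarrow> 'k) \<times> 'g) \<Rightarrow> 'x \<times> 'y \<Rightarrow> 'x \<times> 'y" where
  "wreath_action X \<phi> Y \<psi> = (\<lambda>(k, g). \<lambda>(z, w)\<in>X \<times> Y. (\<phi> g z, \<psi> (k (\<phi> g z)) w))"


section \<open>The rooted tree and its automorphisms\<close>

text \<open>The vertices of the tree over \<open>X\<close> are the words in \<open>lists X\<close>; the root is \<open>[]\<close>.\<close>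

definition level :: "'x set \<Rightarrow> nat \<Rightarrow> 'x list set" where
  "level X n = {v \<in> lists X. length v = n}"

definition adjacent :: "'x set \<Rightarrow> 'x list \<Rightarrow> 'x list \<Rightarrow> bool" where
  "adjacent X u v \<longleftrightarrow>
     u \<in> lists X \<and> v \<in> lists X \<and> (\<exists>z\<in>X. v = u @ [z] \<or> u = v @ [z])"

definition AutT :: "'x set \<Rightarrow> ('x list \<Rightarrow> 'x list) monoid" where
  "AutT X = BijGroup (lists X)
     \<lparr>carrier := {g \<in> Bij (lists X). g [] = [] \<and>
        (\<forall>u\<in>lists X. \<forall>v\<in>lists X. adjacent X (g u) (g v) \<longleftrightarrow> adjacent X u v)}\<rparr>"

text \<open>The profinite topology: the one that \<open>AutT X\<close> carries as a subspace of the product of its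
  (discrete) restrictions to the truncations of the tree.\<close>

definition truncation :: "'x set \<Rightarrow> nat \<Rightarrow> 'x list set" where
  "truncation X n = {v \<in> lists X. length v \<le> n}"

definition AutT_topology :: "'x set \<Rightarrow> ('x list \<Rightarrow> 'x list) topology" where
  "AutT_topology X =
     pullback_topology (carrier (AutT X)) (\<lambda>g n. restrict g (truncation X n))
       (product_topology
         (\<lambda>n. discrete_topology ((\<lambda>g. restrict g (truncation X n)) ` carrier (AutT X))) UNIV)"

definition vertex_perm :: "'x set \<Rightarrow> ('x list \<Rightarrow> 'x list) \<Rightarrow> 'x list \<Rightarrow> 'x \<Rightarrow> 'x" where
  "vertex_perm X g v = (\<lambda>z\<in>X. last (g (v @ [z])))"

definition wreath_power ::
    "('g, 'b) monoid_scheme \<Rightarrow> 'x set \<Rightarrow> ('g \<Rightarrow> 'x \<Rightarrow> 'x) \<Rightarrow> ('x list \<Rightarrow> 'x list) set" where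
  "wreath_power H X \<phi> =
     {g \<in> carrier (AutT X). \<forall>v\<in>lists X. vertex_perm X g v \<in> \<phi> ` carrier H}"

definition dense_subgroup ::
    "'x set \<Rightarrow> ('x list \<Rightarrow> 'x list) set \<Rightarrow> ('x list \<Rightarrow> 'x list) set \<Rightarrow> bool" where
  "dense_subgroup X G W \<longleftrightarrow>
     subgroup G (AutT X\<lparr>carrier := W\<rparr>) \<and>
     subtopology (AutT_topology X) W closure_of G = W"


section \<open>Branch groups and maximal subgroups\<close>

definition finite_index :: "('g, 'b) monoid_scheme \<Rightarrow> 'g set \<Rightarrow> 'g set \<Rightarrow> bool" where
  "finite_index A G K \<longleftrightarrow> finite (rcosets\<^bsub>A\<lparr>carrier := G\<rparr>\<^esub> K)"

definition RiSt_vertex ::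
    "'x set \<Rightarrow> ('x list \<Rightarrow> 'x list) set \<Rightarrow> 'x list \<Rightarrow> ('x list \<Rightarrow> 'x list) set" where
  "RiSt_vertex X G v =
     {g \<in> G. \<forall>u\<in>lists X. \<not> prefix v u \<longrightarrow> vertex_perm X g u = (\<lambda>z\<in>X. z)}"

definition RiSt_level ::
    "'x set \<Rightarrow> ('x list \<Rightarrow> 'x list) set \<Rightarrow> nat \<Rightarrow> ('x list \<Rightarrow> 'x list) set" where
  "RiSt_level X G n = generate (AutT X) (\<Union>v\<in>level X n. RiSt_vertex X G v)"

definition branch_group :: "'x set \<Rightarrow> ('x list \<Rightarrow> 'x list) set \<Rightarrow> bool" where
  "branch_group X G \<longleftrightarrow>
     subgroup G (AutT X) \<and>
     (\<forall>n. \<forall>u\<in>level X n. \<forall>v\<in>level X n. \<exists>g\<in>G. g u = v) \<and>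
     (\<forall>n. finite_index (AutT X) G (RiSt_level X G n))"

definition maximal_subgroup :: "('g, 'b) monoid_scheme \<Rightarrow> 'g set \<Rightarrow> 'g set \<Rightarrow> bool" where
  "maximal_subgroup A G M \<longleftrightarrow>
     subgroup M (A\<lparr>carrier := G\<rparr>) \<and> M \<noteq> G \<and>
     (\<forall>K. subgroup K (A\<lparr>carrier := G\<rparr>) \<and> M \<subseteq> K \<and> K \<noteq> G \<longrightarrow> K = M)"


section \<open>The construction\<close>

text \<open>The automorphism with prescribed vertex permutations \<open>p v\<close>.\<close>

fun portrait_map :: "('x list \<Rightarrow> 'x \<Rightarrow> 'x) \<Rightarrow> 'x list \<Rightarrow> 'x list" where
  "portrait_map p [] = []"
| "portrait_map p (z # u) = p [] z # portrait_map (\<lambda>v. p (z # v)) u"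

definition portrait_aut ::
    "'x set \<Rightarrow> ('x list \<Rightarrow> 'x \<Rightarrow> 'x) \<Rightarrow> 'x list \<Rightarrow> 'x list" where
  "portrait_aut X p = restrict (portrait_map p) (lists X)"

definition rooted_aut :: "'x set \<Rightarrow> ('x \<Rightarrow> 'x) \<Rightarrow> 'x list \<Rightarrow> 'x list" where
  "rooted_aut X s = portrait_aut X (\<lambda>v. if v = [] then s else (\<lambda>z\<in>X. z))"

definition directed_aut :: "'x set \<Rightarrow> 'x \<Rightarrow> 'x \<Rightarrow> ('x \<Rightarrow> 'x) \<Rightarrow> 'x list \<Rightarrow> 'x list" where
  "directed_aut X x y s =
     portrait_aut X (\<lambda>v. if \<exists>k. v = replicate k y @ [x] then s else (\<lambda>z\<in>X. z))"

definition branch_construction ::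
    "'x set \<Rightarrow> ('g \<Rightarrow> 'x \<Rightarrow> 'x) \<Rightarrow> 'x \<Rightarrow> 'x \<Rightarrow> nat \<Rightarrow> (nat \<Rightarrow> 'g) \<Rightarrow> ('x list \<Rightarrow> 'x list) set" where
  "branch_construction X \<phi> x y m h =
     generate (AutT X)
       ((\<lambda>i. rooted_aut X (\<phi> (h i))) ` {1..m} \<union> (\<lambda>i. directed_aut X x y (\<phi> (h i))) ` {1..m})"

lemma length_portrait_map [simp]: "length (portrait_map p u) = length u"
  by (induction u arbitrary: p) auto

lemma portrait_map_append:
  "portrait_map p (u @ w) = portrait_map p u @ portrait_map (\<lambda>v. p (u @ v)) w"
  by (induction u arbitrary: p) auto

lemma portrait_map_bij:
  assumes "\<And>v. v \<in> lists X \<Longrightarrow> bij_betw (p v) X X"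
  shows "bij_betw (portrait_map p) (lists X) (lists X)"
proof (rule bij_betw_imageI)
  show "inj_on (portrait_map p) (lists X)"
  proof (rule inj_onI)
    fix u w assume "u \<in> lists X" "w \<in> lists X" "portrait_map p u = portrait_map p w"
    then show "u = w" using assms
    proof (induction u arbitrary: p w rule: list.induct)
      case Nil
      then show ?case by (cases w) auto
    next
      case (Cons a u)
      then obtain b w' where w: "w = b # w'" by (cases w) auto
      have "inj_on (p []) X"
        using Cons.prems(4)[of "[]"] by (simp add: bij_betw_def)
      then have ab: "a = b"
        using Cons.prems w by (auto dest: inj_onD)
      have "u = w'"
      proof (rule Cons.IH[where p = "\<lambda>v. p (a # v)"])
        show "\<And>v. v \<in> lists X \<Longrightarrow> bij_betw (p (a # v)) X X"
          using Cons.prems(1,4) by auto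
      qed (use Cons.prems w ab in auto)
      then show ?case using w ab by simp
    qed
  qed
  have into: "portrait_map p u \<in> lists X" if "u \<in> lists X" for u
    using that assms
  proof (induction u arbitrary: p rule: list.induct)
    case (Cons a u)
    have "portrait_map (\<lambda>v. p (a # v)) u \<in> lists X"
      by (rule Cons.IH) (use Cons.prems in auto)
    moreover have "p [] a \<in> X"
      using Cons.prems(1) Cons.prems(2)[of "[]"] by (auto simp: bij_betw_def)
    ultimately show ?case by simp
  qed simp
  have onto: "\<exists>u\<in>lists X. portrait_map p u = w" if "w \<in> lists X" for w
    using that assms
  proof (induction w arbitrary: p rule: list.induct)
    case (Cons b w)
    obtain a where a: "a \<in> X" "p [] a = b"
      using Cons.prems(1) Cons.prems(2)[of "[]"] by (force simp: bij_betw_def)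
    have "\<exists>u\<in>lists X. portrait_map (\<lambda>v. p (a # v)) u = w"
      by (rule Cons.IH) (use Cons.prems a in auto)
    then obtain u where "u \<in> lists X" "portrait_map (\<lambda>v. p (a # v)) u = w" by blast
    then show ?case using a by (intro bexI[of _ "a # u"]) auto
  qed (auto intro: bexI[of _ "[]"])
  show "portrait_map p ` lists X = lists X"
    using into onto by blast
qed

lemma vertex_perm_portrait_aut:
  assumes "\<And>v. v \<in> lists X \<Longrightarrow> p v \<in> Bij X" and "v \<in> lists X"
  shows "vertex_perm X (portrait_aut X p) v = p v"
  using assms(2) assms(1)[OF assms(2)]
  by (auto simp: vertex_perm_def portrait_aut_def portrait_map_append Bij_def fun_eq_iff
      restrict_def extensional_def)

lemma portrait_aut_in_AutT:
  assumes p: "\<And>v. v \<in> lists X \<Longrightarrow> p v \<in> Bij X"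
  shows "portrait_aut X p \<in> carrier (AutT X)"
proof -
  have bij: "bij_betw (portrait_map p) (lists X) (lists X)"
    by (rule portrait_map_bij) (use p in \<open>auto simp: Bij_def\<close>)
  have mem: "portrait_map p u \<in> lists X" if "u \<in> lists X" for u
    using bij that by (auto simp: bij_betw_def)
  have step: "(\<exists>z\<in>X. portrait_map p v = portrait_map p u @ [z]) \<longleftrightarrow> (\<exists>z\<in>X. v = u @ [z])"
    if u: "u \<in> lists X" and v: "v \<in> lists X" for u v
  proof
    assume "\<exists>z\<in>X. v = u @ [z]"
    then show "\<exists>z\<in>X. portrait_map p v = portrait_map p u @ [z]"
      using p[OF u] by (auto simp: portrait_map_append Bij_def bij_betw_def)
  next
    assume "\<exists>z\<in>X. portrait_map p v = portrait_map p u @ [z]"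
    then obtain z where z: "portrait_map p v = portrait_map p u @ [z]" by blast
    then have "length v = Suc (length u)"
      by (metis length_append_singleton length_portrait_map)
    then obtain u' a where v': "v = u' @ [a]" by (metis length_Suc_conv_rev)
    with z have "portrait_map p u' = portrait_map p u"
      by (simp add: portrait_map_append)
    moreover have "u' \<in> lists X" "a \<in> X" using v v' by auto
    ultimately have "u' = u"
      using bij u by (auto simp: bij_betw_def dest: inj_onD)
    then show "\<exists>z\<in>X. v = u @ [z]" using v' \<open>a \<in> X\<close> by blast
  qed
  have "adjacent X (portrait_map p u) (portrait_map p v) \<longleftrightarrow> adjacent X u v"
    if "u \<in> lists X" "v \<in> lists X" for u v
    using step[OF that] step[OF that(2,1)] mem that unfolding adjacent_def by blast
  moreover have "portrait_aut X p \<in> Bij (lists X)"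
    using bij by (simp add: Bij_def portrait_aut_def bij_betw_restrict_eq)
  ultimately show ?thesis
    by (simp add: AutT_def portrait_aut_def)
qed

lemma directed_aut_rec:
  assumes "s \<in> Bij X" "x \<in> X" "y \<in> X" "x \<noteq> y" "u \<in> lists X"
  shows "directed_aut X x y s (y # u) = y # directed_aut X x y s u"
    and "directed_aut X x y s (x # u) = x # rooted_aut X s u"
    and "z \<in> X \<Longrightarrow> z \<noteq> x \<Longrightarrow> z \<noteq> y \<Longrightarrow> directed_aut X x y s (z # u) = z # u"
    and "directed_aut X x y s [] = []"
proof -
  have triv: "portrait_map (\<lambda>v. \<lambda>z\<in>X. z) w = w" if "w \<in> lists X" for w
    using that by (induction w rule: list.induct) auto
  have y: "(\<exists>k. y # v = replicate k y @ [x]) \<longleftrightarrow> (\<exists>k. v = replicate k y @ [x])" for v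
  proof
    assume "\<exists>k. y # v = replicate k y @ [x]"
    then obtain k where k: "y # v = replicate k y @ [x]" by blast
    then show "\<exists>k. v = replicate k y @ [x]" using assms(4) by (cases k) auto
  next
    assume "\<exists>k. v = replicate k y @ [x]"
    then obtain k where "v = replicate k y @ [x]" by blast
    then have "y # v = replicate (Suc k) y @ [x]" by simp
    then show "\<exists>k. y # v = replicate k y @ [x]" by blast
  qed
  have x: "(\<exists>k. x # v = replicate k y @ [x]) \<longleftrightarrow> v = []" for v
  proof
    assume "\<exists>k. x # v = replicate k y @ [x]"
    then obtain k where k: "x # v = replicate k y @ [x]" by blast
    then show "v = []" using assms(4) by (cases k) auto
  qed (auto intro: exI[of _ 0])
  have z: "\<not> (\<exists>k. z # v = replicate k y @ [x])" if "z \<noteq> x" "z \<noteq> y" for z v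
  proof
    assume "\<exists>k. z # v = replicate k y @ [x]"
    then obtain k where k: "z # v = replicate k y @ [x]" by blast
    then show False using that by (cases k) auto
  qed
  show "directed_aut X x y s (y # u) = y # directed_aut X x y s u"
    using assms by (simp add: directed_aut_def portrait_aut_def y)
  show "directed_aut X x y s (x # u) = x # rooted_aut X s u"
    using assms by (simp add: directed_aut_def rooted_aut_def portrait_aut_def x)
  show "directed_aut X x y s (z # u) = z # u" if "z \<in> X" "z \<noteq> x" "z \<noteq> y"
    using assms that by (simp add: directed_aut_def portrait_aut_def z triv)
  show "directed_aut X x y s [] = []"
    by (simp add: directed_aut_def portrait_aut_def)
qed


section \<open>Passing from \<open>X\<close> to \<open>X \<times> X\<close>\<close>

text \<open>The \<open>n\<close>-th level of the tree over \<open>X \<times> X\<close> is the \<open>2n\<close>-th level of the tree over \<open>X\<close>.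
  Under this identification \<open>two_step X g\<close> is the restriction of \<open>g\<close> to the even levels.\<close>

definition unpair_word :: "('x \<times> 'x) list \<Rightarrow> 'x list" where
  "unpair_word w = concat (map (\<lambda>(a, b). [a, b]) w)"

fun pair_word :: "'x list \<Rightarrow> ('x \<times> 'x) list" where
  "pair_word (a # b # u) = (a, b) # pair_word u"
| "pair_word _ = []"

definition two_step ::
    "'x set \<Rightarrow> ('x list \<Rightarrow> 'x list) \<Rightarrow> ('x \<times> 'x) list \<Rightarrow> ('x \<times> 'x) list" where
  "two_step X g = (\<lambda>w\<in>lists (X \<times> X). pair_word (g (unpair_word w)))"

end

theory Submission
  imports Defs
begin

text \<open>
  Write \<open>P\<close> for the image of \<open>H\<close> in \<open>Sym X\<close>. Conjugating a directed generator by \<open>\<pi>\<close> keeps its section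
  at \<open>x\<close> and moves its section at \<open>y\<close> away, so commutators of such elements are supported below
  \<open>x\<close>. As \<open>H\<close> is perfect, \<open>G\<close> contains a copy of \<open>H\<close> below \<open>x\<close>, and hence a copy of \<open>G\<close> below every
  letter: \<open>G = G\<^sup>X \<rtimes> H\<close>. This makes \<open>G\<close> branch, and \<open>G\<close> contains the group \<open>F\<close> of all finitary
  automorphisms with vertex permutations in \<open>P\<close>, which is dense in \<open>W\<close> but proper in \<open>G\<close>.
  Since \<open>G\<close> is finitely generated, some maximal subgroup \<open>M\<close> contains \<open>F\<close>. If \<open>M\<close> had finite index,
  then of the copies of the directed group \<open>A \<cong> H\<close> below infinitely many incomparable vertices
  three would agree modulo \<open>M\<close>; commutators and perfectness put one copy inside \<open>M\<close>. Conjugating by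
  \<open>F\<close> and using that an element of \<open>A\<close> differs from its copy below \<open>y\<^sup>n\<close> by a finitary element gives
  \<open>A \<subseteq> M\<close>, so \<open>M = G\<close>.
\<close>

section \<open>Automorphisms of the rooted tree\<close>

text \<open>The maximal subgroup \<open>M\<close> need not be normal, so there is no quotient to
  work in: what is compared are the cosets of the individual elements of each copy of the directed
  group, for all elements at once. A coincidence between copies \<open>i\<close> and
  \<open>j\<close> only puts the quotients \<open>\<delta> i s \<cdot> \<delta> j (inv s)\<close>
  into \<open>M\<close>, and the commutator of two such quotients still carries a factor at
  \<open>j\<close>. Pairing \<open>i\<close> once with \<open>j\<close> and once with a third copy
  \<open>l\<close> puts the stray factors at different vertices, where they cancel. When
  \<open>condition_star\<close> fails, two levels of the tree are merged into one. A nontrivial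
  element in one coordinate of the base of the wreath square moves a point below one letter and
  fixes the points below every other letter, so two points of one orbit get different stabilizers;
  perfectness is inherited because the wreath square is generated by perfect subgroups. Restriction
  to the even levels then identifies the two infinite wreath powers, both as groups and as
  topological spaces.\<close>

lemma carrier_BijGroup [simp]: "carrier (BijGroup S) = Bij S"
  by (simp add: BijGroup_def)

lemma one_BijGroup [simp]: "\<one>\<^bsub>BijGroup S\<^esub> = (\<lambda>z\<in>S. z)"
  by (simp add: BijGroup_def)

lemma mult_BijGroup: "f \<in> Bij S \<Longrightarrow> g \<in> Bij S \<Longrightarrow> f \<otimes>\<^bsub>BijGroup S\<^esub> g = compose S f g"
  by (simp add: BijGroup_def)

lemma Bij_apply_mem: "s \<in> Bij X \<Longrightarrow> z \<in> X \<Longrightarrow> s z \<in> X"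
  using Bij_imp_funcset by (auto simp: Pi_iff)

lemma Bij_eq_iff: "s \<in> Bij X \<Longrightarrow> z \<in> X \<Longrightarrow> w \<in> X \<Longrightarrow> s z = s w \<longleftrightarrow> z = w"
  by (auto simp: Bij_def bij_betw_def dest: inj_onD)

lemma carrier_update: "carrier (M\<lparr>carrier := A\<rparr>) = A"
  by simp

lemma carrier_AutT:
  "g \<in> carrier (AutT X) \<longleftrightarrow> g \<in> Bij (lists X) \<and> g [] = [] \<and>
    (\<forall>u\<in>lists X. \<forall>v\<in>lists X. adjacent X (g u) (g v) \<longleftrightarrow> adjacent X u v)"
  unfolding AutT_def carrier_update by blast

lemma AutT_Bij: "g \<in> carrier (AutT X) \<Longrightarrow> g \<in> Bij (lists X)"
  unfolding carrier_AutT by blast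

lemma AutT_Nil [simp]: "g \<in> carrier (AutT X) \<Longrightarrow> g [] = []"
  unfolding carrier_AutT by blast

lemma AutT_adjacent:
  "g \<in> carrier (AutT X) \<Longrightarrow> u \<in> lists X \<Longrightarrow> v \<in> lists X \<Longrightarrow> adjacent X (g u) (g v) \<longleftrightarrow> adjacent X u v"
  unfolding carrier_AutT by blast

lemma subgroup_AutT: "subgroup (carrier (AutT X)) (BijGroup (lists X))"
proof (rule group.subgroupI[OF group_BijGroup])
  show "carrier (AutT X) \<subseteq> carrier (BijGroup (lists X))"
    by (auto simp: AutT_Bij)
  have "(\<lambda>v\<in>lists X. v) \<in> carrier (AutT X)"
    by (simp add: carrier_AutT id_Bij)
  then show "carrier (AutT X) \<noteq> {}" by blast
next
  fix g assume g: "g \<in> carrier (AutT X)"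
  note gB = AutT_Bij[OF g]
  have inv: "inv\<^bsub>BijGroup (lists X)\<^esub> g = (\<lambda>v\<in>lists X. inv_into (lists X) g v)"
    using gB by (rule inv_BijGroup)
  have mem: "inv_into (lists X) g v \<in> lists X" and gi: "g (inv_into (lists X) g v) = v"
    if "v \<in> lists X" for v
    using Bij_inv_into_mem[OF gB that] gB that
    by (auto simp: Bij_def bij_betw_def f_inv_into_f)
  have "inv_into (lists X) g [] = []"
    using g gB inv_into_f_f[of g "lists X" "[]"] by (auto simp: Bij_def bij_betw_def)
  moreover have "adjacent X (inv_into (lists X) g u) (inv_into (lists X) g v) \<longleftrightarrow> adjacent X u v"
    if "u \<in> lists X" "v \<in> lists X" for u v
    using AutT_adjacent[OF g mem[OF that(1)] mem[OF that(2)]] gi that by simp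
  ultimately show "inv\<^bsub>BijGroup (lists X)\<^esub> g \<in> carrier (AutT X)"
    using restrict_inv_into_Bij[OF gB] unfolding inv carrier_AutT by (auto simp del: in_lists_conv_set)
next
  fix g h assume g: "g \<in> carrier (AutT X)" and h: "h \<in> carrier (AutT X)"
  note gB = AutT_Bij[OF g] and hB = AutT_Bij[OF h]
  have hm: "h u \<in> lists X" if "u \<in> lists X" for u
    using Bij_apply_mem[OF hB that] .
  have "adjacent X (g (h u)) (g (h v)) \<longleftrightarrow> adjacent X u v" if "u \<in> lists X" "v \<in> lists X" for u v
    by (simp only: AutT_adjacent[OF g hm[OF that(1)] hm[OF that(2)]] AutT_adjacent[OF h that])
  moreover have "g (h []) = []" using g h by simp
  ultimately have "compose (lists X) g h \<in> carrier (AutT X)"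
    using compose_Bij[OF gB hB] unfolding carrier_AutT by (simp add: compose_eq del: in_lists_conv_set)
  then show "g \<otimes>\<^bsub>BijGroup (lists X)\<^esub> h \<in> carrier (AutT X)"
    by (simp add: mult_BijGroup gB hB)
qed

lemma AutT_alt: "AutT X = BijGroup (lists X)\<lparr>carrier := carrier (AutT X)\<rparr>"
  unfolding AutT_def carrier_update ..

lemma group_AutT: "group (AutT X)"
  by (subst AutT_alt) (rule subgroup.subgroup_is_group[OF subgroup_AutT group_BijGroup])

lemma one_AutT: "\<one>\<^bsub>AutT X\<^esub> = (\<lambda>v\<in>lists X. v)"
  by (subst AutT_alt) simp

lemma mult_AutT:
  "g \<in> carrier (AutT X) \<Longrightarrow> h \<in> carrier (AutT X) \<Longrightarrow> g \<otimes>\<^bsub>AutT X\<^esub> h = compose (lists X) g h"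
  by (subst AutT_alt) (simp add: mult_BijGroup AutT_Bij)

lemma AutT_mem_lists: "g \<in> carrier (AutT X) \<Longrightarrow> u \<in> lists X \<Longrightarrow> g u \<in> lists X"
  using AutT_Bij Bij_apply_mem by metis

text \<open>Automorphisms are only known to fix the root and to respect adjacency, so levels are
  recovered by induction from the root: the image of a child is adjacent to the image of its parent,
  and injectivity excludes that it is the image of the grandparent.\<close>

lemma AutT_extend:
  assumes g: "g \<in> carrier (AutT X)" and "u \<in> lists X" "z \<in> X"
  shows "\<exists>c\<in>X. g (u @ [z]) = g u @ [c]"
  using assms(2,3)
proof (induction u arbitrary: z rule: rev_induct)
  case Nil
  have "adjacent X (g []) (g [z])"
    using AutT_adjacent[OF g, of "[]" "[z]"] Nil by (auto simp: adjacent_def)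
  then show ?case using g by (auto simp: adjacent_def)
next
  case (snoc c u)
  then have u: "u \<in> lists X" "c \<in> X" by auto
  obtain d where d: "d \<in> X" "g (u @ [c]) = g u @ [d]" using snoc.IH[OF u] by blast
  have "adjacent X (g (u @ [c])) (g ((u @ [c]) @ [z]))"
    using AutT_adjacent[OF g, of "u @ [c]" "(u @ [c]) @ [z]"] snoc.prems u by (auto simp: adjacent_def)
  then consider e where "e \<in> X" "g ((u @ [c]) @ [z]) = g (u @ [c]) @ [e]"
    | e where "g (u @ [c]) = g ((u @ [c]) @ [z]) @ [e]"
    unfolding adjacent_def by blast
  then show ?case
  proof cases
    case 2
    then have "g u = g ((u @ [c]) @ [z])" using d by simp
    then have "u = (u @ [c]) @ [z]"
      using Bij_eq_iff[OF AutT_Bij[OF g]] u snoc.prems by auto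
    then show ?thesis by simp
  qed blast
qed

lemma AutT_snoc:
  assumes "g \<in> carrier (AutT X)" "u \<in> lists X" "z \<in> X"
  shows "g (u @ [z]) = g u @ [vertex_perm X g u z]" "vertex_perm X g u z \<in> X"
  using AutT_extend[OF assms] assms(3) by (auto simp: vertex_perm_def)

lemma AutT_length: "g \<in> carrier (AutT X) \<Longrightarrow> u \<in> lists X \<Longrightarrow> length (g u) = length u"
  by (induction u rule: rev_induct) (auto simp: AutT_snoc)

text \<open>\<open>X\<close> may be infinite here, so surjectivity is taken from that of
  \<open>g\<close>: a preimage of \<open>g u @ [c]\<close> is a child of some \<open>v\<close> with
  \<open>g v = g u\<close>, and injectivity gives \<open>v = u\<close>.\<close>

lemma vertex_perm_Bij:
  assumes g: "g \<in> carrier (AutT X)" and u: "u \<in> lists X"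
  shows "vertex_perm X g u \<in> Bij X"
proof -
  have "inj_on (vertex_perm X g u) X"
  proof (rule inj_onI)
    fix z w assume "z \<in> X" "w \<in> X" "vertex_perm X g u z = vertex_perm X g u w"
    then have "g (u @ [z]) = g (u @ [w])" by (simp add: AutT_snoc[OF g u])
    then show "z = w" using Bij_eq_iff[OF AutT_Bij[OF g]] u \<open>z \<in> X\<close> \<open>w \<in> X\<close> by auto
  qed
  moreover have "\<exists>z\<in>X. vertex_perm X g u z = c" if c: "c \<in> X" for c
  proof -
    have "g u @ [c] \<in> g ` lists X"
      using AutT_Bij[OF g] AutT_mem_lists[OF g u] c by (auto simp: Bij_def bij_betw_def)
    then obtain w where w: "w \<in> lists X" "g w = g u @ [c]" by (metis imageE)
    then have "length w = Suc (length u)"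
      using AutT_length[OF g] u by (metis length_append_singleton)
    then obtain v z where vz: "w = v @ [z]" by (metis length_Suc_conv_rev)
    then have v: "v \<in> lists X" "z \<in> X" using w by auto
    have "g v = g u" "vertex_perm X g v z = c" using w AutT_snoc[OF g v] vz by auto
    then have "v = u" using Bij_eq_iff[OF AutT_Bij[OF g]] u v by auto
    then show ?thesis using v \<open>vertex_perm X g v z = c\<close> by blast
  qed
  ultimately show ?thesis
    using AutT_snoc(2)[OF g u] by (auto simp: Bij_def bij_betw_def vertex_perm_def)
qed

lemma AutT_eq_portrait_aut:
  assumes g: "g \<in> carrier (AutT X)"
  shows "portrait_aut X (vertex_perm X g) = g"
proof
  have "portrait_map (vertex_perm X g) u = g u" if "u \<in> lists X" for u
    using that
    by (induction u rule: rev_induct) (auto simp: AutT_Nil[OF g] portrait_map_append AutT_snoc[OF g])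
  moreover have "g u = undefined" if "u \<notin> lists X" for u
    using AutT_Bij[OF g] that by (simp add: Bij_def extensional_def)
  ultimately show "portrait_aut X (vertex_perm X g) u = g u" for u
    by (auto simp: portrait_aut_def)
qed

lemma portrait_map_cong:
  assumes "u \<in> lists X" "\<And>v. v \<in> lists X \<Longrightarrow> p v = q v"
  shows "portrait_map p u = portrait_map q u"
  using assms by (induction u rule: rev_induct) (auto simp: portrait_map_append)

lemma portrait_aut_cong:
  "(\<And>v. v \<in> lists X \<Longrightarrow> p v = q v) \<Longrightarrow> portrait_aut X p = portrait_aut X q"
  using portrait_map_cong[of _ X p q] by (auto simp: portrait_aut_def restrict_def)


section \<open>Root permutation and sections\<close>

text \<open>This is the wreath recursion with root permutation \<open>s\<close> and sections
  \<open>f z\<close>. Sections are indexed by the letter before it is moved, which fixes the shape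
  of the product formula. The restriction to \<open>lists X\<close> makes nodes extensional, like
  all elements of \<open>AutT X\<close>.\<close>

definition node :: "'x set \<Rightarrow> ('x \<Rightarrow> 'x) \<Rightarrow> ('x \<Rightarrow> 'x list \<Rightarrow> 'x list) \<Rightarrow> 'x list \<Rightarrow> 'x list" where
  "node X s f = (\<lambda>v\<in>lists X. case v of [] \<Rightarrow> [] | z # u \<Rightarrow> s z # f z u)"

lemma node_Nil [simp]: "node X s f [] = []"
  by (simp add: node_def)

lemma node_Cons [simp]: "z \<in> X \<Longrightarrow> u \<in> lists X \<Longrightarrow> node X s f (z # u) = s z # f z u"
  by (simp add: node_def)

lemma node_cong:
  "(\<And>z. z \<in> X \<Longrightarrow> s z = t z) \<Longrightarrow> (\<And>z. z \<in> X \<Longrightarrow> f z = g z) \<Longrightarrow> node X s f = node X t g"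
  by (auto simp: node_def restrict_def split: list.splits)

text \<open>Translates sections into a portrait, so that membership in \<open>AutT X\<close> and the
  vertex permutations of a node come from the general facts on portraits.\<close>

lemma node_eq_portrait_aut:
  assumes "\<And>z. z \<in> X \<Longrightarrow> f z \<in> carrier (AutT X)"
  shows "node X s f = portrait_aut X (case_list s (\<lambda>z. vertex_perm X (f z)))"
proof -
  have "portrait_map (vertex_perm X (f z)) u = f z u" if "z \<in> X" "u \<in> lists X" for z u
    using AutT_eq_portrait_aut[OF assms[OF that(1)]] that by (metis portrait_aut_def restrict_apply')
  then show ?thesis
    by (auto simp: node_def portrait_aut_def restrict_def split: list.splits)
qed

lemma portrait_aut_eq_node:
  "portrait_aut X p = node X (p []) (\<lambda>z. portrait_aut X (\<lambda>v. p (z # v)))"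
  by (auto simp: node_def portrait_aut_def restrict_def split: list.splits)

lemma portrait_aut_trivial: "portrait_aut X (\<lambda>v. \<lambda>z\<in>X. z) = \<one>\<^bsub>AutT X\<^esub>"
proof -
  have "portrait_map (\<lambda>v. \<lambda>z\<in>X. z) w = w" if "w \<in> lists X" for w
    using that by (induction w rule: list.induct) auto
  then show ?thesis by (auto simp: portrait_aut_def one_AutT restrict_def)
qed

lemma case_list_vertex_perm_Bij:
  assumes "s \<in> Bij X" "\<And>z. z \<in> X \<Longrightarrow> f z \<in> carrier (AutT X)" "v \<in> lists X"
  shows "case_list s (\<lambda>z. vertex_perm X (f z)) v \<in> Bij X"
  using assms by (cases v) (auto intro: vertex_perm_Bij)

lemma node_in_AutT:
  assumes "s \<in> Bij X" "\<And>z. z \<in> X \<Longrightarrow> f z \<in> carrier (AutT X)"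
  shows "node X s f \<in> carrier (AutT X)"
proof -
  have "portrait_aut X (case_list s (\<lambda>z. vertex_perm X (f z))) \<in> carrier (AutT X)"
    using case_list_vertex_perm_Bij[OF assms] by (rule portrait_aut_in_AutT)
  then show ?thesis using assms(2) by (simp add: node_eq_portrait_aut)
qed

lemma vertex_perm_node:
  assumes "s \<in> Bij X" "\<And>z. z \<in> X \<Longrightarrow> f z \<in> carrier (AutT X)"
  shows "vertex_perm X (node X s f) [] = s"
    and "z \<in> X \<Longrightarrow> u \<in> lists X \<Longrightarrow> vertex_perm X (node X s f) (z # u) = vertex_perm X (f z) u"
  using vertex_perm_portrait_aut[OF case_list_vertex_perm_Bij[OF assms]]
  by (simp_all add: node_eq_portrait_aut assms(2) del: in_lists_conv_set)

lemma AutT_eq_node: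
  assumes g: "g \<in> carrier (AutT X)"
  obtains f where "f \<in> X \<rightarrow> carrier (AutT X)" "g = node X (vertex_perm X g []) f"
    "\<And>z u. z \<in> X \<Longrightarrow> u \<in> lists X \<Longrightarrow> vertex_perm X (f z) u = vertex_perm X g (z # u)"
proof
  let ?f = "\<lambda>z. portrait_aut X (\<lambda>v. vertex_perm X g (z # v))"
  show "?f \<in> X \<rightarrow> carrier (AutT X)"
    using vertex_perm_Bij[OF g] by (intro funcsetI portrait_aut_in_AutT) simp
  show "g = node X (vertex_perm X g []) ?f"
    using AutT_eq_portrait_aut[OF g] portrait_aut_eq_node by metis
  show "vertex_perm X (?f z) u = vertex_perm X g (z # u)" if "z \<in> X" "u \<in> lists X" for z u
    using vertex_perm_Bij[OF g] that by (intro vertex_perm_portrait_aut) simp_all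
qed

text \<open>The right factor acts first and sends \<open>z\<close> to \<open>t z\<close>, so the
  section of the left factor is taken there.\<close>

lemma node_mult:
  assumes "s \<in> Bij X" "t \<in> Bij X"
    and "\<And>z. z \<in> X \<Longrightarrow> f z \<in> carrier (AutT X)" "\<And>z. z \<in> X \<Longrightarrow> g z \<in> carrier (AutT X)"
  shows "node X s f \<otimes>\<^bsub>AutT X\<^esub> node X t g =
    node X (compose X s t) (\<lambda>z. f (t z) \<otimes>\<^bsub>AutT X\<^esub> g z)"
proof
  fix v
  show "(node X s f \<otimes>\<^bsub>AutT X\<^esub> node X t g) v =
    node X (compose X s t) (\<lambda>z. f (t z) \<otimes>\<^bsub>AutT X\<^esub> g z) v"
  proof (cases "v \<in> lists X \<and> v \<noteq> []")
    case True
    then obtain z u where v: "v = z # u" "z \<in> X" "u \<in> lists X" by (cases v) auto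
    then show ?thesis
      using assms AutT_mem_lists[OF assms(4)] Bij_apply_mem[OF assms(2)]
      by (simp add: mult_AutT node_in_AutT compose_eq del: in_lists_conv_set)
  next
    case False
    then show ?thesis
      using assms
      by (auto simp: mult_AutT node_in_AutT compose_def node_def[of X "\<lambda>x\<in>X. s (t x)"])
  qed
qed

lemma node_one: "node X (\<lambda>z\<in>X. z) (\<lambda>z. \<one>\<^bsub>AutT X\<^esub>) = \<one>\<^bsub>AutT X\<^esub>"
  by (auto simp: node_def one_AutT restrict_def split: list.splits)

lemma node_inv:
  assumes "s \<in> Bij X" "\<And>z. z \<in> X \<Longrightarrow> f z \<in> carrier (AutT X)"
  shows "inv\<^bsub>AutT X\<^esub> node X s f =
    node X (inv\<^bsub>BijGroup X\<^esub> s) (\<lambda>z. inv\<^bsub>AutT X\<^esub> f ((inv\<^bsub>BijGroup X\<^esub> s) z))"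
proof -
  interpret T: group "AutT X" by (rule group_AutT)
  interpret B: group "BijGroup X" by (rule group_BijGroup)
  let ?t = "inv\<^bsub>BijGroup X\<^esub> s"
  have t: "?t \<in> Bij X" using B.inv_closed[of s] assms(1) by simp
  have c: "compose X s ?t = (\<lambda>z\<in>X. z)" "compose X ?t s = (\<lambda>z\<in>X. z)"
    using B.r_inv[of s] B.l_inv[of s] assms(1) t by (simp_all add: mult_BijGroup)
  have st: "?t (s z) = z" if "z \<in> X" for z
    using fun_cong[OF c(2), of z] that by (simp add: compose_eq)
  have "node X ?t (\<lambda>z. inv\<^bsub>AutT X\<^esub> f (?t z)) \<otimes>\<^bsub>AutT X\<^esub> node X s f =
      node X (\<lambda>z\<in>X. z) (\<lambda>_. \<one>\<^bsub>AutT X\<^esub>)"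
    using assms t
    by (subst node_mult) (auto simp: c st Bij_apply_mem[OF t] intro!: node_cong)
  then show ?thesis
    using assms t
    by (intro T.inv_equality) (auto simp: node_one Bij_apply_mem[OF t] intro!: node_in_AutT)
qed

section \<open>Embedding automorphisms below a single letter\<close>

definition lift :: "'x set \<Rightarrow> 'x \<Rightarrow> ('x list \<Rightarrow> 'x list) \<Rightarrow> 'x list \<Rightarrow> 'x list" where
  "lift X z g = node X (\<lambda>w\<in>X. w) (\<lambda>w. if w = z then g else \<one>\<^bsub>AutT X\<^esub>)"

lemma lift_in_AutT [simp]: "g \<in> carrier (AutT X) \<Longrightarrow> lift X z g \<in> carrier (AutT X)"
  unfolding lift_def
  by (rule node_in_AutT) (auto simp: id_Bij group.is_monoid[OF group_AutT] monoid.one_closed)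

lemma lift_mult:
  assumes "g \<in> carrier (AutT X)" "h \<in> carrier (AutT X)"
  shows "lift X z (g \<otimes>\<^bsub>AutT X\<^esub> h) = lift X z g \<otimes>\<^bsub>AutT X\<^esub> lift X z h"
proof -
  interpret T: group "AutT X" by (rule group_AutT)
  show ?thesis unfolding lift_def using assms
    by (subst node_mult) (auto simp: id_Bij compose_def intro!: node_cong)
qed

lemma group_hom_lift: "group_hom (AutT X) (AutT X) (lift X z)"
  by (auto simp: group_hom_def group_hom_axioms_def hom_def group_AutT lift_mult)

text \<open>Below every letter at least one of the two sections is trivial.\<close>

lemma lift_commute:
  assumes "g \<in> carrier (AutT X)" "h \<in> carrier (AutT X)" "z \<noteq> w"
  shows "lift X z g \<otimes>\<^bsub>AutT X\<^esub> lift X w h = lift X w h \<otimes>\<^bsub>AutT X\<^esub> lift X z g"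
proof -
  interpret T: group "AutT X" by (rule group_AutT)
  show ?thesis unfolding lift_def using assms
    by (simp add: node_mult id_Bij) (auto intro!: node_cong)
qed

lemma vertex_perm_one: "vertex_perm X \<one>\<^bsub>AutT X\<^esub> u = (\<lambda>z\<in>X. z)" if "u \<in> lists X"
  using that by (auto simp: vertex_perm_def one_AutT restrict_def)

lemma vertex_perm_lift:
  assumes "g \<in> carrier (AutT X)" "w \<in> X" "u \<in> lists X"
  shows "vertex_perm X (lift X z g) (w # u) = (if w = z then vertex_perm X g u else (\<lambda>z\<in>X. z))"
proof -
  interpret T: group "AutT X" by (rule group_AutT)
  show ?thesis unfolding lift_def using assms
    by (subst vertex_perm_node) (auto simp: id_Bij vertex_perm_one)
qed

lemma vertex_perm_lift_Nil:
  assumes "g \<in> carrier (AutT X)"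
  shows "vertex_perm X (lift X z g) [] = (\<lambda>z\<in>X. z)"
proof -
  interpret T: group "AutT X" by (rule group_AutT)
  show ?thesis unfolding lift_def using assms
    by (subst vertex_perm_node) (auto simp: id_Bij)
qed

lemma rooted_aut_eq_node: "rooted_aut X s = node X s (\<lambda>_. \<one>\<^bsub>AutT X\<^esub>)"
  unfolding rooted_aut_def by (subst portrait_aut_eq_node) (simp add: portrait_aut_trivial)

text \<open>As \<open>x\<close> and \<open>y\<close> differ, the special vertices below
  \<open>y\<close> are \<open>y\<close> followed by a special vertex, and the only one below
  \<open>x\<close> is \<open>x\<close> itself. A directed element thus reproduces itself at
  \<open>y\<close>.\<close>

lemma directed_aut_eq_node:
  assumes "x \<noteq> y"
  shows "directed_aut X x y s = node X (\<lambda>z\<in>X. z)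
    (\<lambda>z. if z = x then rooted_aut X s else if z = y then directed_aut X x y s else \<one>\<^bsub>AutT X\<^esub>)"
proof -
  have y: "(\<exists>k. y # v = replicate k y @ [x]) \<longleftrightarrow> (\<exists>k. v = replicate k y @ [x])" for v
  proof -
    have "(\<exists>k. y # v = replicate k y @ [x]) \<longleftrightarrow>
      (y # v = [x] \<or> (\<exists>k. y # v = replicate (Suc k) y @ [x]))"
      by (metis (no_types) append_Nil not0_implies_Suc replicate_0)
    then show ?thesis using assms by auto
  qed
  have x: "(\<exists>k. x # v = replicate k y @ [x]) \<longleftrightarrow> v = []" for v
  proof -
    have "(\<exists>k. x # v = replicate k y @ [x]) \<longleftrightarrow>
      (x # v = [x] \<or> (\<exists>k. x # v = replicate (Suc k) y @ [x]))"
      by (metis (no_types) append_Nil not0_implies_Suc replicate_0)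
    then show ?thesis using assms by auto
  qed
  have z: "\<not> (\<exists>k. z # v = replicate k y @ [x])" if "z \<noteq> x" "z \<noteq> y" for z v
  proof
    assume "\<exists>k. z # v = replicate k y @ [x]"
    then obtain k where "z # v = replicate k y @ [x]" by blast
    then show False using that by (cases k) auto
  qed
  show ?thesis
    unfolding directed_aut_def
    by (subst portrait_aut_eq_node, rule node_cong)
      (auto simp: x y z portrait_aut_trivial rooted_aut_def)
qed

section \<open>Subgroups closed under composing sections\<close>

lemma inv_id_Bij: "inv\<^bsub>BijGroup X\<^esub> (\<lambda>z\<in>X. z) = (\<lambda>z\<in>X. z)"
  using monoid.inv_one[OF group.is_monoid[OF group_BijGroup[of X]]] by simp

lemma node_id_mult:
  assumes "\<And>z. z \<in> X \<Longrightarrow> f z \<in> carrier (AutT X)" "\<And>z. z \<in> X \<Longrightarrow> g z \<in> carrier (AutT X)"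
  shows "node X (\<lambda>z\<in>X. z) f \<otimes>\<^bsub>AutT X\<^esub> node X (\<lambda>z\<in>X. z) g =
    node X (\<lambda>z\<in>X. z) (\<lambda>z. f z \<otimes>\<^bsub>AutT X\<^esub> g z)"
  using assms by (subst node_mult) (auto simp: id_Bij compose_def intro!: node_cong)

lemma node_id_inv:
  assumes "\<And>z. z \<in> X \<Longrightarrow> f z \<in> carrier (AutT X)"
  shows "inv\<^bsub>AutT X\<^esub> node X (\<lambda>z\<in>X. z) f = node X (\<lambda>z\<in>X. z) (\<lambda>z. inv\<^bsub>AutT X\<^esub> f z)"
  using assms by (subst node_inv) (auto simp: id_Bij inv_id_Bij intro!: node_cong)

lemma node_id_commutator:
  assumes "\<And>z. z \<in> X \<Longrightarrow> f z \<in> carrier (AutT X)" "\<And>z. z \<in> X \<Longrightarrow> g z \<in> carrier (AutT X)"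
  shows "node X (\<lambda>z\<in>X. z) f \<otimes>\<^bsub>AutT X\<^esub> node X (\<lambda>z\<in>X. z) g \<otimes>\<^bsub>AutT X\<^esub>
      inv\<^bsub>AutT X\<^esub> (node X (\<lambda>z\<in>X. z) f) \<otimes>\<^bsub>AutT X\<^esub> inv\<^bsub>AutT X\<^esub> (node X (\<lambda>z\<in>X. z) g) =
    node X (\<lambda>z\<in>X. z)
      (\<lambda>z. f z \<otimes>\<^bsub>AutT X\<^esub> g z \<otimes>\<^bsub>AutT X\<^esub> inv\<^bsub>AutT X\<^esub> f z \<otimes>\<^bsub>AutT X\<^esub> inv\<^bsub>AutT X\<^esub> g z)"
proof -
  interpret T: group "AutT X" by (rule group_AutT)
  show ?thesis using assms by (simp add: node_id_mult node_id_inv)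
qed

text \<open>A node with trivial root permutation is the product of the lifts of its sections. As
  \<open>X\<close> is finite, the letters are filled in one at a time, with trivial sections at
  those still missing.\<close>

lemma node_id_mem:
  assumes K: "subgroup K (AutT X)" and "finite X"
    and f: "\<And>z. z \<in> X \<Longrightarrow> f z \<in> carrier (AutT X)" and K': "\<And>z. z \<in> X \<Longrightarrow> lift X z (f z) \<in> K"
  shows "node X (\<lambda>z\<in>X. z) f \<in> K"
proof -
  interpret T: group "AutT X" by (rule group_AutT)
  have "node X (\<lambda>z\<in>X. z) (\<lambda>z. if z \<in> Y then f z else \<one>\<^bsub>AutT X\<^esub>) \<in> K" if "finite Y" "Y \<subseteq> X" for Y
    using that
  proof (induction Y)
    case empty
    then show ?case
      using subgroup.one_closed[OF K] by (simp only: empty_iff if_False node_one)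
  next
    case (insert w Y)
    have eq: "node X (\<lambda>z\<in>X. z) (\<lambda>z. if z \<in> insert w Y then f z else \<one>\<^bsub>AutT X\<^esub>) =
        lift X w (f w) \<otimes>\<^bsub>AutT X\<^esub> node X (\<lambda>z\<in>X. z) (\<lambda>z. if z \<in> Y then f z else \<one>\<^bsub>AutT X\<^esub>)"
      using insert f unfolding lift_def by (subst node_id_mult) (auto intro!: node_cong)
    have "w \<in> X" "Y \<subseteq> X" using insert.prems by auto
    then show ?case
      unfolding eq by (intro subgroup.m_closed[OF K] K' insert.IH)
  qed
  from this[OF \<open>finite X\<close>] have "node X (\<lambda>z\<in>X. z) (\<lambda>z. if z \<in> X then f z else \<one>\<^bsub>AutT X\<^esub>) \<in> K"
    by simp
  then show ?thesis by (simp cong: node_cong)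
qed

text \<open>The set is a copy of the wreath product of \<open>K\<close> by \<open>P\<close>. It is
  used with \<open>K = G\<close> to bound \<open>G\<close> from above, and with the finitary groups
  to climb one level.\<close>

lemma subgroup_nodes:
  assumes P: "subgroup P (BijGroup X)" and K: "subgroup K (AutT X)"
  shows "subgroup {node X s f | s f. s \<in> P \<and> f \<in> X \<rightarrow> K} (AutT X)"
proof -
  interpret T: group "AutT X" by (rule group_AutT)
  have PB: "s \<in> Bij X" if "s \<in> P" for s using subgroup.mem_carrier[OF P that] by simp
  have KT: "k \<in> carrier (AutT X)" if "k \<in> K" for k using subgroup.mem_carrier[OF K that] .
  show ?thesis
  proof (rule T.subgroupI)
    show "{node X s f |s f. s \<in> P \<and> f \<in> X \<rightarrow> K} \<subseteq> carrier (AutT X)"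
      by (auto intro!: node_in_AutT PB intro: KT)
    have "node X \<one>\<^bsub>BijGroup X\<^esub> (\<lambda>_. \<one>\<^bsub>AutT X\<^esub>) \<in> {node X s f |s f. s \<in> P \<and> f \<in> X \<rightarrow> K}"
      using subgroup.one_closed[OF P] subgroup.one_closed[OF K] by blast
    then show "{node X s f |s f. s \<in> P \<and> f \<in> X \<rightarrow> K} \<noteq> {}" by blast
  next
    fix g assume "g \<in> {node X s f |s f. s \<in> P \<and> f \<in> X \<rightarrow> K}"
    then obtain s f where g: "g = node X s f" "s \<in> P" "f \<in> X \<rightarrow> K" by blast
    have t: "inv\<^bsub>BijGroup X\<^esub> s \<in> P" using subgroup.m_inv_closed[OF P g(2)] .
    have "(\<lambda>z. inv\<^bsub>AutT X\<^esub> f ((inv\<^bsub>BijGroup X\<^esub> s) z)) \<in> X \<rightarrow> K"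
      using g(3) Bij_apply_mem[OF PB[OF t]] subgroup.m_inv_closed[OF K] by (auto simp: Pi_iff)
    moreover have "inv\<^bsub>AutT X\<^esub> g =
        node X (inv\<^bsub>BijGroup X\<^esub> s) (\<lambda>z. inv\<^bsub>AutT X\<^esub> f ((inv\<^bsub>BijGroup X\<^esub> s) z))"
      unfolding g(1) by (rule node_inv) (use g PB KT in auto)
    ultimately show "inv\<^bsub>AutT X\<^esub> g \<in> {node X s f |s f. s \<in> P \<and> f \<in> X \<rightarrow> K}"
      using t by blast
  next
    fix g h
    assume "g \<in> {node X s f |s f. s \<in> P \<and> f \<in> X \<rightarrow> K}" "h \<in> {node X s f |s f. s \<in> P \<and> f \<in> X \<rightarrow> K}"
    then obtain s f t f' where g: "g = node X s f" "s \<in> P" "f \<in> X \<rightarrow> K"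
      and h: "h = node X t f'" "t \<in> P" "f' \<in> X \<rightarrow> K" by blast
    have "(\<lambda>z. f (t z) \<otimes>\<^bsub>AutT X\<^esub> f' z) \<in> X \<rightarrow> K"
      using g(3) h(3) Bij_apply_mem[OF PB[OF h(2)]] subgroup.m_closed[OF K] by (auto simp: Pi_iff)
    moreover have "compose X s t \<in> P"
      using subgroup.m_closed[OF P g(2) h(2)] PB g(2) h(2) by (simp add: mult_BijGroup)
    moreover have "g \<otimes>\<^bsub>AutT X\<^esub> h = node X (compose X s t) (\<lambda>z. f (t z) \<otimes>\<^bsub>AutT X\<^esub> f' z)"
      unfolding g(1) h(1) by (rule node_mult) (use g h PB KT in auto)
    ultimately show "g \<otimes>\<^bsub>AutT X\<^esub> h \<in> {node X s f |s f. s \<in> P \<and> f \<in> X \<rightarrow> K}" by blast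
  qed
qed

section \<open>Rooted and directed automorphisms as homomorphic images of permutations\<close>

lemma rooted_aut_in_AutT: "s \<in> Bij X \<Longrightarrow> rooted_aut X s \<in> carrier (AutT X)"
  unfolding rooted_aut_def by (rule portrait_aut_in_AutT) (simp add: id_Bij)

lemma directed_aut_in_AutT: "s \<in> Bij X \<Longrightarrow> directed_aut X x y s \<in> carrier (AutT X)"
  unfolding directed_aut_def by (rule portrait_aut_in_AutT) (simp add: id_Bij)

lemma group_hom_rooted_aut: "group_hom (BijGroup X) (AutT X) (rooted_aut X)"
proof -
  interpret T: group "AutT X" by (rule group_AutT)
  have "rooted_aut X (s \<otimes>\<^bsub>BijGroup X\<^esub> t) = rooted_aut X s \<otimes>\<^bsub>AutT X\<^esub> rooted_aut X t"
    if "s \<in> Bij X" "t \<in> Bij X" for s t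
    using that by (simp add: rooted_aut_eq_node mult_BijGroup node_mult)
  then show ?thesis
    by (auto simp: group_hom_def group_hom_axioms_def hom_def group_AutT group_BijGroup
        rooted_aut_in_AutT)
qed

text \<open>Comparing sections would be circular, since the section at \<open>y\<close> is the claim
  itself; induction on the word breaks the circle, because the word left below \<open>y\<close> is
  shorter.\<close>

lemma directed_aut_compose:
  assumes s: "s \<in> Bij X" and t: "t \<in> Bij X" and xy: "x \<in> X" "y \<in> X" "x \<noteq> y"
  shows "directed_aut X x y s \<otimes>\<^bsub>AutT X\<^esub> directed_aut X x y t = directed_aut X x y (compose X s t)"
proof -
  note st = compose_Bij[OF s t]
  note rec = directed_aut_rec[OF _ xy]
  have r: "rooted_aut X s (rooted_aut X t u) = rooted_aut X (compose X s t) u" if "u \<in> lists X" for u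
  proof -
    interpret R: group_hom "BijGroup X" "AutT X" "rooted_aut X" by (rule group_hom_rooted_aut)
    have "rooted_aut X (compose X s t) = compose (lists X) (rooted_aut X s) (rooted_aut X t)"
      using R.hom_mult[of s t] s t by (simp add: mult_BijGroup mult_AutT rooted_aut_in_AutT)
    then show ?thesis using that by (simp add: compose_eq)
  qed
  have "directed_aut X x y s (directed_aut X x y t u) = directed_aut X x y (compose X s t) u"
    if "u \<in> lists X" for u
    using that
  proof (induction u rule: list.induct)
    case Nil
    then show ?case by (simp only: rec(4)[OF s lists.Nil] rec(4)[OF t lists.Nil] rec(4)[OF st lists.Nil])
  next
    case (Cons z u)
    then have z: "z \<in> X" and u: "u \<in> lists X" by auto
    have m: "directed_aut X x y t u \<in> lists X" "rooted_aut X t u \<in> lists X"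
      using AutT_mem_lists[OF directed_aut_in_AutT[OF t] u] AutT_mem_lists[OF rooted_aut_in_AutT[OF t] u] .
    consider "z = y" | "z = x" | "z \<noteq> x" "z \<noteq> y" by blast
    then show ?case
    proof cases
      case 1
      then show ?thesis
        by (simp only: rec(1)[OF t u] rec(1)[OF s m(1)] rec(1)[OF st u] Cons.IH[OF u])
    next
      case 2
      then show ?thesis
        by (simp only: rec(2)[OF t u] rec(2)[OF s m(2)] rec(2)[OF st u] r[OF u])
    next
      case 3
      show ?thesis
        by (simp only: rec(3)[OF t u z 3] rec(3)[OF s u z 3] rec(3)[OF st u z 3])
    qed
  qed
  then show ?thesis
    using Bij_imp_extensional[OF AutT_Bij[OF directed_aut_in_AutT[OF st]]] s t
    by (intro extensionalityI[of _ "lists X"])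
      (auto simp: mult_AutT directed_aut_in_AutT compose_eq simp del: in_lists_conv_set)
qed

lemma group_hom_directed_aut:
  assumes "x \<in> X" "y \<in> X" "x \<noteq> y"
  shows "group_hom (BijGroup X) (AutT X) (directed_aut X x y)"
  using assms by (auto simp: group_hom_def group_hom_axioms_def hom_def group_AutT group_BijGroup
      directed_aut_in_AutT mult_BijGroup directed_aut_compose)

text \<open>Conjugation by a rooted element carries the copy below \<open>z\<close> to the copy
  below \<open>s z\<close>. The form without inverses keeps the calculation to products of
  nodes.\<close>

lemma rooted_aut_lift:
  assumes s: "s \<in> Bij X" and z: "z \<in> X" and g: "g \<in> carrier (AutT X)"
  shows "rooted_aut X s \<otimes>\<^bsub>AutT X\<^esub> lift X z g = lift X (s z) g \<otimes>\<^bsub>AutT X\<^esub> rooted_aut X s"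
proof -
  interpret T: group "AutT X" by (rule group_AutT)
  have "compose X s (\<lambda>w\<in>X. w) w = compose X (\<lambda>w\<in>X. w) s w" if "w \<in> X" for w
    using that Bij_apply_mem[OF s that] by (simp add: compose_eq)
  then show ?thesis
    using s z g Bij_eq_iff[OF s _ z]
    by (auto simp: rooted_aut_eq_node lift_def node_mult id_Bij intro!: node_cong)
qed

section \<open>The group generated by rooted and directed automorphisms\<close>

text \<open>\<open>P\<close> stands for the image of the abstract group in the symmetric group of
  \<open>X\<close>. That \<open>x\<close> and \<open>y\<close> differ follows from
  \<open>\<pi>\<close> fixing one and moving the other.\<close>

locale perfect_perm_group =
  fixes X :: "'x set" and P :: "('x \<Rightarrow> 'x) set" and x y :: 'x and \<pi> :: "'x \<Rightarrow> 'x"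
  assumes finite_X: "finite X" and subgroup_P: "subgroup P (BijGroup X)"
    and perfect_P: "derived (BijGroup X) P = P"
    and transitive_P: "\<And>a b. a \<in> X \<Longrightarrow> b \<in> X \<Longrightarrow> \<exists>s\<in>P. s a = b"
    and x: "x \<in> X" and y: "y \<in> X" and \<pi>: "\<pi> \<in> P" "\<pi> x = x" "\<pi> y \<noteq> y"
begin

sublocale T: group "AutT X" by (rule group_AutT)

sublocale B: group "BijGroup X" by (rule group_BijGroup)

abbreviation tree_mult (infixl "\<cdot>" 70) where "g \<cdot> h \<equiv> g \<otimes>\<^bsub>AutT X\<^esub> h"

abbreviation "T \<equiv> carrier (AutT X)"

abbreviation "rooted \<equiv> rooted_aut X"

abbreviation "directed \<equiv> directed_aut X x y"

abbreviation "unit \<equiv> \<one>\<^bsub>AutT X\<^esub>"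

text \<open>All of \<open>P\<close> replaces a chosen list of generators. The group is the same
  because rooted and directed elements depend homomorphically on the permutation, and the generating
  set is still finite.\<close>

definition G :: "('x list \<Rightarrow> 'x list) set" where
  "G = generate (AutT X) (rooted ` P \<union> directed ` P)"

lemma xy: "x \<noteq> y" using \<pi> by auto

lemma P_Bij: "s \<in> P \<Longrightarrow> s \<in> Bij X"
  using subgroup.mem_carrier[OF subgroup_P] by simp

lemma P_id: "(\<lambda>z\<in>X. z) \<in> P"
  using subgroup.one_closed[OF subgroup_P] by simp

lemma rooted_T: "s \<in> P \<Longrightarrow> rooted s \<in> T"
  by (simp add: rooted_aut_in_AutT P_Bij)

lemma directed_T: "s \<in> P \<Longrightarrow> directed s \<in> T"
  by (simp add: directed_aut_in_AutT P_Bij)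

lemma generators_T: "rooted ` P \<union> directed ` P \<subseteq> T"
  using rooted_T directed_T by auto

lemma subgroup_G: "subgroup G (AutT X)"
  unfolding G_def by (rule T.generate_is_subgroup[OF generators_T])

lemma G_T: "g \<in> G \<Longrightarrow> g \<in> T"
  using subgroup.mem_carrier[OF subgroup_G] .

lemma G_mult: "g \<in> G \<Longrightarrow> h \<in> G \<Longrightarrow> g \<cdot> h \<in> G"
  using subgroup.m_closed[OF subgroup_G] .

lemma G_inv: "g \<in> G \<Longrightarrow> inv\<^bsub>AutT X\<^esub> g \<in> G"
  using subgroup.m_inv_closed[OF subgroup_G] .

lemma rooted_G: "s \<in> P \<Longrightarrow> rooted s \<in> G"
  unfolding G_def by (intro generate.incl) auto

lemma directed_G: "s \<in> P \<Longrightarrow> directed s \<in> G"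
  unfolding G_def by (intro generate.incl) auto

lemma directed_eq_node:
  "directed s = node X (\<lambda>z\<in>X. z) (\<lambda>z. if z = x then rooted s else if z = y then directed s else unit)"
  by (rule directed_aut_eq_node[OF xy])

lemma directed_eq_lifts:
  assumes "s \<in> P" shows "directed s = lift X x (rooted s) \<cdot> lift X y (directed s)"
proof -
  have "lift X x (rooted s) \<cdot> lift X y (directed s) =
    node X (\<lambda>z\<in>X. z) (\<lambda>z. if z = x then rooted s else if z = y then directed s else unit)"
    unfolding lift_def using assms xy rooted_T directed_T
    by (subst node_id_mult) (auto intro!: node_cong)
  then show ?thesis using directed_eq_node by metis
qed

text \<open>Conjugating \<open>directed b\<close> by \<open>\<pi>\<close> keeps the section at \<open>x\<close> and moves the one at \<open>y\<close> away, so
  the commutator with \<open>directed a\<close> is concentrated below \<open>x\<close>.\<close>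

lemma lift_commutator_G:
  assumes a: "a \<in> P" and b: "b \<in> P"
  shows "lift X x (rooted a \<cdot> rooted b \<cdot> inv\<^bsub>AutT X\<^esub> rooted a \<cdot> inv\<^bsub>AutT X\<^esub> rooted b) \<in> G"
proof -
  let ?f = "\<lambda>z. if z = x then rooted a else if z = y then directed a else unit"
  let ?g = "\<lambda>z. if z = x then rooted b else if z = y then directed b else unit"
  let ?h = "\<lambda>z. if z = x then rooted b else if z = \<pi> y then directed b else unit"
  let ?c = "node X (\<lambda>z\<in>X. z) ?h"
  note T_simps = rooted_T[OF a] rooted_T[OF b] directed_T[OF a] directed_T[OF b]
  note piB = P_Bij[OF \<pi>(1)]
  have cT: "?c \<in> T" by (rule node_in_AutT) (auto simp: id_Bij T_simps)
  have pix: "\<pi> z = x \<longleftrightarrow> z = x" and piy: "\<pi> z = \<pi> y \<longleftrightarrow> z = y" if "z \<in> X" for z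
    using Bij_eq_iff[OF piB that x] Bij_eq_iff[OF piB that y] \<pi>(2) by auto
  have pyx: "\<pi> y \<noteq> x" using pix[OF y] xy by simp
  have "?c \<cdot> rooted \<pi> = node X (compose X (\<lambda>z\<in>X. z) \<pi>) (\<lambda>z. ?h (\<pi> z) \<cdot> unit)"
    unfolding rooted_aut_eq_node[of X \<pi>]
    by (rule node_mult) (auto simp: id_Bij piB T_simps)
  also have "\<dots> = node X (compose X \<pi> (\<lambda>z\<in>X. z)) (\<lambda>z. unit \<cdot> ?g z)"
    by (rule node_cong) (auto simp: compose_eq Bij_apply_mem[OF piB] pix piy T_simps)
  also have "\<dots> = node X \<pi> (\<lambda>_. unit) \<cdot> node X (\<lambda>z\<in>X. z) ?g"
    by (subst node_mult) (auto simp: id_Bij piB T_simps intro!: node_cong)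
  also have "\<dots> = rooted \<pi> \<cdot> directed b"
    by (simp only: rooted_aut_eq_node[of X \<pi>] directed_eq_node[of b, symmetric])
  finally have "?c = rooted \<pi> \<cdot> directed b \<cdot> inv\<^bsub>AutT X\<^esub> rooted \<pi>"
    by (simp only: T.inv_solve_right[OF cT T.m_closed[OF rooted_T[OF \<pi>(1)] T_simps(4)] rooted_T[OF \<pi>(1)]])
  then have "?c \<in> G"
    by (simp only: G_mult G_inv rooted_G[OF \<pi>(1)] directed_G[OF b])
  then have mem: "directed a \<cdot> ?c \<cdot> inv\<^bsub>AutT X\<^esub> directed a \<cdot> inv\<^bsub>AutT X\<^esub> ?c \<in> G"
    by (intro G_mult G_inv directed_G a)
  have "directed a \<cdot> ?c \<cdot> inv\<^bsub>AutT X\<^esub> directed a \<cdot> inv\<^bsub>AutT X\<^esub> ?c =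
      node X (\<lambda>z\<in>X. z) (\<lambda>z. ?f z \<cdot> ?h z \<cdot> inv\<^bsub>AutT X\<^esub> ?f z \<cdot> inv\<^bsub>AutT X\<^esub> ?h z)"
    by (subst (1 2) directed_eq_node, rule node_id_commutator) (auto simp: T_simps)
  \<comment> \<open>At \<open>y\<close> the section of \<open>?c\<close> is trivial, and at
    \<open>\<pi> y\<close> that of \<open>directed a\<close>, because \<open>\<pi> y\<close> is
    neither \<open>x\<close> nor \<open>y\<close>. A commutator with a trivial entry is trivial, so
    only \<open>x\<close> survives.\<close>
  also have "\<dots> = lift X x (rooted a \<cdot> rooted b \<cdot> inv\<^bsub>AutT X\<^esub> rooted a \<cdot> inv\<^bsub>AutT X\<^esub> rooted b)"
    unfolding lift_def using T_simps xy \<pi>(3) pyx by (intro node_cong) auto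
  finally show ?thesis using mem by (simp only:)
qed

text \<open>As \<open>P\<close> is perfect, its image under \<open>\<kappa>\<close> is generated by
  commutators of image elements, so a subgroup containing these contains the whole image. The
  argument serves twice: for the rooted copy below \<open>x\<close>, and for a directed copy inside
  a subgroup of finite index.\<close>

lemma perfect_image:
  assumes K: "group_hom (BijGroup X) (AutT X) \<kappa>" and M: "subgroup M (AutT X)"
    and comm: "\<And>a b. a \<in> P \<Longrightarrow> b \<in> P \<Longrightarrow>
      \<kappa> a \<cdot> \<kappa> b \<cdot> inv\<^bsub>AutT X\<^esub> \<kappa> a \<cdot> inv\<^bsub>AutT X\<^esub> \<kappa> b \<in> M"
    and s: "s \<in> P"
  shows "\<kappa> s \<in> M"
proof -
  interpret K: group_hom "BijGroup X" "AutT X" \<kappa> by (rule K)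
  let ?D = "\<Union>a\<in>P. \<Union>b\<in>P. {a \<otimes>\<^bsub>BijGroup X\<^esub> b \<otimes>\<^bsub>BijGroup X\<^esub> inv\<^bsub>BijGroup X\<^esub> a \<otimes>\<^bsub>BijGroup X\<^esub> inv\<^bsub>BijGroup X\<^esub> b}"
  have sub: "?D \<subseteq> carrier (BijGroup X)"
    using B.derived_set_in_carrier[OF subgroup.subset[OF subgroup_P]] .
  have "\<kappa> ` P = generate (AutT X) (\<kappa> ` ?D)"
    using K.generate_img[OF sub] perfect_P by (simp add: derived_def)
  also have "\<dots> \<subseteq> M"
  proof (rule T.generate_subgroup_incl[OF _ M])
    have "\<kappa> (a \<otimes>\<^bsub>BijGroup X\<^esub> b \<otimes>\<^bsub>BijGroup X\<^esub> inv\<^bsub>BijGroup X\<^esub> a \<otimes>\<^bsub>BijGroup X\<^esub>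
        inv\<^bsub>BijGroup X\<^esub> b) \<in> M" if "a \<in> P" "b \<in> P" for a b
    proof -
      have "a \<in> carrier (BijGroup X)" "b \<in> carrier (BijGroup X)"
        using that by (simp_all add: P_Bij)
      then show ?thesis
        using comm[OF that] by (simp only: K.hom_mult K.hom_inv B.m_closed B.inv_closed)
    qed
    then show "\<kappa> ` ?D \<subseteq> M" by blast
  qed
  finally show ?thesis using s by blast
qed

lemma lift_rooted_G:
  assumes "s \<in> P" shows "lift X x (rooted s) \<in> G"
proof (rule perfect_image[OF _ subgroup_G _ assms])
  interpret L: group_hom "AutT X" "AutT X" "lift X x" by (rule group_hom_lift)
  show "group_hom (BijGroup X) (AutT X) (\<lambda>s. lift X x (rooted s))"
    using Group.hom_compose[OF group_hom.homh[OF group_hom_rooted_aut] L.homh]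
    by (simp add: group_hom_def group_hom_axioms_def group_AutT group_BijGroup comp_def)
  show "lift X x (rooted a) \<cdot> lift X x (rooted b) \<cdot> inv\<^bsub>AutT X\<^esub> lift X x (rooted a) \<cdot>
      inv\<^bsub>AutT X\<^esub> lift X x (rooted b) \<in> G" if "a \<in> P" "b \<in> P" for a b
    using lift_commutator_G[OF that] that
    by (simp only: L.hom_mult L.hom_inv T.m_closed T.inv_closed rooted_T)
qed

lemma lift_transport:
  assumes "z \<in> X" "w \<in> X" "g \<in> T" "lift X z g \<in> G"
  shows "lift X w g \<in> G"
proof -
  obtain s where s: "s \<in> P" "s z = w" using transitive_P assms by blast
  have "rooted s \<cdot> lift X z g = lift X w g \<cdot> rooted s"
    using rooted_aut_lift[OF P_Bij[OF s(1)] assms(1,3)] s(2) by simp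
  then have "lift X w g = rooted s \<cdot> lift X z g \<cdot> inv\<^bsub>AutT X\<^esub> rooted s"
    using assms rooted_T[OF s(1)] by (metis T.inv_solve_right T.m_closed lift_in_AutT)
  then show ?thesis using assms(4) rooted_G[OF s(1)] by (simp add: G_mult G_inv)
qed

text \<open>Once the rooted part at \<open>x\<close> lies in \<open>G\<close>, it can be split off
  \<open>directed s\<close>, which leaves the section at \<open>y\<close> alone.\<close>

lemma lift_directed_G:
  assumes "s \<in> P" shows "lift X y (directed s) \<in> G"
proof -
  have "lift X y (directed s) = inv\<^bsub>AutT X\<^esub> lift X x (rooted s) \<cdot> directed s"
    using directed_eq_lifts[OF assms] rooted_T[OF assms] directed_T[OF assms]
    by (metis T.inv_solve_left lift_in_AutT)
  then show ?thesis
    using lift_rooted_G[OF assms] directed_G[OF assms] by (simp add: G_mult G_inv)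
qed

text \<open>Both kinds of generators have their copies below \<open>y\<close> in \<open>G\<close>,
  so the homomorphism \<open>lift X y\<close> maps \<open>G\<close> into itself; transitivity then
  reaches every other letter.\<close>

lemma lift_G:
  assumes g: "g \<in> G" and z: "z \<in> X"
  shows "lift X z g \<in> G"
proof -
  interpret L: group_hom "AutT X" "AutT X" "lift X y" by (rule group_hom_lift)
  have "lift X y ` G = generate (AutT X) (lift X y ` (rooted ` P \<union> directed ` P))"
    unfolding G_def by (rule L.generate_img[OF generators_T, symmetric])
  also have "\<dots> \<subseteq> G"
    using lift_directed_G lift_transport[OF x y rooted_T lift_rooted_G]
    by (intro T.generate_subgroup_incl[OF _ subgroup_G]) auto
  finally have "lift X y g \<in> G" using g by blast
  then show ?thesis using lift_transport[OF y z G_T[OF g]] by simp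
qed

text \<open>Root permutation and sections may be chosen independently. Together with
  \<open>G_node\<close> this identifies \<open>G\<close> with the wreath product of \<open>G\<close>
  by \<open>P\<close>.\<close>

lemma node_G:
  assumes s: "s \<in> P" and f: "\<And>z. z \<in> X \<Longrightarrow> f z \<in> G"
  shows "node X s f \<in> G"
proof -
  have "node X s f = rooted s \<cdot> node X (\<lambda>z\<in>X. z) f"
    unfolding rooted_aut_eq_node using P_Bij[OF s] f G_T
    by (subst node_mult) (auto simp: id_Bij compose_eq intro!: node_cong)
  moreover have "node X (\<lambda>z\<in>X. z) f \<in> G"
    using node_id_mem[OF subgroup_G finite_X, of f] f lift_G G_T by auto
  ultimately show ?thesis using rooted_G[OF s] by (simp add: G_mult)
qed

lemma G_node:
  assumes "g \<in> G"
  obtains s f where "s \<in> P" "f \<in> X \<rightarrow> G" "g = node X s f"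
proof -
  have "rooted ` P \<union> directed ` P \<subseteq> {node X s f | s f. s \<in> P \<and> f \<in> X \<rightarrow> G}"
  proof (intro Un_least image_subsetI)
    fix s assume s: "s \<in> P"
    have "rooted s = node X s (\<lambda>_. unit)" "(\<lambda>_. unit) \<in> X \<rightarrow> G"
      using subgroup.one_closed[OF subgroup_G] by (auto simp: rooted_aut_eq_node)
    then show "rooted s \<in> {node X s f | s f. s \<in> P \<and> f \<in> X \<rightarrow> G}" using s by blast
    have "(\<lambda>z. if z = x then rooted s else if z = y then directed s else unit) \<in> X \<rightarrow> G"
      using subgroup.one_closed[OF subgroup_G] rooted_G[OF s] directed_G[OF s] by auto
    then show "directed s \<in> {node X s f | s f. s \<in> P \<and> f \<in> X \<rightarrow> G}"
      using directed_eq_node[of s] P_id by blast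
  qed
  then have "G \<subseteq> {node X s f | s f. s \<in> P \<and> f \<in> X \<rightarrow> G}"
    unfolding G_def
    by (rule T.generate_subgroup_incl[OF _ subgroup_nodes[OF subgroup_P subgroup_G[unfolded G_def]]])
  then show ?thesis using assms that by blast
qed

lemma vertex_perm_G:
  assumes "v \<in> lists X" "g \<in> G"
  shows "vertex_perm X g v \<in> P"
  using assms
proof (induction v arbitrary: g rule: list.induct)
  case Nil
  obtain s f where "s \<in> P" "f \<in> X \<rightarrow> G" "g = node X s f" using G_node[OF Nil(2)] .
  then show ?case using G_T P_Bij by (subst \<open>g = _\<close>, subst vertex_perm_node) auto
next
  case (Cons z u)
  obtain s f where sf: "s \<in> P" "f \<in> X \<rightarrow> G" "g = node X s f" using G_node[OF Cons.prems(2)] .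
  have "z \<in> X" "u \<in> lists X" using Cons.prems by auto
  then have "vertex_perm X g (z # u) = vertex_perm X (f z) u"
    using sf G_T P_Bij by (simp only: sf(3), intro vertex_perm_node(2)) auto
  then show ?case using Cons.IH \<open>z \<in> X\<close> \<open>u \<in> lists X\<close> sf(2) by auto
qed

end

section \<open>Maximal subgroups, commutators and cosets\<close>

lemma subgroup_carrier_update_iff:
  assumes "group A" "subgroup K A"
  shows "subgroup M (A\<lparr>carrier := K\<rparr>) \<longleftrightarrow> subgroup M A \<and> M \<subseteq> K"
  using group.incl_subgroup[OF assms] group.subgroup_incl[OF assms(1) _ assms(2)]
    subgroup.subset[of M "A\<lparr>carrier := K\<rparr>"] by auto

text \<open>Zorn's lemma on the proper subgroups above \<open>F\<close>. Finite generation keeps the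
  union of a chain proper: if the union contained \<open>S\<close>, a single member would already
  contain \<open>S\<close> and hence be everything.\<close>

lemma (in group) exists_maximal_subgroup_containing:
  assumes S: "finite S" "S \<subseteq> carrier G" and F: "subgroup F G" "F \<subset> generate G S"
  shows "\<exists>M. F \<subseteq> M \<and> maximal_subgroup G (generate G S) M"
proof -
  let ?\<A> = "{M. subgroup M G \<and> F \<subseteq> M \<and> M \<subset> generate G S}"
  have "\<exists>M\<in>?\<A>. \<forall>K\<in>?\<A>. M \<subseteq> K \<longrightarrow> K = M"
  proof (rule subset_Zorn_nonempty)
    show "?\<A> \<noteq> {}" using F by blast
    fix \<C> assume ne: "\<C> \<noteq> {}" and chain: "subset.chain ?\<A> \<C>"
    have mem: "subgroup M G" "F \<subseteq> M" "M \<subset> generate G S" if "M \<in> \<C>" for M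
      using chain that by (auto simp: subset_chain_def)
    have "subgroup (\<Union>\<C>) G"
    proof (rule subgroupI)
      show "\<Union>\<C> \<subseteq> carrier G" using subgroup.subset[OF mem(1)] by blast
      show "\<Union>\<C> \<noteq> {}" using ne subgroup.one_closed[OF mem(1)] by blast
      show "inv a \<in> \<Union>\<C>" if a: "a \<in> \<Union>\<C>" for a
      proof -
        obtain M where M: "M \<in> \<C>" "a \<in> M" using a by blast
        then show ?thesis using subgroup.m_inv_closed[OF mem(1)[OF M(1)]] by blast
      qed
      show "a \<otimes> b \<in> \<Union>\<C>" if ab: "a \<in> \<Union>\<C>" "b \<in> \<Union>\<C>" for a b
      proof -
        obtain M N where MN: "M \<in> \<C>" "N \<in> \<C>" "a \<in> M" "b \<in> N" using ab by blast
        then have "M \<subseteq> N \<or> N \<subseteq> M" using chain by (auto simp: subset_chain_def)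
        then obtain L where L: "L \<in> \<C>" "a \<in> L" "b \<in> L" using MN by blast
        then show ?thesis using subgroup.m_closed[OF mem(1)[OF L(1)]] by blast
      qed
    qed
    moreover have "\<Union>\<C> \<noteq> generate G S"
    proof
      assume eq: "\<Union>\<C> = generate G S"
      have "S \<subseteq> \<Union>\<C>" unfolding eq by (auto intro: generate.incl)
      then obtain M where "M \<in> \<C>" "S \<subseteq> M"
        using finite_subset_Union_chain[OF S(1) _ ne chain] by blast
      then have "generate G S \<subseteq> M" using generate_subgroup_incl[OF _ mem(1)] by blast
      then show False using mem(3)[OF \<open>M \<in> \<C>\<close>] by blast
    qed
    ultimately show "\<Union>\<C> \<in> ?\<A>" using ne mem(2,3) by blast
  qed
  then obtain M where M: "M \<in> ?\<A>" "\<forall>K\<in>?\<A>. M \<subseteq> K \<longrightarrow> K = M" by blast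
  note iff = subgroup_carrier_update_iff[OF group_axioms generate_is_subgroup[OF S(2)]]
  have "maximal_subgroup G (generate G S) M"
    unfolding maximal_subgroup_def iff using M by (intro conjI allI impI) blast+
  then show ?thesis using M(1) by blast
qed

text \<open>The commutator of \<open>g\<close> and \<open>h\<close> is \<open>g h\<close> times the
  inverse of \<open>h g\<close>; for \<open>g = a c\<close> and \<open>h = b d\<close> both products
  end in \<open>c d\<close>, which cancels. In the application \<open>a\<close> and \<open>b\<close>
  live below one vertex, and \<open>c\<close> and \<open>d\<close> are the stray factors below two
  others.\<close>

lemma (in group) commutator_commuting_factors:
  assumes [simp]: "a \<in> carrier G" "b \<in> carrier G" "c \<in> carrier G" "d \<in> carrier G"
    and "c \<otimes> b = b \<otimes> c" "d \<otimes> a = a \<otimes> d" "d \<otimes> c = c \<otimes> d"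
  shows "(a \<otimes> c) \<otimes> (b \<otimes> d) \<otimes> inv (a \<otimes> c) \<otimes> inv (b \<otimes> d) = a \<otimes> b \<otimes> inv a \<otimes> inv b"
proof -
  have 1: "(a \<otimes> c) \<otimes> (b \<otimes> d) = (a \<otimes> b) \<otimes> (c \<otimes> d)"
    using assms(5) by (simp add: m_assoc) (simp add: m_assoc[symmetric])
  have "(b \<otimes> d) \<otimes> (a \<otimes> c) = b \<otimes> (d \<otimes> a) \<otimes> c" by (simp add: m_assoc)
  also have "\<dots> = b \<otimes> a \<otimes> (d \<otimes> c)" by (simp add: assms(6) m_assoc)
  finally have 2: "(b \<otimes> d) \<otimes> (a \<otimes> c) = (b \<otimes> a) \<otimes> (c \<otimes> d)" by (simp add: assms(7))
  have "(a \<otimes> c) \<otimes> (b \<otimes> d) \<otimes> inv (a \<otimes> c) \<otimes> inv (b \<otimes> d) =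
      (a \<otimes> c) \<otimes> (b \<otimes> d) \<otimes> inv ((b \<otimes> d) \<otimes> (a \<otimes> c))"
    by (subst inv_mult_group[of "b \<otimes> d"]) (simp_all add: m_assoc)
  also have "\<dots> = (a \<otimes> b) \<otimes> (c \<otimes> d) \<otimes> inv ((b \<otimes> a) \<otimes> (c \<otimes> d))" by (simp only: 1 2)
  also have "\<dots> = a \<otimes> b \<otimes> inv a \<otimes> inv b"
  proof -
    have cancel: "g \<otimes> (inv g \<otimes> h) = h" if "g \<in> carrier G" "h \<in> carrier G" for g h
      using that by (simp add: m_assoc[symmetric])
    show ?thesis by (simp add: inv_mult_group m_assoc cancel)
  qed
  finally show ?thesis .
qed

lemma (in group) rcos_eq_imp_mult_inv_mem:
  assumes M: "subgroup M G" and ab: "a \<in> carrier G" "b \<in> carrier G" and eq: "M #> a = M #> b"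
  shows "a \<otimes> inv b \<in> M"
proof -
  have "a \<in> M #> b" using rcos_self[OF ab(1) M] eq by simp
  then obtain m where m: "m \<in> M" "a = m \<otimes> b" by (auto simp: r_coset_def)
  then have "a \<otimes> inv b = m" using subgroup.mem_carrier[OF M m(1)] ab by (simp add: m_assoc)
  then show ?thesis using m by simp
qed


section \<open>Automorphisms supported below a vertex\<close>

text \<open>The fold makes the first letter of \<open>v\<close> the outermost lift, so
  \<open>g\<close> is placed below the vertex \<open>v\<close>.\<close>

abbreviation lifts :: "'x set \<Rightarrow> 'x list \<Rightarrow> ('x list \<Rightarrow> 'x list) \<Rightarrow> 'x list \<Rightarrow> 'x list" where
  "lifts X v \<equiv> foldr (lift X) v"

lemma lifts_in_AutT: "g \<in> carrier (AutT X) \<Longrightarrow> lifts X v g \<in> carrier (AutT X)"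
  by (induction v) auto

lemma group_hom_lifts: "group_hom (AutT X) (AutT X) (lifts X v)"
proof -
  have "lifts X v (g \<otimes>\<^bsub>AutT X\<^esub> h) = lifts X v g \<otimes>\<^bsub>AutT X\<^esub> lifts X v h"
    if "g \<in> carrier (AutT X)" "h \<in> carrier (AutT X)" for g h
    using that by (induction v) (simp_all add: lift_mult lifts_in_AutT)
  then show ?thesis
    by (auto simp: group_hom_def group_hom_axioms_def hom_def group_AutT lifts_in_AutT)
qed

text \<open>Descending along the common prefix leads to two different letters, where
  \<open>lift_commute\<close> applies; incomparability excludes that one word ends before.\<close>

lemma lifts_commute:
  assumes "g \<in> carrier (AutT X)" "h \<in> carrier (AutT X)" "\<not> prefix v w" "\<not> prefix w v"
  shows "lifts X v g \<otimes>\<^bsub>AutT X\<^esub> lifts X w h = lifts X w h \<otimes>\<^bsub>AutT X\<^esub> lifts X v g"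
  using assms(3,4)
proof (induction v arbitrary: w)
  case (Cons z v)
  then obtain z' w' where w: "w = z' # w'" by (cases w) auto
  note gh = lifts_in_AutT[OF assms(1), of v] lifts_in_AutT[OF assms(2), of w']
  show ?case
  proof (cases "z = z'")
    case True
    then have "lifts X v g \<otimes>\<^bsub>AutT X\<^esub> lifts X w' h = lifts X w' h \<otimes>\<^bsub>AutT X\<^esub> lifts X v g"
      using Cons w by simp
    then show ?thesis using True w gh by (simp add: lift_mult[symmetric])
  next
    case False
    then show ?thesis using w gh by (simp add: lift_commute)
  qed
qed simp

section \<open>Finitary automorphisms\<close>

text \<open>The \<open>n\<close>-fold iterated wreath product of \<open>P\<close>: vertex
  permutations from \<open>P\<close> above level \<open>n\<close> and trivial ones from level
  \<open>n\<close> on.\<close>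

primrec finitary :: "'x set \<Rightarrow> ('x \<Rightarrow> 'x) set \<Rightarrow> nat \<Rightarrow> ('x list \<Rightarrow> 'x list) set" where
  "finitary X P 0 = {\<one>\<^bsub>AutT X\<^esub>}"
| "finitary X P (Suc n) = {node X s f | s f. s \<in> P \<and> f \<in> X \<rightarrow> finitary X P n}"

context perfect_perm_group begin

abbreviation "Fin \<equiv> (\<Union>n. finitary X P n)"

lemma finite_P: "finite P"
proof (rule finite_subset)
  have "Bij X \<subseteq> X \<rightarrow>\<^sub>E X" by (auto simp: PiE_def Bij_def bij_betw_def)
  then show "P \<subseteq> X \<rightarrow>\<^sub>E X" using P_Bij by blast
  show "finite (X \<rightarrow>\<^sub>E X)" using finite_X by (simp add: finite_PiE)
qed

lemma subgroup_finitary: "subgroup (finitary X P n) (AutT X)"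
  by (induction n) (simp_all add: T.triv_subgroup subgroup_nodes[OF subgroup_P])

lemma finite_finitary: "finite (finitary X P n)"
proof (induction n)
  case (Suc n)
  have "finitary X P (Suc n) \<subseteq> (\<lambda>(s, f). node X s f) ` (P \<times> (X \<rightarrow>\<^sub>E finitary X P n))"
  proof
    fix g assume "g \<in> finitary X P (Suc n)"
    then obtain s f where g: "g = node X s f" "s \<in> P" "f \<in> X \<rightarrow> finitary X P n" by auto
    then have "g = node X s (restrict f X)" "restrict f X \<in> X \<rightarrow>\<^sub>E finitary X P n"
      by (auto intro: node_cong)
    then show "g \<in> (\<lambda>(s, f). node X s f) ` (P \<times> (X \<rightarrow>\<^sub>E finitary X P n))" using g(2) by force
  qed
  then show ?case
    using Suc finite_P finite_X by (meson finite_PiE finite_SigmaI finite_imageI finite_subset)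
qed simp

lemma finitary_Suc_mono: "finitary X P n \<subseteq> finitary X P (Suc n)"
proof (induction n)
  case 0
  have "unit = node X (\<lambda>z\<in>X. z) (\<lambda>_. unit)" by (simp only: node_one)
  then have "\<exists>s f. unit = node X s f \<and> s \<in> P \<and> f \<in> X \<rightarrow> {unit}" using P_id by blast
  then show ?case by simp
next
  case (Suc n)
  then show ?case by (simp only: finitary.simps(2)[of _ _ "Suc n"]) (fastforce simp: Pi_iff)
qed

lemma finitary_mono: "m \<le> n \<Longrightarrow> finitary X P m \<subseteq> finitary X P n"
  by (rule lift_Suc_mono_le[of "finitary X P"]) (rule finitary_Suc_mono)

text \<open>Finitely many sections have a common depth.\<close>

lemma node_Fin:
  assumes s: "s \<in> P" and f: "\<And>z. z \<in> X \<Longrightarrow> f z \<in> Fin"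
  shows "node X s f \<in> Fin"
proof -
  have "\<forall>z\<in>X. \<exists>n. f z \<in> finitary X P n" using f by blast
  then obtain N where N: "\<And>z. z \<in> X \<Longrightarrow> f z \<in> finitary X P (N z)"
    using bchoice[of X "\<lambda>z n. f z \<in> finitary X P n"] by blast
  have "f z \<in> finitary X P (Max (N ` X))" if "z \<in> X" for z
    using N[OF that] finitary_mono[of "N z" "Max (N ` X)"] finite_X that by auto
  then have "node X s f \<in> finitary X P (Suc (Max (N ` X)))" using s by auto
  then show ?thesis by blast
qed

lemma unit_Fin: "unit \<in> Fin"
  using finitary.simps(1) by blast

lemma rooted_Fin: "s \<in> P \<Longrightarrow> rooted s \<in> Fin"
  unfolding rooted_aut_eq_node by (rule node_Fin) (use unit_Fin in auto)

lemma subgroup_Fin: "subgroup Fin (AutT X)"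
proof (rule T.subgroupI)
  show "Fin \<subseteq> T" using subgroup.subset[OF subgroup_finitary] by blast
  show "Fin \<noteq> {}" using unit_Fin by blast
  show "inv\<^bsub>AutT X\<^esub> g \<in> Fin" if "g \<in> Fin" for g
    using that subgroup.m_inv_closed[OF subgroup_finitary] by blast
  show "g \<cdot> h \<in> Fin" if gh: "g \<in> Fin" "h \<in> Fin" for g h
  proof -
    obtain m n where "g \<in> finitary X P m" "h \<in> finitary X P n" using gh by blast
    then have "g \<in> finitary X P (max m n)" "h \<in> finitary X P (max m n)"
      using finitary_mono[of m "max m n"] finitary_mono[of n "max m n"] by auto
    then show ?thesis using subgroup.m_closed[OF subgroup_finitary] by blast
  qed
qed

lemma finitary_G: "finitary X P n \<subseteq> G"
proof (induction n)
  case 0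
  then show ?case using subgroup.one_closed[OF subgroup_G] by simp
next
  case (Suc n)
  then show ?case by (auto intro!: node_G)
qed

lemma Fin_T: "f \<in> Fin \<Longrightarrow> f \<in> T"
  using finitary_G G_T by blast

lemma vertex_perm_finitary:
  assumes "g \<in> finitary X P n" "v \<in> lists X" "n \<le> length v"
  shows "vertex_perm X g v = (\<lambda>z\<in>X. z)"
  using assms
proof (induction n arbitrary: g v)
  case 0
  then have "g = unit" by simp
  then show ?case using vertex_perm_one[OF 0(2)] by (simp only:)
next
  case (Suc n)
  obtain s f where g: "g = node X s f" "s \<in> P" "f \<in> X \<rightarrow> finitary X P n"
    using Suc.prems(1) by auto
  obtain z u where v: "v = z # u" "z \<in> X" "u \<in> lists X" using Suc.prems(2,3) by (cases v) auto
  have "vertex_perm X g v = vertex_perm X (f z) u"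
    unfolding g(1) v(1) using g v P_Bij finitary_G[of n] G_T
    by (intro vertex_perm_node(2)) (auto simp: Pi_iff)
  then show ?case using Suc.IH[of "f z" u] Suc.prems(3) g(3) v by auto
qed

text \<open>\<open>directed \<pi>\<close> has the nontrivial vertex permutation \<open>\<pi>\<close>
  at \<open>y\<^sup>n x\<close> for every \<open>n\<close>, whereas an element of depth
  \<open>n\<close> is trivial at this vertex of level \<open>n + 1\<close>.\<close>

lemma Fin_proper: "Fin \<noteq> G"
proof
  assume "Fin = G"
  then obtain n where n: "directed \<pi> \<in> finitary X P n" using directed_G[OF \<pi>(1)] by blast
  let ?v = "replicate n y @ [x]"
  have v: "?v \<in> lists X" using x y by auto
  have "vertex_perm X (directed \<pi>) ?v = (if \<exists>k. ?v = replicate k y @ [x] then \<pi> else (\<lambda>z\<in>X. z))"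
    unfolding directed_aut_def using v P_Bij[OF \<pi>(1)]
    by (intro vertex_perm_portrait_aut) (auto simp: id_Bij)
  then have "vertex_perm X (directed \<pi>) ?v = \<pi>" by auto
  moreover have "vertex_perm X (directed \<pi>) ?v = (\<lambda>z\<in>X. z)"
    using vertex_perm_finitary[OF n v] by simp
  ultimately have "\<pi> y = (\<lambda>z\<in>X. z) y" by simp
  then show False using \<pi>(3) y by simp
qed

text \<open>Transitivity is applied letter by letter along the path, with trivial sections off it.
  The section of \<open>f\<close> at \<open>v\<close> itself is trivial too, so conjugation by
  \<open>f\<close> moves the copy below \<open>v\<close> to the copy below \<open>w\<close> without
  altering \<open>a\<close>.\<close>

lemma Fin_level_transport:
  assumes "v \<in> lists X" "w \<in> lists X" "length v = length w"
  shows "\<exists>f\<in>Fin. f v = w \<and> (\<forall>a\<in>T. f \<cdot> lifts X v a = lifts X w a \<cdot> f)"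
  using assms
proof (induction v arbitrary: w rule: list.induct)
  case Nil
  then have "w = []" by simp
  moreover have "unit [] = []" using AutT_Nil[OF T.one_closed] .
  ultimately show ?case
    by (intro bexI[OF _ unit_Fin]) simp
next
  case (Cons z v)
  then obtain z' w' where w: "w = z' # w'" by (cases w) auto
  have zv: "z \<in> X" "z' \<in> X" "v \<in> lists X" "w' \<in> lists X" "length v = length w'"
    using Cons.prems w by auto
  obtain f where f: "f \<in> Fin" "f v = w'" "\<And>a. a \<in> T \<Longrightarrow> f \<cdot> lifts X v a = lifts X w' a \<cdot> f"
    using Cons.IH[OF zv(3-5)] by blast
  obtain s where s: "s \<in> P" "s z = z'" using transitive_P zv by blast
  note sB = P_Bij[OF s(1)]
  let ?f = "node X s (\<lambda>c. if c = z then f else unit)"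
  have fT: "f \<in> T" using Fin_T[OF f(1)] .
  have "?f \<in> Fin" using f(1) unit_Fin by (intro node_Fin[OF s(1)]) auto
  moreover have "?f (z # v) = w" using zv f(2) s(2) w by simp
  moreover have "?f \<cdot> lifts X (z # v) a = lifts X w a \<cdot> ?f" if a: "a \<in> T" for a
  proof -
    note lT = lifts_in_AutT[OF a, of v] lifts_in_AutT[OF a, of w']
    have sz: "s c = z' \<longleftrightarrow> c = z" if "c \<in> X" for c
      using Bij_eq_iff[OF sB that zv(1)] s(2) by auto
    have "?f \<cdot> lifts X (z # v) a = node X (compose X s (\<lambda>c\<in>X. c))
        (\<lambda>c. (if (\<lambda>c\<in>X. c) c = z then f else unit) \<cdot> (if c = z then lifts X v a else unit))"
      unfolding foldr_Cons comp_def lift_def[of X z]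
      by (rule node_mult[OF sB id_Bij]) (auto simp: fT lT)
    also have "\<dots> = node X (compose X (\<lambda>c\<in>X. c) s)
        (\<lambda>c. (if s c = z' then lifts X w' a else unit) \<cdot> (if c = z then f else unit))"
      by (rule node_cong) (auto simp: compose_eq Bij_apply_mem[OF sB] sz f(3)[OF a])
    also have "\<dots> = lifts X w a \<cdot> ?f"
      unfolding w foldr_Cons comp_def lift_def[of X z']
      by (rule node_mult[OF id_Bij sB, symmetric]) (auto simp: fT lT)
    finally show ?thesis .
  qed
  ultimately show ?case by blast
qed

text \<open>The action on words of length at most \<open>n\<close> sees only the vertex permutations
  above level \<open>n\<close>, so the portrait of \<open>w\<close> can be cut off there. This is
  the source of density.\<close>

lemma finitary_approximation:
  assumes "w \<in> T" "\<And>v. v \<in> lists X \<Longrightarrow> vertex_perm X w v \<in> P"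
  shows "\<exists>g\<in>finitary X P n. \<forall>v\<in>lists X. length v \<le> n \<longrightarrow> g v = w v"
  using assms
proof (induction n arbitrary: w)
  case 0
  then show ?case by (auto simp: one_AutT)
next
  case (Suc n)
  obtain f where f: "f \<in> X \<rightarrow> T" "w = node X (vertex_perm X w []) f"
    "\<And>z u. z \<in> X \<Longrightarrow> u \<in> lists X \<Longrightarrow> vertex_perm X (f z) u = vertex_perm X w (z # u)"
    using AutT_eq_node[OF Suc.prems(1)] by blast
  have "\<exists>g\<in>finitary X P n. \<forall>v\<in>lists X. length v \<le> n \<longrightarrow> g v = f z v" if "z \<in> X" for z
    using f that Suc.prems(2) by (intro Suc.IH) auto
  then obtain g where g: "\<And>z. z \<in> X \<Longrightarrow> g z \<in> finitary X P n"
    "\<And>z v. z \<in> X \<Longrightarrow> v \<in> lists X \<Longrightarrow> length v \<le> n \<Longrightarrow> g z v = f z v" by metis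
  let ?g = "node X (vertex_perm X w []) g"
  have "?g \<in> finitary X P (Suc n)" using g(1) Suc.prems(2)[of "[]"] by auto
  moreover have "?g v = w v" if v: "v \<in> lists X" "length v \<le> Suc n" for v
  proof -
    have "?g v = node X (vertex_perm X w []) f v"
      using g(2) v by (cases v) simp_all
    also have "\<dots> = w v" using fun_cong[OF f(2), symmetric] .
    finally show ?thesis .
  qed
  ultimately show ?case by blast
qed


section \<open>Rigid level stabilizers\<close>

text \<open>By \<open>node_G\<close> and \<open>G_node\<close> this is the stabilizer of level
  \<open>n\<close> in \<open>G\<close>, the direct product of the copies of \<open>G\<close> below
  the vertices of that level.\<close>

primrec level_stabilizer :: "nat \<Rightarrow> ('x list \<Rightarrow> 'x list) set" where
  "level_stabilizer 0 = G"
| "level_stabilizer (Suc n) = {node X (\<lambda>z\<in>X. z) f | f. f \<in> X \<rightarrow> level_stabilizer n}"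

primrec vertex_lifts :: "nat \<Rightarrow> ('x list \<Rightarrow> 'x list) set" where
  "vertex_lifts 0 = G"
| "vertex_lifts (Suc n) = (\<Union>z\<in>X. lift X z ` vertex_lifts n)"

lemma vertex_lifts_G: "vertex_lifts n \<subseteq> G"
  by (induction n) (auto intro: lift_G)

lemma level_stabilizer_T: "level_stabilizer n \<subseteq> T"
  by (induction n) (auto simp: G_T id_Bij intro!: node_in_AutT)

text \<open>A node with trivial root permutation is a product of lifts, and the homomorphism
  \<open>lift X z\<close> carries generated subgroups to generated subgroups, which allows one more
  level.\<close>

lemma level_stabilizer_generate: "level_stabilizer n \<subseteq> generate (AutT X) (vertex_lifts n)"
proof (induction n)
  case 0
  then show ?case by (auto intro: generate.incl)
next
  case (Suc n)
  have VT: "vertex_lifts m \<subseteq> T" for m using vertex_lifts_G G_T by blast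
  show ?case
  proof
    fix g assume "g \<in> level_stabilizer (Suc n)"
    then obtain f where f: "g = node X (\<lambda>z\<in>X. z) f" "f \<in> X \<rightarrow> level_stabilizer n" by auto
    have "lift X z (f z) \<in> generate (AutT X) (vertex_lifts (Suc n))" if z: "z \<in> X" for z
    proof -
      interpret L: group_hom "AutT X" "AutT X" "lift X z" by (rule group_hom_lift)
      have "lift X z (f z) \<in> lift X z ` generate (AutT X) (vertex_lifts n)"
        using f(2) z Suc by auto
      also have "\<dots> = generate (AutT X) (lift X z ` vertex_lifts n)"
        by (rule L.generate_img[OF VT, symmetric])
      also have "\<dots> \<subseteq> generate (AutT X) (vertex_lifts (Suc n))"
        using z by (intro T.mono_generate) auto
      finally show ?thesis .
    qed
    then show "g \<in> generate (AutT X) (vertex_lifts (Suc n))"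
      unfolding f(1) using f(2) level_stabilizer_T
      by (intro node_id_mem[OF T.generate_is_subgroup[OF VT] finite_X]) auto
  qed
qed

lemma vertex_lifts_RiSt:
  "g \<in> vertex_lifts n \<Longrightarrow> \<exists>v\<in>level X n. g \<in> RiSt_vertex X G v"
proof (induction n arbitrary: g)
  case 0
  then show ?case by (auto simp: level_def RiSt_vertex_def)
next
  case (Suc n)
  then obtain z h where g: "z \<in> X" "g = lift X z h" "h \<in> vertex_lifts n" by auto
  obtain v where v: "v \<in> level X n" "h \<in> RiSt_vertex X G v" using Suc.IH[OF g(3)] by blast
  have hT: "h \<in> T" using g(3) vertex_lifts_G G_T by blast
  have "vertex_perm X g u = (\<lambda>z\<in>X. z)" if u: "u \<in> lists X" "\<not> prefix (z # v) u" for u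
  proof (cases u)
    case Nil
    then show ?thesis using g(2) vertex_perm_lift_Nil[OF hT] by simp
  next
    case (Cons c u')
    then show ?thesis
      using g(2) vertex_perm_lift[OF hT, of c u' z] u v by (auto simp: RiSt_vertex_def)
  qed
  moreover have "g \<in> G" using Suc.prems vertex_lifts_G by blast
  moreover have "z # v \<in> level X (Suc n)" using v(1) g(1) by (auto simp: level_def)
  ultimately show ?case by (intro bexI[of _ "z # v"]) (auto simp: RiSt_vertex_def)
qed

text \<open>The portrait is split at level \<open>n\<close>: \<open>t\<close> carries the part above
  it and ranges over a finite group, while \<open>k\<close> collects the sections at that
  level.\<close>

lemma G_decomposition:
  "g \<in> G \<Longrightarrow> \<exists>t\<in>finitary X P n. \<exists>k\<in>level_stabilizer n. g = t \<cdot> k"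
proof (induction n arbitrary: g)
  case 0
  then show ?case using G_T by auto
next
  case (Suc n)
  obtain s f where g: "s \<in> P" "f \<in> X \<rightarrow> G" "g = node X s f" using G_node[OF Suc.prems] .
  have "\<forall>z\<in>X. \<exists>t k. t \<in> finitary X P n \<and> k \<in> level_stabilizer n \<and> f z = t \<cdot> k"
    using g(2) Suc.IH by blast
  then obtain t k where tk: "\<And>z. z \<in> X \<Longrightarrow> t z \<in> finitary X P n"
    "\<And>z. z \<in> X \<Longrightarrow> k z \<in> level_stabilizer n" "\<And>z. z \<in> X \<Longrightarrow> f z = t z \<cdot> k z" by metis
  have tkT: "t z \<in> T" "k z \<in> T" if "z \<in> X" for z
    using tk(1,2)[OF that] finitary_G[of n] G_T level_stabilizer_T[of n] by blast+
  have "node X s t \<cdot> node X (\<lambda>z\<in>X. z) k =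
      node X (compose X s (\<lambda>z\<in>X. z)) (\<lambda>z. t ((\<lambda>z\<in>X. z) z) \<cdot> k z)"
    by (rule node_mult) (simp_all only: id_Bij P_Bij[OF g(1)] tkT)
  also have "\<dots> = g"
    unfolding g(3) by (rule node_cong) (auto simp: tk(3) compose_eq)
  finally have "g = node X s t \<cdot> node X (\<lambda>z\<in>X. z) k" by simp
  moreover have "node X s t \<in> finitary X P (Suc n)" using g(1) tk(1) by auto
  moreover have "node X (\<lambda>z\<in>X. z) k \<in> level_stabilizer (Suc n)" using tk(2) by auto
  ultimately show ?case by blast
qed

lemma finite_index_RiSt_level: "finite_index (AutT X) G (RiSt_level X G n)"
proof -
  let ?R = "RiSt_level X G n"
  have RT: "(\<Union>v\<in>level X n. RiSt_vertex X G v) \<subseteq> T"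
    using G_T by (auto simp: RiSt_vertex_def)
  have R: "subgroup ?R (AutT X)"
    unfolding RiSt_level_def by (rule T.generate_is_subgroup[OF RT])
  have "vertex_lifts n \<subseteq> (\<Union>v\<in>level X n. RiSt_vertex X G v)" using vertex_lifts_RiSt by blast
  then have SR: "level_stabilizer n \<subseteq> ?R"
    unfolding RiSt_level_def using level_stabilizer_generate T.mono_generate by blast
  have *: "\<exists>t\<in>finitary X P n. ?R #>\<^bsub>AutT X\<^esub> g = ?R #>\<^bsub>AutT X\<^esub> t" if g: "g \<in> G" for g
  proof -
    \<comment> \<open>The decomposition leaves the stabilizer part on the right, while a right coset
      absorbs factors on the left; hence it is applied to the inverse of \<open>g\<close>.\<close>
    obtain t k where tk: "t \<in> finitary X P n" "k \<in> level_stabilizer n" "inv\<^bsub>AutT X\<^esub> g = t \<cdot> k"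
      using G_decomposition[OF G_inv[OF g]] by blast
    have T: "t \<in> T" "k \<in> T" "g \<in> T" using tk finitary_G level_stabilizer_T G_T g by blast+
    have "g = inv\<^bsub>AutT X\<^esub> (t \<cdot> k)" using T(3) tk(3) T.inv_inv by metis
    then have eq: "g = inv\<^bsub>AutT X\<^esub> k \<cdot> inv\<^bsub>AutT X\<^esub> t" using T by (simp add: T.inv_mult_group)
    have kR: "inv\<^bsub>AutT X\<^esub> k \<in> ?R" using SR tk(2) subgroup.m_inv_closed[OF R] by blast
    have "?R #>\<^bsub>AutT X\<^esub> g = (?R #>\<^bsub>AutT X\<^esub> inv\<^bsub>AutT X\<^esub> k) #>\<^bsub>AutT X\<^esub> inv\<^bsub>AutT X\<^esub> t"
      unfolding eq using T by (simp add: T.coset_mult_assoc subgroup.subset[OF R])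
    also have "\<dots> = ?R #>\<^bsub>AutT X\<^esub> inv\<^bsub>AutT X\<^esub> t"
      using T.coset_join2[OF _ R kR] T by simp
    finally show ?thesis using tk(1) subgroup.m_inv_closed[OF subgroup_finitary] by blast
  qed
  have eq: "rcosets\<^bsub>AutT X\<lparr>carrier := G\<rparr>\<^esub> ?R = (\<lambda>g. ?R #>\<^bsub>AutT X\<^esub> g) ` G"
    by (auto simp: RCOSETS_def r_coset_def)
  have "rcosets\<^bsub>AutT X\<lparr>carrier := G\<rparr>\<^esub> ?R \<subseteq> (\<lambda>t. ?R #>\<^bsub>AutT X\<^esub> t) ` finitary X P n"
    unfolding eq image_subset_iff image_iff by (intro ballI *)
  then show ?thesis
    unfolding finite_index_def using finite_finitary finite_subset by blast
qed

theorem branch_G: "branch_group X G"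
proof -
  have "\<exists>g\<in>G. g u = v" if "u \<in> level X n" "v \<in> level X n" for u v n
    using Fin_level_transport[of u v] that finitary_G by (force simp: level_def)
  then show ?thesis
    unfolding branch_group_def using subgroup_G finite_index_RiSt_level by blast
qed


section \<open>A maximal subgroup of infinite index\<close>

lemma lifts_directed_G: "s \<in> P \<Longrightarrow> v \<in> lists X \<Longrightarrow> lifts X v (directed s) \<in> G"
  by (induction v) (auto intro: directed_G lift_G)

text \<open>Along the spine \<open>directed s\<close> consists of rooted parts at the vertices
  \<open>y\<^sup>k x\<close>. Those with \<open>k < n\<close> form a finitary element, and what
  remains is \<open>directed s\<close> again, placed below \<open>y\<^sup>n\<close>.\<close>

lemma directed_eq_finitary_mult:
  assumes s: "s \<in> P"
  shows "\<exists>t\<in>Fin. directed s = t \<cdot> lifts X (replicate n y) (directed s)"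
proof (induction n)
  case 0
  show ?case using directed_T[OF s] by (intro bexI[OF _ unit_Fin]) simp
next
  case (Suc n)
  then obtain t where t: "t \<in> Fin" "directed s = t \<cdot> lifts X (replicate n y) (directed s)" by blast
  let ?d = "lifts X (replicate n y) (directed s)"
  let ?t = "node X (\<lambda>z\<in>X. z) (\<lambda>z. if z = x then rooted s else if z = y then t else unit)"
  have T: "t \<in> T" "?d \<in> T" "rooted s \<in> T"
    using Fin_T[OF t(1)] lifts_in_AutT[OF directed_T[OF s]] rooted_T[OF s] by blast+
  have "?t \<cdot> lift X y ?d = node X (\<lambda>z\<in>X. z)
      (\<lambda>z. (if z = x then rooted s else if z = y then t else unit) \<cdot> (if z = y then ?d else unit))"
    unfolding lift_def[of X y ?d] by (rule node_id_mult) (auto simp: T simp del: foldr_replicate)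
  also have "\<dots> = node X (\<lambda>z\<in>X. z)
      (\<lambda>z. if z = x then rooted s else if z = y then directed s else unit)"
    by (rule node_cong) (auto simp: T xy t(2)[symmetric] simp del: foldr_replicate)
  also have "\<dots> = directed s" by (rule directed_eq_node[symmetric])
  finally have "directed s = ?t \<cdot> lifts X (replicate (Suc n) y) (directed s)" by simp
  moreover have "?t \<in> Fin"
    using t(1) unit_Fin rooted_Fin[OF s] by (intro node_Fin[OF P_id]) auto
  ultimately show ?case by blast
qed

text \<open>The vertices \<open>y\<^sup>k x\<close> are pairwise incomparable, so among the copies of the directed
  group below them three lie in the same cosets of \<open>M\<close>. The commutator of quotients of such copies
  cancels all but one of them, and perfectness recovers that copy.\<close>

lemma finite_index_contains_lifts:
  assumes M: "subgroup M (AutT X)" "M \<subseteq> G" and fin: "finite_index (AutT X) G M"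
  obtains v where "v \<in> lists X" "\<And>s. s \<in> P \<Longrightarrow> lifts X v (directed s) \<in> M"
proof -
  define V where "V k = replicate k y @ [x]" for k :: nat
  define \<delta> where "\<delta> k s = lifts X (V k) (directed s)" for k s
  have V: "V k \<in> lists X" for k using x y by (auto simp: V_def)
  have inc: "\<not> prefix (V i) (V j)" if "i \<noteq> j" for i j
  proof
    assume "prefix (V i) (V j)"
    then obtain w where w: "replicate j y @ [x] = (replicate i y @ [x]) @ w"
      by (auto simp: V_def prefix_def)
    have "i \<le> j" using arg_cong[OF w, of length] by simp
    then have "i < j" using that by simp
    \<comment> \<open>The words are told apart at position \<open>i\<close>, where
      \<open>V i\<close> has its final \<open>x\<close>.\<close>
    then have "(replicate j y @ [x]) ! i = y" by (simp add: nth_append)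
    moreover have "((replicate i y @ [x]) @ w) ! i = x" by (simp add: nth_append)
    ultimately show False using w xy by simp
  qed
  have \<delta>G: "\<delta> k s \<in> G" if "s \<in> P" for k s
    unfolding \<delta>_def using lifts_directed_G[OF that V] .
  have \<delta>T: "\<delta> k s \<in> T" if "s \<in> P" for k s using G_T[OF \<delta>G[OF that]] .
  have comm: "\<delta> i s \<cdot> \<delta> j t = \<delta> j t \<cdot> \<delta> i s" if "i \<noteq> j" "s \<in> P" "t \<in> P" for i j s t
    unfolding \<delta>_def using that inc by (intro lifts_commute directed_T) auto
  have hom: "group_hom (BijGroup X) (AutT X) (\<delta> k)" for k
    using Group.hom_compose[OF group_hom.homh[OF group_hom_directed_aut[OF x y xy]]
        group_hom.homh[OF group_hom_lifts[of X "V k"]]]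
    by (simp add: group_hom_def group_hom_axioms_def group_AutT group_BijGroup comp_def
        \<delta>_def[abs_def])
  \<comment> \<open>One function records the cosets of all elements of a copy, so that a coincidence
    holds for every \<open>s\<close> simultaneously; its range is finite because \<open>P\<close>
    and the index are.\<close>
  let ?c = "\<lambda>k. \<lambda>s\<in>P. M #>\<^bsub>AutT X\<^esub> \<delta> k s"
  have "?c k \<in> P \<rightarrow>\<^sub>E rcosets\<^bsub>AutT X\<lparr>carrier := G\<rparr>\<^esub> M" for k
    using \<delta>G by (auto simp: RCOSETS_def r_coset_def)
  then have "range ?c \<subseteq> P \<rightarrow>\<^sub>E rcosets\<^bsub>AutT X\<lparr>carrier := G\<rparr>\<^esub> M" by blast
  moreover have "finite (P \<rightarrow>\<^sub>E rcosets\<^bsub>AutT X\<lparr>carrier := G\<rparr>\<^esub> M)"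
    using fin finite_P by (simp add: finite_PiE finite_index_def)
  ultimately have "finite (range ?c)" by (rule finite_subset)
  \<comment> \<open>A value taken infinitely often supplies three indices
    \<open>i < j < l\<close>.\<close>
  then obtain i0 where i0: "infinite {k \<in> UNIV. ?c k = ?c i0}"
    using pigeonhole_infinite[of UNIV ?c] by auto
  obtain i where i: "?c i = ?c i0" using i0 by blast
  obtain j where j: "i < j" "?c j = ?c i0" using i0 by (auto simp: infinite_nat_iff_unbounded)
  obtain l where l: "j < l" "?c l = ?c i0" using i0 by (auto simp: infinite_nat_iff_unbounded)
  have q: "\<delta> i s \<cdot> \<delta> k (inv\<^bsub>BijGroup X\<^esub> s) \<in> M" if k: "?c k = ?c i0" and s: "s \<in> P" for k s
  proof -
    interpret D: group_hom "BijGroup X" "AutT X" "\<delta> k" by (rule hom)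
    have "M #>\<^bsub>AutT X\<^esub> \<delta> i s = M #>\<^bsub>AutT X\<^esub> \<delta> k s"
      using fun_cong[OF k[folded i], of s] s by simp
    then have "\<delta> i s \<cdot> inv\<^bsub>AutT X\<^esub> \<delta> k s \<in> M"
      by (rule T.rcos_eq_imp_mult_inv_mem[OF M(1) \<delta>T[OF s] \<delta>T[OF s]])
    \<comment> \<open>The inverse is moved inside the homomorphism, so that each factor has the form
      \<open>\<delta> k s\<close> and the commutation rule covers it.\<close>
    then show ?thesis using D.hom_inv[of s] P_Bij[OF s] by simp
  qed
  have "\<delta> i s \<in> M" if "s \<in> P" for s
  proof (rule perfect_image[OF hom M(1) _ that])
    fix a b assume a: "a \<in> P" and b: "b \<in> P"
    note ai = subgroup.m_inv_closed[OF subgroup_P a] and bi = subgroup.m_inv_closed[OF subgroup_P b]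
    \<comment> \<open>The second index is \<open>j\<close> in one quotient and \<open>l\<close> in
      the other, so the unwanted factors commute with each other and with the copy at
      \<open>i\<close>.\<close>
    let ?u = "\<delta> i a \<cdot> \<delta> j (inv\<^bsub>BijGroup X\<^esub> a)" and ?v = "\<delta> i b \<cdot> \<delta> l (inv\<^bsub>BijGroup X\<^esub> b)"
    have "?u \<cdot> ?v \<cdot> inv\<^bsub>AutT X\<^esub> ?u \<cdot> inv\<^bsub>AutT X\<^esub> ?v =
        \<delta> i a \<cdot> \<delta> i b \<cdot> inv\<^bsub>AutT X\<^esub> \<delta> i a \<cdot> inv\<^bsub>AutT X\<^esub> \<delta> i b"
      using j(1) l(1) a b ai bi
      by (intro T.commutator_commuting_factors \<delta>T comm) auto
    moreover have "?u \<cdot> ?v \<cdot> inv\<^bsub>AutT X\<^esub> ?u \<cdot> inv\<^bsub>AutT X\<^esub> ?v \<in> M"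
      using q[OF j(2) a] q[OF l(2) b]
      by (simp only: subgroup.m_closed[OF M(1)] subgroup.m_inv_closed[OF M(1)])
    ultimately show "\<delta> i a \<cdot> \<delta> i b \<cdot> inv\<^bsub>AutT X\<^esub> \<delta> i a \<cdot> inv\<^bsub>AutT X\<^esub> \<delta> i b \<in> M"
      by (simp only:)
  qed
  then show ?thesis using that[of "V i"] V by (simp add: \<delta>_def)
qed

lemma finite_index_above_Fin:
  assumes M: "subgroup M (AutT X)" "M \<subseteq> G" "Fin \<subseteq> M" and fin: "finite_index (AutT X) G M"
  shows "M = G"
proof -
  obtain v where v: "v \<in> lists X" "\<And>s. s \<in> P \<Longrightarrow> lifts X v (directed s) \<in> M"
    using finite_index_contains_lifts[OF M(1,2) fin] by blast
  \<comment> \<open>The copy inside \<open>M\<close> sits at an arbitrary vertex; on its level, this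
    is the vertex from which \<open>directed_eq_finitary_mult\<close> leads back to the
    root.\<close>
  let ?w = "replicate (length v) y"
  have w: "?w \<in> lists X" "length v = length ?w" using y by auto
  obtain f where f: "f \<in> Fin" "\<And>a. a \<in> T \<Longrightarrow> f \<cdot> lifts X v a = lifts X ?w a \<cdot> f"
    using Fin_level_transport[OF v(1) w] by blast
  have "directed s \<in> M" if s: "s \<in> P" for s
  proof -
    have "lifts X ?w (directed s) = f \<cdot> lifts X v (directed s) \<cdot> inv\<^bsub>AutT X\<^esub> f"
      using f(2)[OF directed_T[OF s]] lifts_in_AutT[OF directed_T[OF s]] Fin_T[OF f(1)]
      by (metis T.inv_solve_right T.m_closed)
    then have "lifts X ?w (directed s) \<in> M"
      using v(2)[OF s] f(1) M(3) subgroup.m_closed[OF M(1)] subgroup.m_inv_closed[OF M(1)]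
      by (metis subsetD)
    moreover obtain t where "t \<in> Fin" "directed s = t \<cdot> lifts X ?w (directed s)"
      using directed_eq_finitary_mult[OF s] by blast
    ultimately show ?thesis using M(3) subgroup.m_closed[OF M(1)] by (metis subsetD)
  qed
  then have "G \<subseteq> M"
    unfolding G_def using rooted_Fin M(3)
    by (intro T.generate_subgroup_incl[OF _ M(1)]) blast
  then show ?thesis using M(2) by blast
qed

theorem maximal_G: "\<exists>M. maximal_subgroup (AutT X) G M \<and> \<not> finite_index (AutT X) G M"
proof -
  have "Fin \<subset> generate (AutT X) (rooted ` P \<union> directed ` P)"
    using Fin_proper finitary_G unfolding G_def by blast
  then obtain M where M: "Fin \<subseteq> M" "maximal_subgroup (AutT X) G M"
    using T.exists_maximal_subgroup_containing[OF _ generators_T subgroup_Fin] finite_P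
    unfolding G_def by blast
  have "subgroup M (AutT X)" "M \<subseteq> G" "M \<noteq> G"
    using M(2) subgroup_carrier_update_iff[OF group_AutT subgroup_G] by (auto simp: maximal_subgroup_def)
  then have "\<not> finite_index (AutT X) G M" using finite_index_above_Fin M(1) by blast
  then show ?thesis using M(2) by blast
qed

end

section \<open>The profinite topology\<close>

definition agree_upto :: "'x set \<Rightarrow> nat \<Rightarrow> ('x list \<Rightarrow> 'x list) \<Rightarrow> ('x list \<Rightarrow> 'x list) \<Rightarrow> bool" where
  "agree_upto X n g h \<longleftrightarrow> (\<forall>v\<in>lists X. length v \<le> n \<longrightarrow> g v = h v)"

lemma agree_upto_iff_restrict:
  "agree_upto X n g h \<longleftrightarrow> restrict g (truncation X n) = restrict h (truncation X n)"
proof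
  assume "agree_upto X n g h"
  then show "restrict g (truncation X n) = restrict h (truncation X n)"
    by (intro restrict_ext) (auto simp: agree_upto_def truncation_def)
next
  assume eq: "restrict g (truncation X n) = restrict h (truncation X n)"
  show "agree_upto X n g h"
    unfolding agree_upto_def
  proof (intro ballI impI)
    fix v assume "v \<in> lists X" "length v \<le> n"
    then have "v \<in> truncation X n" by (simp add: truncation_def)
    then show "g v = h v" using fun_cong[OF eq, of v] by simp
  qed
qed

lemma agree_upto_refl: "agree_upto X n g g"
  by (simp add: agree_upto_def)

lemma agree_upto_trans: "agree_upto X n g h \<Longrightarrow> agree_upto X n h k \<Longrightarrow> agree_upto X n g k"
  by (simp add: agree_upto_def)

lemma agree_upto_mono: "agree_upto X n g h \<Longrightarrow> m \<le> n \<Longrightarrow> agree_upto X m g h"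
  by (auto simp: agree_upto_def)

text \<open>A basic open set of the product constrains finitely many truncations, and the longest of
  them determines the others; so openness reduces to agreement up to a single length.\<close>

lemma openin_AutT_topology:
  "openin (AutT_topology X) U \<longleftrightarrow> U \<subseteq> carrier (AutT X) \<and>
    (\<forall>g\<in>U. \<exists>n. \<forall>h\<in>carrier (AutT X). agree_upto X n g h \<longrightarrow> h \<in> U)"
proof -
  let ?T = "carrier (AutT X)"
  let ?r = "\<lambda>g n. restrict g (truncation X n)"
  let ?I = "\<lambda>n. (\<lambda>g. ?r g n) ` ?T"
  let ?D = "\<lambda>n. discrete_topology (?I n)"
  have "\<exists>n. \<forall>h\<in>?T. agree_upto X n g h \<longrightarrow> h \<in> U"
    if V: "openin (product_topology ?D UNIV) V" "U = ?r -` V \<inter> ?T" and g: "g \<in> U" for V g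
  proof -
    have "?r g \<in> V" using g V(2) by simp
    then obtain F where F: "finite {i \<in> UNIV. F i \<noteq> topspace (?D i)}" "?r g \<in> Pi\<^sub>E UNIV F" "Pi\<^sub>E UNIV F \<subseteq> V"
      using V(1) unfolding openin_product_topology_alt by blast
    obtain n where n: "\<And>i. F i \<noteq> topspace (?D i) \<Longrightarrow> i \<le> n"
      using F(1) finite_nat_set_iff_bounded_le by auto
    have "h \<in> U" if h: "h \<in> ?T" "agree_upto X n g h" for h
    proof -
      have "?r h i \<in> F i" for i
      proof (cases "F i = topspace (?D i)")
        case True
        then show ?thesis using h(1) by simp
      next
        case False
        then have "?r h i = ?r g i"
          using agree_upto_mono[OF h(2) n] unfolding agree_upto_iff_restrict by simp
        then show ?thesis using F(2) by (auto simp: PiE_iff)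
      qed
      then have "?r h \<in> V" using F(3) by (auto simp: PiE_iff)
      then show ?thesis using V(2) h(1) by simp
    qed
    then show ?thesis by blast
  qed
  moreover have "\<exists>V. openin (product_topology ?D UNIV) V \<and> U = ?r -` V \<inter> ?T"
    if U: "U \<subseteq> ?T" "\<forall>g\<in>U. \<exists>n. \<forall>h\<in>?T. agree_upto X n g h \<longrightarrow> h \<in> U"
  proof -
    \<comment> \<open>Families in \<open>V\<close> need not come from one automorphism. They only
      have to match some \<open>g \<in> U\<close> in one coordinate, at a length that forces
      membership in \<open>U\<close>; this already makes \<open>V\<close> open with preimage
      \<open>U\<close>.\<close>
    define V where "V = {p. (\<forall>i. p i \<in> ?I i) \<and>
      (\<exists>g\<in>U. \<exists>n. p n = ?r g n \<and> (\<forall>h\<in>?T. agree_upto X n g h \<longrightarrow> h \<in> U))}"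
    have "openin (product_topology ?D UNIV) V"
      unfolding openin_product_topology_alt
    proof
      fix p assume p: "p \<in> V"
      then obtain g n where gn: "g \<in> U" "p n = ?r g n" "\<forall>h\<in>?T. agree_upto X n g h \<longrightarrow> h \<in> U"
        by (auto simp: V_def)
      let ?F = "\<lambda>i. if i = n then {p n} else ?I i"
      have "finite {i \<in> UNIV. ?F i \<noteq> topspace (?D i)}"
        by (rule finite_subset[of _ "{n}"]) auto
      moreover have "\<forall>i\<in>UNIV. openin (?D i) (?F i)" using p by (auto simp: V_def)
      moreover have "p \<in> Pi\<^sub>E UNIV ?F" using p by (auto simp: V_def PiE_iff)
      moreover have "Pi\<^sub>E UNIV ?F \<subseteq> V"
      proof
        fix q assume q: "q \<in> Pi\<^sub>E UNIV ?F"
        then have qF: "q i \<in> ?F i" for i by (auto simp: PiE_iff)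
        have "q i \<in> ?I i" for i
          using qF[of i] p by (cases "i = n") (auto simp: V_def)
        moreover have "q n = ?r g n" using qF[of n] gn(2) by simp
        ultimately show "q \<in> V" using gn unfolding V_def by blast
      qed
      ultimately show "\<exists>F. finite {i \<in> UNIV. F i \<noteq> topspace (?D i)} \<and>
          (\<forall>i\<in>UNIV. openin (?D i) (F i)) \<and> p \<in> Pi\<^sub>E UNIV F \<and> Pi\<^sub>E UNIV F \<subseteq> V"
        by (intro exI[of _ ?F] conjI)
    qed
    moreover have "U = ?r -` V \<inter> ?T"
    proof
      show "U \<subseteq> ?r -` V \<inter> ?T"
      proof
        fix g assume g: "g \<in> U"
        then have "g \<in> ?T" using U(1) by blast
        moreover obtain n where "\<forall>h\<in>?T. agree_upto X n g h \<longrightarrow> h \<in> U" using U(2) g by blast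
        then have "\<exists>g'\<in>U. \<exists>n. ?r g n = ?r g' n \<and> (\<forall>h\<in>?T. agree_upto X n g' h \<longrightarrow> h \<in> U)"
          using g by (intro bexI[of _ g] exI[of _ n] conjI refl)
        then have "?r g \<in> V" unfolding V_def using \<open>g \<in> ?T\<close> by (intro CollectI conjI allI imageI)
        ultimately show "g \<in> ?r -` V \<inter> ?T" by simp
      qed
      show "?r -` V \<inter> ?T \<subseteq> U"
      proof
        fix h assume h: "h \<in> ?r -` V \<inter> ?T"
        then obtain g n where gn: "g \<in> U" "?r h n = ?r g n" "\<forall>h\<in>?T. agree_upto X n g h \<longrightarrow> h \<in> U"
          by (auto simp: V_def)
        then show "h \<in> U" using h agree_upto_iff_restrict[of X n g h] by auto
      qed
    qed
    ultimately show ?thesis by blast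
  qed
  ultimately show ?thesis
    unfolding AutT_topology_def openin_pullback_topology by blast
qed

lemma openin_subtopology_AutT:
  assumes W: "W \<subseteq> carrier (AutT X)"
  shows "openin (subtopology (AutT_topology X) W) U \<longleftrightarrow> U \<subseteq> W \<and>
    (\<forall>g\<in>U. \<exists>n. \<forall>h\<in>W. agree_upto X n g h \<longrightarrow> h \<in> U)"
proof
  assume "openin (subtopology (AutT_topology X) W) U"
  then obtain V where V: "openin (AutT_topology X) V" "U = V \<inter> W"
    by (auto simp: openin_subtopology)
  then show "U \<subseteq> W \<and> (\<forall>g\<in>U. \<exists>n. \<forall>h\<in>W. agree_upto X n g h \<longrightarrow> h \<in> U)"
  proof (intro conjI ballI)
    fix g assume "g \<in> U"
    then obtain n where "\<forall>h\<in>carrier (AutT X). agree_upto X n g h \<longrightarrow> h \<in> V"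
      using V unfolding openin_AutT_topology by blast
    then have "\<forall>h\<in>W. agree_upto X n g h \<longrightarrow> h \<in> U" using V(2) W by blast
    then show "\<exists>n. \<forall>h\<in>W. agree_upto X n g h \<longrightarrow> h \<in> U" by blast
  qed (use V in auto)
next
  assume U: "U \<subseteq> W \<and> (\<forall>g\<in>U. \<exists>n. \<forall>h\<in>W. agree_upto X n g h \<longrightarrow> h \<in> U)"
  \<comment> \<open>The union of the balls around points of \<open>U\<close> whose intersection with
    \<open>W\<close> stays inside \<open>U\<close>.\<close>
  let ?V = "{k \<in> carrier (AutT X). \<exists>g\<in>U. \<exists>n. agree_upto X n g k \<and>
    (\<forall>h\<in>W. agree_upto X n g h \<longrightarrow> h \<in> U)}"
  have "openin (AutT_topology X) ?V"
    unfolding openin_AutT_topology by (blast intro: agree_upto_trans)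
  moreover have "U = ?V \<inter> W"
    using U W by (blast intro: agree_upto_refl)
  ultimately show "openin (subtopology (AutT_topology X) W) U"
    unfolding openin_subtopology by blast
qed

lemma topspace_subtopology_AutT:
  assumes "W \<subseteq> carrier (AutT X)"
  shows "topspace (subtopology (AutT_topology X) W) = W"
proof -
  have "openin (AutT_topology X) (carrier (AutT X))"
    unfolding openin_AutT_topology by blast
  then have "carrier (AutT X) \<subseteq> topspace (AutT_topology X)" by (rule openin_subset)
  then show ?thesis using assms by auto
qed

lemma closure_of_subtopology_AutT:
  assumes W: "W \<subseteq> carrier (AutT X)"
    and dense: "\<And>w n. w \<in> W \<Longrightarrow> \<exists>g\<in>S. g \<in> W \<and> agree_upto X n w g"
  shows "subtopology (AutT_topology X) W closure_of S = W"
proof -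
  have "\<exists>g. g \<in> S \<and> g \<in> U"
    if "w \<in> U" "openin (subtopology (AutT_topology X) W) U" for w U
    using that dense[of w] unfolding openin_subtopology_AutT[OF W] by blast
  then show ?thesis
    using topspace_subtopology_AutT[OF W] by (auto simp: in_closure_of)
qed


section \<open>Passage to abstract permutation groups\<close>

text \<open>The chain rule drives the proof: the vertex permutation of a product at \<open>v\<close>
  is that of \<open>g\<close> at \<open>h v\<close> after that of \<open>h\<close> at
  \<open>v\<close>. Applied to an inverse, it yields the inverse of the vertex permutation of
  \<open>g\<close> at the preimage of \<open>v\<close>.\<close>

lemma subgroup_prescribed_vertex_perms:
  assumes P: "subgroup P (BijGroup X)"
  shows "subgroup {g \<in> carrier (AutT X). \<forall>v\<in>lists X. vertex_perm X g v \<in> P} (AutT X)"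
    (is "subgroup ?W _")
proof -
  interpret T: group "AutT X" by (rule group_AutT)
  note PB = subgroup.mem_carrier[OF P, simplified]
  have mult: "vertex_perm X (g \<otimes>\<^bsub>AutT X\<^esub> h) v = compose X (vertex_perm X g (h v)) (vertex_perm X h v)"
    if gh: "g \<in> carrier (AutT X)" "h \<in> carrier (AutT X)" and v: "v \<in> lists X" for g h v
  proof
    fix z
    note hv = AutT_mem_lists[OF gh(2) v]
    have "last (g (h (v @ [z]))) = vertex_perm X g (h v) (vertex_perm X h v z)" if "z \<in> X"
      by (simp add: AutT_snoc[OF gh(2) v that] AutT_snoc[OF gh(1) hv])
    then show "vertex_perm X (g \<otimes>\<^bsub>AutT X\<^esub> h) v z =
        compose X (vertex_perm X g (h v)) (vertex_perm X h v) z"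
      using v by (simp add: mult_AutT[OF gh] vertex_perm_def[of X "\<lambda>w\<in>lists X. g (h w)"] compose_def
          del: in_lists_conv_set)
  qed
  show ?thesis
  proof (rule T.subgroupI)
    show "?W \<subseteq> carrier (AutT X)" by blast
    have "\<one>\<^bsub>AutT X\<^esub> \<in> ?W"
      using subgroup.one_closed[OF P] vertex_perm_one[of _ X] by simp
    then show "?W \<noteq> {}" by blast
    show "g \<otimes>\<^bsub>AutT X\<^esub> h \<in> ?W" if g: "g \<in> ?W" and h: "h \<in> ?W" for g h
    proof -
      have "compose X (vertex_perm X g (h v)) (vertex_perm X h v) \<in> P" if v: "v \<in> lists X" for v
      proof -
        have "vertex_perm X g (h v) \<in> P" "vertex_perm X h v \<in> P"
          using g h v AutT_mem_lists[of h X v] by blast+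
        then show ?thesis using subgroup.m_closed[OF P] PB by (metis mult_BijGroup)
      qed
      then show ?thesis using g h mult by (simp del: in_lists_conv_set)
    qed
    show "inv\<^bsub>AutT X\<^esub> g \<in> ?W" if g: "g \<in> ?W" for g
    proof -
      let ?i = "inv\<^bsub>AutT X\<^esub> g"
      have gi: "g \<in> carrier (AutT X)" "?i \<in> carrier (AutT X)" using g by auto
      have "vertex_perm X ?i v \<in> P" if v: "v \<in> lists X" for v
      proof -
        interpret B: group "BijGroup X" by (rule group_BijGroup)
        let ?s = "vertex_perm X g (?i v)" and ?t = "vertex_perm X ?i v"
        have s: "?s \<in> P" using g AutT_mem_lists[OF gi(2) v] by blast
        have B: "?s \<in> carrier (BijGroup X)" "?t \<in> carrier (BijGroup X)"
          using PB[OF s] vertex_perm_Bij[OF gi(2) v] by simp_all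
        have "compose X ?s ?t = (\<lambda>z\<in>X. z)"
          using mult[OF gi v] vertex_perm_one[OF v] gi by simp
        then have "?s \<otimes>\<^bsub>BijGroup X\<^esub> ?t = \<one>\<^bsub>BijGroup X\<^esub>"
          using B by (simp add: mult_BijGroup)
        then have "?t = inv\<^bsub>BijGroup X\<^esub> ?s"
          using B.inv_equality[of ?t ?s] B.inv_comm B by (metis B.inv_equality)
        then show ?thesis using subgroup.m_inv_closed[OF P s] by simp
      qed
      then show ?thesis using gi by blast
    qed
  qed
qed

lemma faithful_action_group_hom:
  assumes "finite_transitive_perm_group H X \<phi>"
  shows "group_hom H (BijGroup X) \<phi>" "inj_on \<phi> (carrier H)" "finite X"
    "\<And>a b. a \<in> X \<Longrightarrow> b \<in> X \<Longrightarrow> \<exists>s\<in>carrier H. \<phi> s a = b"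
  using assms
  by (auto simp: finite_transitive_perm_group_def faithful_action_def faithful_action_axioms_def
      transitive_action_def transitive_action_axioms_def group_action_def)

lemma wreath_power_subset: "wreath_power H X \<phi> \<subseteq> carrier (AutT X)"
  by (auto simp: wreath_power_def)

lemma subgroup_wreath_power:
  assumes "group_hom H (BijGroup X) \<phi>"
  shows "subgroup (wreath_power H X \<phi>) (AutT X)"
  unfolding wreath_power_def
  by (rule subgroup_prescribed_vertex_perms[OF group_hom.img_is_subgroup[OF assms]])

text \<open>Homomorphisms map generators to generators, so the images of the \<open>h i\<close>
  generate the rooted and the directed copy of the whole of \<open>H\<close>.\<close>

lemma branch_construction_eq:
  assumes hom: "group_hom H (BijGroup X) \<phi>" and xy: "x \<in> X" "y \<in> X" "x \<noteq> y"
    and h: "h ` {1..m} \<subseteq> carrier H" "generate H (h ` {1..m}) = carrier H"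
  shows "branch_construction X \<phi> x y m h =
    generate (AutT X) (rooted_aut X ` \<phi> ` carrier H \<union> directed_aut X x y ` \<phi> ` carrier H)"
    (is "?L = generate _ (?R \<union> ?D)")
proof -
  interpret T: group "AutT X" by (rule group_AutT)
  interpret \<phi>: group_hom H "BijGroup X" \<phi> by (rule hom)
  let ?S = "h ` {1..m}"
  let ?gens = "rooted_aut X ` \<phi> ` ?S \<union> directed_aut X x y ` \<phi> ` ?S"
  have eq: "?L = generate (AutT X) ?gens"
    by (simp add: branch_construction_def image_image)
  have sub: "?R \<union> ?D \<subseteq> carrier (AutT X)"
    using \<phi>.hom_closed by (auto simp: rooted_aut_in_AutT directed_aut_in_AutT)
  have gens: "?gens \<subseteq> ?R \<union> ?D" using h(1) by blast
  then have gT: "?gens \<subseteq> carrier (AutT X)" using sub by (rule subset_trans)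
  have img: "\<kappa> ` \<phi> ` carrier H \<subseteq> generate (AutT X) ?gens"
    if \<kappa>: "group_hom (BijGroup X) (AutT X) \<kappa>" and "\<kappa> ` \<phi> ` ?S \<subseteq> ?gens" for \<kappa>
  proof -
    have "\<phi> ` carrier H = generate (BijGroup X) (\<phi> ` ?S)"
      using \<phi>.generate_img[OF h(1)] h(2) by simp
    moreover have "\<phi> ` ?S \<subseteq> carrier (BijGroup X)" using h(1) \<phi>.hom_closed by blast
    ultimately have "\<kappa> ` \<phi> ` carrier H = generate (AutT X) (\<kappa> ` \<phi> ` ?S)"
      using group_hom.generate_img[OF \<kappa>] by simp
    also have "\<dots> \<subseteq> generate (AutT X) ?gens"
      using that(2) by (rule T.mono_generate)
    finally show ?thesis .
  qed
  have "?R \<union> ?D \<subseteq> generate (AutT X) ?gens"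
    by (intro Un_least img group_hom_rooted_aut group_hom_directed_aut xy Un_upper1 Un_upper2)
  then have "generate (AutT X) (?R \<union> ?D) \<subseteq> generate (AutT X) ?gens"
    by (rule T.generate_subgroup_incl[OF _ T.generate_is_subgroup[OF gT]])
  then show ?thesis
    unfolding eq using T.mono_generate[OF gens] by blast
qed

theorem branch_construction_properties:
  assumes ftp: "finite_transitive_perm_group H X \<phi>" and perf: "perfect_group H"
    and xy: "x \<in> X" "y \<in> X" and \<pi>: "\<pi> \<in> carrier H" "\<phi> \<pi> x = x" "\<phi> \<pi> y \<noteq> y"
    and h: "h ` {1..m} \<subseteq> carrier H" "generate H (h ` {1..m}) = carrier H"
  defines "G \<equiv> branch_construction X \<phi> x y m h"
  shows "dense_subgroup X G (wreath_power H X \<phi>)" "branch_group X G"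
    "\<exists>M. maximal_subgroup (AutT X) G M \<and> \<not> finite_index (AutT X) G M"
proof -
  note act = faithful_action_group_hom[OF ftp]
  interpret \<phi>: group_hom H "BijGroup X" \<phi> by (rule act(1))
  let ?P = "\<phi> ` carrier H"
  interpret C: perfect_perm_group X ?P x y "\<phi> \<pi>"
  proof (rule perfect_perm_group.intro)
    show "finite X" by (rule act(3))
    show "subgroup ?P (BijGroup X)" by (rule \<phi>.img_is_subgroup)
    show "derived (BijGroup X) ?P = ?P"
      using \<phi>.derived_img[of "carrier H"] perf by (simp add: perfect_group_def)
    show "\<exists>s\<in>?P. s a = b" if "a \<in> X" "b \<in> X" for a b
      using act(4)[OF that] by blast
  qed (use xy \<pi> in auto)
  have eq: "G = C.G"
    unfolding G_def C.G_def by (rule branch_construction_eq[OF act(1) xy C.xy h])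
  show "branch_group X G" unfolding eq by (rule C.branch_G)
  show "\<exists>M. maximal_subgroup (AutT X) G M \<and> \<not> finite_index (AutT X) G M"
    unfolding eq by (rule C.maximal_G)
  let ?W = "wreath_power H X \<phi>"
  have GW: "G \<subseteq> ?W"
    using C.G_T C.vertex_perm_G by (auto simp: eq wreath_power_def simp del: in_lists_conv_set)
  have "\<exists>g\<in>G. g \<in> ?W \<and> agree_upto X n w g" if w: "w \<in> ?W" for w n
  proof -
    obtain g where "g \<in> finitary X ?P n" "\<forall>v\<in>lists X. length v \<le> n \<longrightarrow> g v = w v"
      using C.finitary_approximation[of w n] w unfolding wreath_power_def by blast
    then show ?thesis using C.finitary_G[of n] GW eq by (metis agree_upto_def subsetD)
  qed
  then have "subtopology (AutT_topology X) ?W closure_of G = ?W"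
    by (rule closure_of_subtopology_AutT[OF wreath_power_subset])
  then show "dense_subgroup X G ?W"
    unfolding dense_subgroup_def
      subgroup_carrier_update_iff[OF group_AutT subgroup_wreath_power[OF act(1)]]
    using GW C.subgroup_G eq by simp
qed

section \<open>Permutational wreath products\<close>

locale wreath_product =
  fixes K :: "('k, 'c) monoid_scheme" and H :: "('g, 'b) monoid_scheme"
    and X :: "'x set" and \<phi> :: "'g \<Rightarrow> 'x \<Rightarrow> 'x"
  assumes group_K: "group K" and hom: "group_hom H (BijGroup X) \<phi>"
begin

sublocale K: group K by (rule group_K)

sublocale \<phi>: group_hom H "BijGroup X" \<phi> by (rule hom)

text \<open>These rules would turn \<open>\<phi>\<close> of a product into a product in
  \<open>BijGroup X\<close> and so block the pointwise rules \<open>act_mult\<close> and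
  \<open>act_inv\<close>.\<close>

declare \<phi>.hom_mult [simp del] \<phi>.hom_inv [simp del] \<phi>.hom_one [simp del]

abbreviation "W \<equiv> wreath K H X \<phi>"

lemma act_Bij: "g \<in> carrier H \<Longrightarrow> \<phi> g \<in> Bij X"
  using \<phi>.hom_closed by simp

lemma act_mem: "g \<in> carrier H \<Longrightarrow> z \<in> X \<Longrightarrow> \<phi> g z \<in> X"
  by (rule Bij_apply_mem[OF act_Bij])

lemma act_one: "z \<in> X \<Longrightarrow> \<phi> \<one>\<^bsub>H\<^esub> z = z"
  by (simp add: \<phi>.hom_one)

lemma act_mult:
  "g \<in> carrier H \<Longrightarrow> h \<in> carrier H \<Longrightarrow> z \<in> X \<Longrightarrow> \<phi> (g \<otimes>\<^bsub>H\<^esub> h) z = \<phi> g (\<phi> h z)"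
  using \<phi>.hom_mult[of g h] by (simp add: mult_BijGroup act_Bij compose_eq)

lemma act_inv: "g \<in> carrier H \<Longrightarrow> z \<in> X \<Longrightarrow> \<phi> (inv\<^bsub>H\<^esub> g) (\<phi> g z) = z"
  using act_mult[of "inv\<^bsub>H\<^esub> g" g z] by (simp add: act_one)

lemma act_inv': "g \<in> carrier H \<Longrightarrow> z \<in> X \<Longrightarrow> \<phi> g (\<phi> (inv\<^bsub>H\<^esub> g) z) = z"
  using act_mult[of g "inv\<^bsub>H\<^esub> g" z] by (simp add: act_one)

lemma wreath_carrier: "carrier W = (X \<rightarrow>\<^sub>E carrier K) \<times> carrier H"
  by (simp add: wreath_def)

lemma wreath_one: "\<one>\<^bsub>W\<^esub> = (\<lambda>z\<in>X. \<one>\<^bsub>K\<^esub>, \<one>\<^bsub>H\<^esub>)"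
  by (simp add: wreath_def)

lemma wreath_mult:
  "(k, g) \<otimes>\<^bsub>W\<^esub> (k', g') = (\<lambda>z\<in>X. k z \<otimes>\<^bsub>K\<^esub> k' (\<phi> (inv\<^bsub>H\<^esub> g) z), g \<otimes>\<^bsub>H\<^esub> g')"
  by (simp add: wreath_def)

lemma base_mem: "k \<in> X \<rightarrow>\<^sub>E carrier K \<Longrightarrow> z \<in> X \<Longrightarrow> k z \<in> carrier K"
  by (rule PiE_mem)

lemma PiE_extensional: "k \<in> X \<rightarrow>\<^sub>E carrier K \<Longrightarrow> k \<in> extensional X"
  by (simp add: PiE_def)

lemma group_wreath: "group W"
proof (rule groupI)
  show "\<one>\<^bsub>W\<^esub> \<in> carrier W" by (simp add: wreath_carrier wreath_one)
  show "p \<otimes>\<^bsub>W\<^esub> q \<in> carrier W" if "p \<in> carrier W" "q \<in> carrier W" for p q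
    using that by (cases p, cases q) (auto simp: wreath_carrier wreath_mult intro: base_mem act_mem)
  show "p \<otimes>\<^bsub>W\<^esub> q \<otimes>\<^bsub>W\<^esub> r = p \<otimes>\<^bsub>W\<^esub> (q \<otimes>\<^bsub>W\<^esub> r)"
    if "p \<in> carrier W" "q \<in> carrier W" "r \<in> carrier W" for p q r
  proof -
    obtain k g k' g' k'' g'' where pqr: "p = (k, g)" "q = (k', g')" "r = (k'', g'')"
      by (cases p, cases q, cases r) blast
    then have c: "k \<in> X \<rightarrow>\<^sub>E carrier K" "k' \<in> X \<rightarrow>\<^sub>E carrier K" "k'' \<in> X \<rightarrow>\<^sub>E carrier K"
      "g \<in> carrier H" "g' \<in> carrier H" "g'' \<in> carrier H"
      using that by (auto simp: wreath_carrier)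
    have "k z \<otimes>\<^bsub>K\<^esub> k' (\<phi> (inv\<^bsub>H\<^esub> g) z) \<otimes>\<^bsub>K\<^esub> k'' (\<phi> (inv\<^bsub>H\<^esub> (g \<otimes>\<^bsub>H\<^esub> g')) z) =
        k z \<otimes>\<^bsub>K\<^esub> (k' (\<phi> (inv\<^bsub>H\<^esub> g) z) \<otimes>\<^bsub>K\<^esub> k'' (\<phi> (inv\<^bsub>H\<^esub> g') (\<phi> (inv\<^bsub>H\<^esub> g) z)))"
      if z: "z \<in> X" for z
    proof -
      have m: "\<phi> (inv\<^bsub>H\<^esub> g) z \<in> X" "\<phi> (inv\<^bsub>H\<^esub> g') (\<phi> (inv\<^bsub>H\<^esub> g) z) \<in> X"
        using c z by (simp_all add: act_mem)
      have "\<phi> (inv\<^bsub>H\<^esub> (g \<otimes>\<^bsub>H\<^esub> g')) z = \<phi> (inv\<^bsub>H\<^esub> g') (\<phi> (inv\<^bsub>H\<^esub> g) z)"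
        using c z by (simp add: \<phi>.G.inv_mult_group act_mult)
      then show ?thesis
        using K.m_assoc[of "k z"] PiE_mem[OF c(1) z] PiE_mem[OF c(2) m(1)] PiE_mem[OF c(3) m(2)] by simp
    qed
    then show ?thesis
      using c unfolding pqr wreath_mult by (auto simp: act_mem \<phi>.G.m_assoc intro!: restrict_ext)
  qed
  show "\<one>\<^bsub>W\<^esub> \<otimes>\<^bsub>W\<^esub> p = p" if "p \<in> carrier W" for p
  proof (cases p)
    case (Pair k g)
    then have c: "k \<in> X \<rightarrow>\<^sub>E carrier K" "g \<in> carrier H" using that by (auto simp: wreath_carrier)
    have "(\<lambda>z\<in>X. (\<lambda>z\<in>X. \<one>\<^bsub>K\<^esub>) z \<otimes>\<^bsub>K\<^esub> k (\<phi> (inv\<^bsub>H\<^esub> \<one>\<^bsub>H\<^esub>) z)) = k"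
      using base_mem[OF c(1)] PiE_extensional[OF c(1)]
      by (intro extensionalityI[of _ X]) (auto simp: act_one)
    then show ?thesis using c unfolding Pair wreath_one wreath_mult by simp
  qed
  show "\<exists>q\<in>carrier W. q \<otimes>\<^bsub>W\<^esub> p = \<one>\<^bsub>W\<^esub>" if "p \<in> carrier W" for p
  proof (cases p)
    case (Pair k g)
    then have c: "k \<in> X \<rightarrow>\<^sub>E carrier K" "g \<in> carrier H" using that by (auto simp: wreath_carrier)
    \<comment> \<open>In the product the twist by the top component \<open>inv g\<close> makes the
      right factor be read at \<open>\<phi> g z\<close>, so the inverse is taken there.\<close>
    let ?q = "(\<lambda>z\<in>X. inv\<^bsub>K\<^esub> k (\<phi> g z), inv\<^bsub>H\<^esub> g)"
    have kz: "k (\<phi> g z) \<in> carrier K" if "z \<in> X" for z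
      using PiE_mem[OF c(1) act_mem[OF c(2) that]] .
    then have "?q \<in> carrier W" using c by (auto simp: wreath_carrier)
    moreover have "?q \<otimes>\<^bsub>W\<^esub> p = \<one>\<^bsub>W\<^esub>"
      using c kz unfolding Pair wreath_one wreath_mult by (auto intro!: restrict_ext)
    ultimately show ?thesis by blast
  qed
qed

sublocale W: group W by (rule group_wreath)

definition base_at :: "'x \<Rightarrow> 'k \<Rightarrow> ('x \<Rightarrow> 'k) \<times> 'g" where
  "base_at z k = (\<lambda>w\<in>X. if w = z then k else \<one>\<^bsub>K\<^esub>, \<one>\<^bsub>H\<^esub>)"

lemma group_hom_base_at: "group_hom K W (base_at z)"
proof -
  have "base_at z (k \<otimes>\<^bsub>K\<^esub> l) = base_at z k \<otimes>\<^bsub>W\<^esub> base_at z l"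
    if "k \<in> carrier K" "l \<in> carrier K" for k l
    using that by (auto simp: base_at_def wreath_mult act_one intro!: restrict_ext)
  then show ?thesis
    by (auto simp: group_hom_def group_hom_axioms_def hom_def group_K group_wreath
        wreath_carrier base_at_def)
qed

lemma group_hom_top: "group_hom H W (\<lambda>g. (\<lambda>z\<in>X. \<one>\<^bsub>K\<^esub>, g))"
  by (auto simp: group_hom_def group_hom_axioms_def hom_def group_wreath
      wreath_carrier wreath_mult act_mem intro!: restrict_ext)

text \<open>The coordinate copies of \<open>K\<close> and the top copy of \<open>H\<close> are
  images of perfect groups, hence lie in the derived subgroup. They generate everything, since over
  a finite \<open>X\<close> each base element is a finite product of coordinate elements.\<close>

lemma perfect_wreath:
  assumes fin: "finite X" and pK: "perfect_group K" and pH: "perfect_group H"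
  shows "perfect_group W"
proof -
  let ?D = "derived W (carrier W)"
  have D: "subgroup ?D W" by (rule W.derived_is_subgroup) simp
  have img: "\<kappa> a \<in> ?D"
    if \<kappa>: "group_hom A W \<kappa>" and A: "derived A (carrier A) = carrier A" and a: "a \<in> carrier A"
    for \<kappa> and a :: 'a and A :: "('a, 'e) monoid_scheme"
  proof -
    interpret \<kappa>: group_hom A W \<kappa> by (rule \<kappa>)
    have "\<kappa> ` carrier A = derived W (\<kappa> ` carrier A)"
      using \<kappa>.derived_img[of "carrier A"] A by simp
    also have "\<dots> \<subseteq> ?D" using \<kappa>.hom_closed by (intro W.mono_derived) blast
    finally show ?thesis using a by blast
  qed
  have base: "base_at z k \<in> ?D" if "k \<in> carrier K" for z k
    using img[OF group_hom_base_at _ that] pK by (simp add: perfect_group_def)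
  have top: "(\<lambda>z\<in>X. \<one>\<^bsub>K\<^esub>, g) \<in> ?D" if "g \<in> carrier H" for g
    using img[OF group_hom_top _ that] pH by (simp add: perfect_group_def)
  have part: "(\<lambda>z\<in>X. if z \<in> Y then k z else \<one>\<^bsub>K\<^esub>, \<one>\<^bsub>H\<^esub>) \<in> ?D"
    if "finite Y" "Y \<subseteq> X" "k \<in> X \<rightarrow> carrier K" for Y k
    using that
  proof (induction Y)
    case empty
    then show ?case
      using subgroup.one_closed[OF D] by (simp only: empty_iff if_False wreath_one)
  next
    case (insert w Y)
    have eq: "(\<lambda>z\<in>X. if z \<in> insert w Y then k z else \<one>\<^bsub>K\<^esub>, \<one>\<^bsub>H\<^esub>) =
        base_at w (k w) \<otimes>\<^bsub>W\<^esub> (\<lambda>z\<in>X. if z \<in> Y then k z else \<one>\<^bsub>K\<^esub>, \<one>\<^bsub>H\<^esub>)"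
      using insert by (auto simp: base_at_def wreath_mult act_one Pi_iff intro!: restrict_ext)
    have "k w \<in> carrier K" "Y \<subseteq> X" using insert.prems by auto
    then show ?case
      unfolding eq
      by (rule subgroup.m_closed[OF D base insert.IH]) (rule insert.prems(2))
  qed
  have "carrier W \<subseteq> ?D"
  proof
    fix p assume "p \<in> carrier W"
    then obtain k g where p: "p = (k, g)" "k \<in> X \<rightarrow>\<^sub>E carrier K" "g \<in> carrier H"
      by (auto simp: wreath_carrier)
    have kX: "(\<lambda>z\<in>X. if z \<in> X then k z else \<one>\<^bsub>K\<^esub>) = k"
      using p(2) by (intro extensionalityI[of _ X]) (auto simp: PiE_def)
    have "(\<lambda>z\<in>X. k z \<otimes>\<^bsub>K\<^esub> (\<lambda>z\<in>X. \<one>\<^bsub>K\<^esub>) (\<phi> (inv\<^bsub>H\<^esub> \<one>\<^bsub>H\<^esub>) z)) = k"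
      using base_mem[OF p(2)] PiE_extensional[OF p(2)]
      by (intro extensionalityI[of _ X]) (auto simp: act_one)
    then have "p = (k, \<one>\<^bsub>H\<^esub>) \<otimes>\<^bsub>W\<^esub> (\<lambda>z\<in>X. \<one>\<^bsub>K\<^esub>, g)"
      using p by (simp add: wreath_mult)
    moreover have "(k, \<one>\<^bsub>H\<^esub>) \<in> ?D" using part[OF fin, of k] p(2) kX by auto
    ultimately show "p \<in> ?D" using top[OF p(3)] subgroup.m_closed[OF D] by simp
  qed
  then show ?thesis
    using subgroup.subset[OF D] group_wreath by (auto simp: perfect_group_def)
qed

end

section \<open>The natural action of a wreath product on pairs\<close>

locale wreath_product_action = wreath_product K H X \<phi>
  for K :: "('k, 'c) monoid_scheme" and H :: "('g, 'b) monoid_scheme"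
    and X :: "'x set" and \<phi> :: "'g \<Rightarrow> 'x \<Rightarrow> 'x" +
  fixes Y :: "'y set" and \<psi> :: "'k \<Rightarrow> 'y \<Rightarrow> 'y"
  assumes hom_\<psi>: "group_hom K (BijGroup Y) \<psi>"
begin

text \<open>Interpreting the locale with the two groups exchanged makes the pointwise rules
  available for the action of \<open>K\<close> on \<open>Y\<close> as well.\<close>

sublocale \<psi>: wreath_product H K Y \<psi>
  by (rule wreath_product.intro[OF \<phi>.G.group_axioms hom_\<psi>])

abbreviation "act \<equiv> wreath_action X \<phi> Y \<psi>"

lemma wreath_action_apply:
  "z \<in> X \<Longrightarrow> w \<in> Y \<Longrightarrow> act (k, g) (z, w) = (\<phi> g z, \<psi> (k (\<phi> g z)) w)"
  by (simp add: wreath_action_def)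

lemma wreath_action_Bij:
  assumes "p \<in> carrier W"
  shows "act p \<in> Bij (X \<times> Y)"
proof -
  obtain k g where p: "p = (k, g)" "k \<in> X \<rightarrow>\<^sub>E carrier K" "g \<in> carrier H"
    using assms by (auto simp: wreath_carrier)
  have kz: "k (\<phi> g z) \<in> carrier K" "\<phi> g z \<in> X" if "z \<in> X" for z
    using PiE_mem[OF p(2) act_mem[OF p(3) that]] act_mem[OF p(3) that] .
  have "inj_on (act p) (X \<times> Y)"
  proof (rule inj_onI, clarify)
    fix z w z' w' assume zw: "z \<in> X" "w \<in> Y" "z' \<in> X" "w' \<in> Y" and eq: "act p (z, w) = act p (z', w')"
    then have "z = z'" using Bij_eq_iff[OF act_Bij[OF p(3)]] by (simp add: p(1) wreath_action_apply)
    moreover have "w = w'"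
      using eq zw \<open>z = z'\<close> Bij_eq_iff[OF \<psi>.act_Bij[OF kz(1)[OF zw(1)]]]
      by (simp add: p(1) wreath_action_apply)
    ultimately show "z = z' \<and> w = w'" by blast
  qed
  moreover have "act p ` (X \<times> Y) = X \<times> Y"
  proof
    show "act p ` (X \<times> Y) \<subseteq> X \<times> Y"
      using kz \<psi>.act_mem by (auto simp: p(1) wreath_action_apply)
    show "X \<times> Y \<subseteq> act p ` (X \<times> Y)"
    proof clarify
      fix a b assume ab: "a \<in> X" "b \<in> Y"
      \<comment> \<open>The base coordinate is read at the target \<open>a\<close> of the first
        component, so \<open>?w\<close> has to undo \<open>k a\<close>.\<close>
      let ?z = "\<phi> (inv\<^bsub>H\<^esub> g) a" and ?w = "\<psi> (inv\<^bsub>K\<^esub> (k a)) b"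
      have ka: "k a \<in> carrier K" using PiE_mem[OF p(2) ab(1)] .
      have "?z \<in> X" "?w \<in> Y" using ab p(3) ka by (simp_all add: act_mem \<psi>.act_mem)
      moreover have "act p (?z, ?w) = (a, b)"
        using calculation ab p(3) ka by (simp add: p(1) wreath_action_apply act_inv' \<psi>.act_inv')
      ultimately show "(a, b) \<in> act p ` (X \<times> Y)" by (metis image_eqI SigmaI)
    qed
  qed
  moreover have "act p \<in> extensional (X \<times> Y)" by (simp add: p(1) wreath_action_def)
  ultimately show ?thesis by (simp add: Bij_def bij_betw_def)
qed

lemma group_hom_wreath_action: "group_hom W (BijGroup (X \<times> Y)) act"
proof -
  have "act (p \<otimes>\<^bsub>W\<^esub> q) = compose (X \<times> Y) (act p) (act q)"
    if pq: "p \<in> carrier W" "q \<in> carrier W" for p q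
  proof -
    obtain k g l h where p: "p = (k, g)" "k \<in> X \<rightarrow>\<^sub>E carrier K" "g \<in> carrier H"
      and q: "q = (l, h)" "l \<in> X \<rightarrow>\<^sub>E carrier K" "h \<in> carrier H"
      using pq by (auto simp: wreath_carrier)
    show ?thesis
    proof (rule extensionalityI[of _ "X \<times> Y"])
      show "act (p \<otimes>\<^bsub>W\<^esub> q) \<in> extensional (X \<times> Y)"
        using Bij_imp_extensional[OF wreath_action_Bij] pq by simp
      fix c assume "c \<in> X \<times> Y"
      then obtain z w where c: "c = (z, w)" "z \<in> X" "w \<in> Y" by blast
      have m: "\<phi> h z \<in> X" "\<phi> g (\<phi> h z) \<in> X" using c p q by (simp_all add: act_mem)
      have kl: "k (\<phi> g (\<phi> h z)) \<in> carrier K" "l (\<phi> h z) \<in> carrier K"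
        using PiE_mem[OF p(2) m(2)] PiE_mem[OF q(2) m(1)] .
      show "act (p \<otimes>\<^bsub>W\<^esub> q) c = compose (X \<times> Y) (act p) (act q) c"
        using c m kl p(3) q(3)
        by (simp add: p(1) q(1) compose_eq wreath_mult wreath_action_apply act_mult act_inv
            \<psi>.act_mem \<psi>.act_mult)
    qed simp
  qed
  then show ?thesis
    by (auto simp: group_hom_def group_hom_axioms_def hom_def group_wreath group_BijGroup
        wreath_action_Bij mult_BijGroup)
qed

text \<open>A point of \<open>Y\<close> makes the first component visible, which gives
  \<open>g = h\<close>; each base coordinate is then read off below its preimage under
  \<open>g\<close>.\<close>

lemma inj_wreath_action:
  assumes inj: "inj_on \<phi> (carrier H)" "inj_on \<psi> (carrier K)" and ne: "Y \<noteq> {}"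
  shows "inj_on act (carrier W)"
proof (rule inj_onI)
  fix p q assume pq: "p \<in> carrier W" "q \<in> carrier W" and eq: "act p = act q"
  obtain k g l h where p: "p = (k, g)" "k \<in> X \<rightarrow>\<^sub>E carrier K" "g \<in> carrier H"
    and q: "q = (l, h)" "l \<in> X \<rightarrow>\<^sub>E carrier K" "h \<in> carrier H"
    using pq by (auto simp: wreath_carrier)
  have eq': "\<phi> g z = \<phi> h z \<and> \<psi> (k (\<phi> g z)) w = \<psi> (l (\<phi> h z)) w" if "z \<in> X" "w \<in> Y" for z w
    using fun_cong[OF eq, of "(z, w)"]
    unfolding p(1) q(1) wreath_action_apply[OF that] prod.inject .
  have "\<phi> g = \<phi> h"
    using eq' ne Bij_imp_extensional[OF act_Bij[OF p(3)]] Bij_imp_extensional[OF act_Bij[OF q(3)]]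
    by (intro extensionalityI[of _ X]) auto
  then have gh: "g = h" using inj(1) p(3) q(3) by (auto dest: inj_onD)
  have "k = l"
  proof (rule extensionalityI[of _ X])
    fix a assume a: "a \<in> X"
    let ?z = "\<phi> (inv\<^bsub>H\<^esub> g) a"
    have z: "?z \<in> X" "\<phi> g ?z = a" using a p(3) by (simp_all add: act_mem act_inv')
    have kl: "k a \<in> carrier K" "l a \<in> carrier K" using PiE_mem[OF p(2) a] PiE_mem[OF q(2) a] .
    have "\<psi> (k a) = \<psi> (l a)"
      using eq'[OF z(1)] z(2) gh Bij_imp_extensional[OF \<psi>.act_Bij[OF kl(1)]]
        Bij_imp_extensional[OF \<psi>.act_Bij[OF kl(2)]]
      by (intro extensionalityI[of _ Y]) auto
    then show "k a = l a" using inj(2) kl by (auto dest: inj_onD)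
  qed (use p(2) q(2) in \<open>auto simp: PiE_def\<close>)
  then show "p = q" using p(1) q(1) gh by simp
qed

end

lemma wreath_product_actionI:
  assumes "finite_transitive_perm_group H X \<phi>" "finite_transitive_perm_group K Y \<psi>"
  shows "wreath_product_action K H X \<phi> Y \<psi>"
  using faithful_action_group_hom(1)[OF assms(1)] faithful_action_group_hom(1)[OF assms(2)]
  by (auto simp: wreath_product_action_def wreath_product_def wreath_product_action_axioms_def
      group_hom_def)

lemma finite_transitive_perm_groupI:
  assumes "group_hom H (BijGroup X) \<phi>" "inj_on \<phi> (carrier H)" "finite X"
    "\<And>a b. a \<in> X \<Longrightarrow> b \<in> X \<Longrightarrow> \<exists>s\<in>carrier H. \<phi> s a = b"
  shows "finite_transitive_perm_group H X \<phi>"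
  using assms
  by (auto simp: finite_transitive_perm_group_def faithful_action_def faithful_action_axioms_def
      transitive_action_def transitive_action_axioms_def group_action_def)

theorem finite_transitive_wreath:
  assumes H: "finite_transitive_perm_group H X \<phi>" and K: "finite_transitive_perm_group K Y \<psi>"
    and ne: "Y \<noteq> {}"
  shows "finite_transitive_perm_group (wreath K H X \<phi>) (X \<times> Y) (wreath_action X \<phi> Y \<psi>)"
proof -
  note aH = faithful_action_group_hom[OF H] and aK = faithful_action_group_hom[OF K]
  interpret wreath_product_action K H X \<phi> Y \<psi> by (rule wreath_product_actionI[OF H K])
  show ?thesis
  proof (rule finite_transitive_perm_groupI)
    show "group_hom W (BijGroup (X \<times> Y)) act" by (rule group_hom_wreath_action)
    show "inj_on act (carrier W)" by (rule inj_wreath_action[OF aH(2) aK(2) ne])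
    show "finite (X \<times> Y)" using aH(3) aK(3) by simp
    fix a b assume "a \<in> X \<times> Y" "b \<in> X \<times> Y"
    then obtain z w z' w' where ab: "a = (z, w)" "b = (z', w')" "z \<in> X" "w \<in> Y" "z' \<in> X" "w' \<in> Y"
      by blast
    obtain g where g: "g \<in> carrier H" "\<phi> g z = z'" using aH(4) ab by blast
    obtain k where k: "k \<in> carrier K" "\<psi> k w = w'" using aK(4) ab by blast
    \<comment> \<open>A constant base element has the required coordinate wherever \<open>g\<close>
      sends the first component.\<close>
    have "((\<lambda>_\<in>X. k), g) \<in> carrier W" using g k by (simp add: wreath_carrier)
    moreover have "act ((\<lambda>_\<in>X. k), g) a = b" using ab g k by (simp add: wreath_action_apply)
    ultimately show "\<exists>s\<in>carrier W. act s a = b" by blast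
  qed
qed

section \<open>The wreath square satisfies \<open>condition_star\<close>\<close>

lemma perfect_comm_group_trivial:
  assumes "comm_group H" "perfect_group H"
  shows "carrier H = {\<one>\<^bsub>H\<^esub>}"
  using comm_group.derived_eq_singleton[OF assms(1), of "carrier H"] assms(2)
  by (simp add: perfect_group_def)

text \<open>By faithfulness some \<open>h\<close> moves a point \<open>w\<close>. Placed in the base
  at coordinate \<open>w\<close>, it moves \<open>(w, w)\<close> but fixes
  \<open>(\<phi> h w, w)\<close>, and transitivity puts both points in one orbit. A commutative
  perfect group would be trivial, which the same element refutes.\<close>

theorem condition_star_wreath:
  assumes H: "finite_transitive_perm_group H X \<phi>" and perf: "perfect_group H"
    and nontrivial: "carrier H \<noteq> {\<one>\<^bsub>H\<^esub>}"
  shows "condition_star (wreath H H X \<phi>) (X \<times> X) (wreath_action X \<phi> X \<phi>)"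
proof -
  note aH = faithful_action_group_hom[OF H]
  interpret wreath_product_action H H X \<phi> X \<phi> by (rule wreath_product_actionI[OF H H])
  obtain h where h: "h \<in> carrier H" "h \<noteq> \<one>\<^bsub>H\<^esub>"
    using nontrivial K.one_closed by blast
  have "\<phi> h \<noteq> (\<lambda>z\<in>X. z)"
    using inj_onD[OF aH(2), of h "\<one>\<^bsub>H\<^esub>"] h \<phi>.hom_one by auto
  moreover have "\<phi> h \<in> extensional X" by (rule Bij_imp_extensional[OF act_Bij[OF h(1)]])
  ultimately obtain w where w: "w \<in> X" "\<phi> h w \<noteq> w"
    using extensionalityI[of "\<phi> h" X "\<lambda>z\<in>X. z"] by auto
  let ?z = "\<phi> h w"
  have z: "?z \<in> X" by (rule act_mem[OF h(1) w(1)])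
  have ftp: "finite_transitive_perm_group W (X \<times> X) act"
    using finite_transitive_wreath[OF H H] w(1) by blast
  have pW: "perfect_group W" by (rule perfect_wreath[OF aH(3) perf perf])
  have b: "base_at w h \<in> carrier W" using h(1) by (simp add: base_at_def wreath_carrier)
  have bw: "act (base_at w h) (w, w) = (w, ?z)"
    using w(1) by (simp add: base_at_def wreath_action_apply act_one)
  have bz: "act (base_at w h) (?z, w) = (?z, w)"
    using w z by (simp add: base_at_def wreath_action_apply act_one)
  have "stabilizer W act (w, w) \<noteq> stabilizer W act (?z, w)"
    using b bw bz w(2) unfolding stabilizer_def by force
  moreover have "(?z, w) \<in> orbit W act (w, w)"
    using faithful_action_group_hom(4)[OF ftp, of "(w, w)" "(?z, w)"] w z
    by (force simp: orbit_def)
  moreover have "\<not> comm_group W"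
  proof
    assume "comm_group W"
    then have "carrier W = {\<one>\<^bsub>W\<^esub>}" using pW by (rule perfect_comm_group_trivial)
    then have "base_at w h = \<one>\<^bsub>W\<^esub>" using b by blast
    then have "act (base_at w h) (w, w) = (w, w)"
      using w(1) by (simp add: wreath_one wreath_action_apply act_one)
    then show False using bw w(2) by simp
  qed
  moreover have "card (X \<times> X) \<ge> 2"
  proof -
    have "card {w, ?z} \<le> card X" using aH(3) w(1) z by (intro card_mono) auto
    then have "2 \<le> card X" using w(2) by auto
    then show ?thesis using mult_le_mono[of 1 "card X" 2 "card X"] by (simp add: card_cartesian_product)
  qed
  ultimately show ?thesis
    unfolding condition_star_def using w(1) by blast
qed

section \<open>Passing from \<open>X\<close> to \<open>X \<times> X\<close>\<close>

lemma unpair_word_Nil [simp]: "unpair_word [] = []"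
  and unpair_word_Cons [simp]: "unpair_word ((a, b) # w) = a # b # unpair_word w"
  by (simp_all add: unpair_word_def)

lemma pair_unpair_word [simp]: "pair_word (unpair_word w) = w"
  by (induction w) auto

lemma length_unpair_word [simp]: "length (unpair_word w) = 2 * length w"
  by (induction w) auto

lemma unpair_pair_word: "even (length u) \<Longrightarrow> unpair_word (pair_word u) = u"
  by (induction u rule: pair_word.induct) auto

lemma unpair_word_lists: "w \<in> lists (X \<times> X) \<Longrightarrow> unpair_word w \<in> lists X"
  by (induction w rule: lists.induct) auto

lemma pair_word_lists: "u \<in> lists X \<Longrightarrow> pair_word u \<in> lists (X \<times> X)"
  by (induction u rule: pair_word.induct) auto

text \<open>The second component is indexed by the letter before it is moved, as for vertex
  permutations in the tree, whereas \<open>wreath_action\<close> reads its base at the letter after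
  the move.\<close>

definition pair_perm :: "'x set \<Rightarrow> ('x \<Rightarrow> 'x) \<Rightarrow> ('x \<Rightarrow> 'x \<Rightarrow> 'x) \<Rightarrow> 'x \<times> 'x \<Rightarrow> 'x \<times> 'x" where
  "pair_perm X s r = (\<lambda>(a, b)\<in>X \<times> X. (s a, r a b))"

lemma pair_perm_apply: "a \<in> X \<Longrightarrow> b \<in> X \<Longrightarrow> pair_perm X s r (a, b) = (s a, r a b)"
  by (simp add: pair_perm_def)

lemma pair_word_portrait_map:
  assumes "w \<in> lists (X \<times> X)"
  shows "pair_word (portrait_map p (unpair_word w)) =
    portrait_map (\<lambda>v. pair_perm X (p (unpair_word v)) (\<lambda>a. p (unpair_word v @ [a]))) w"
  using assms
proof (induction w arbitrary: p rule: list.induct)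
  case (Cons c w)
  obtain a b where c: "c = (a, b)" by (cases c)
  then have ab: "a \<in> X" "b \<in> X" "w \<in> lists (X \<times> X)" using Cons.prems by auto
  show ?case
    using Cons.IH[OF ab(3), of "\<lambda>v. p (a # b # v)"] ab by (simp add: c pair_perm_apply)
qed simp

text \<open>One vertex permutation of the merged tree packs that of the original portrait at a
  vertex of even level together with those at all its children.\<close>

lemma two_step_portrait_aut:
  "two_step X (portrait_aut X p) =
    portrait_aut (X \<times> X) (\<lambda>v. pair_perm X (p (unpair_word v)) (\<lambda>a. p (unpair_word v @ [a])))"
  by (auto simp: two_step_def portrait_aut_def restrict_def pair_word_portrait_map unpair_word_lists
      simp del: in_lists_conv_set)

text \<open>Presents the wreath power by freely chosen portraits, on which \<open>two_step\<close>
  can be computed.\<close>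

lemma wreath_power_eq_portraits:
  assumes "group_hom H (BijGroup X) \<phi>"
  shows "wreath_power H X \<phi> = {portrait_aut X p | p. \<forall>v\<in>lists X. p v \<in> \<phi> ` carrier H}"
proof -
  interpret \<phi>: group_hom H "BijGroup X" \<phi> by (rule assms)
  have PB: "\<phi> ` carrier H \<subseteq> Bij X" using \<phi>.hom_closed by auto
  show ?thesis
  proof
    show "wreath_power H X \<phi> \<subseteq> {portrait_aut X p | p. \<forall>v\<in>lists X. p v \<in> \<phi> ` carrier H}"
    proof
      fix g assume g: "g \<in> wreath_power H X \<phi>"
      then have "g = portrait_aut X (vertex_perm X g)"
        by (simp add: wreath_power_def AutT_eq_portrait_aut)
      then show "g \<in> {portrait_aut X p | p. \<forall>v\<in>lists X. p v \<in> \<phi> ` carrier H}"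
        using g unfolding wreath_power_def by blast
    qed
    show "{portrait_aut X p | p. \<forall>v\<in>lists X. p v \<in> \<phi> ` carrier H} \<subseteq> wreath_power H X \<phi>"
    proof clarify
      fix p assume p: "\<forall>v\<in>lists X. p v \<in> \<phi> ` carrier H"
      then have pB: "p v \<in> Bij X" if "v \<in> lists X" for v using PB that by blast
      show "portrait_aut X p \<in> wreath_power H X \<phi>"
        using p portrait_aut_in_AutT[OF pB] vertex_perm_portrait_aut[OF pB]
        by (simp add: wreath_power_def del: in_lists_conv_set)
    qed
  qed
qed

lemma wreath_action_image:
  assumes "wreath_product H H X \<phi>"
  shows "wreath_action X \<phi> X \<phi> ` carrier (wreath H H X \<phi>) =
    {pair_perm X s r | s r. s \<in> \<phi> ` carrier H \<and> r \<in> X \<rightarrow> \<phi> ` carrier H}"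
proof -
  interpret wreath_product H H X \<phi> by (rule assms)
  show ?thesis
  proof
    show "wreath_action X \<phi> X \<phi> ` carrier W \<subseteq>
        {pair_perm X s r | s r. s \<in> \<phi> ` carrier H \<and> r \<in> X \<rightarrow> \<phi> ` carrier H}"
    proof clarify
      fix k g assume "(k, g) \<in> carrier W"
      then have kg: "k \<in> X \<rightarrow>\<^sub>E carrier H" "g \<in> carrier H" by (auto simp: wreath_carrier)
      have "wreath_action X \<phi> X \<phi> (k, g) = pair_perm X (\<phi> g) (\<lambda>a. \<phi> (k (\<phi> g a)))"
        by (simp add: wreath_action_def pair_perm_def)
      moreover have "(\<lambda>a. \<phi> (k (\<phi> g a))) \<in> X \<rightarrow> \<phi> ` carrier H"
        using kg by (auto simp: act_mem PiE_mem)
      ultimately show "\<exists>s r. wreath_action X \<phi> X \<phi> (k, g) = pair_perm X s r \<and>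
          s \<in> \<phi> ` carrier H \<and> r \<in> X \<rightarrow> \<phi> ` carrier H"
        using kg(2) by blast
    qed
    show "{pair_perm X s r | s r. s \<in> \<phi> ` carrier H \<and> r \<in> X \<rightarrow> \<phi> ` carrier H} \<subseteq>
        wreath_action X \<phi> X \<phi> ` carrier W"
    proof clarify
      fix r g assume r: "r \<in> X \<rightarrow> \<phi> ` carrier H" and g: "g \<in> carrier H"
      have "\<forall>a\<in>X. \<exists>l. l \<in> carrier H \<and> r a = \<phi> l" using r by blast
      then obtain l where l: "\<And>a. a \<in> X \<Longrightarrow> l a \<in> carrier H" "\<And>a. a \<in> X \<Longrightarrow> r a = \<phi> (l a)"
        by metis
      \<comment> \<open>Reindexing from source letters to target letters: the action of
        \<open>(?k, g)\<close> reads \<open>?k\<close> at \<open>\<phi> g a\<close>, which returns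
        \<open>l a\<close>.\<close>
      let ?k = "\<lambda>c\<in>X. l (\<phi> (inv\<^bsub>H\<^esub> g) c)"
      have "(?k, g) \<in> carrier W" using l(1) g by (auto simp: wreath_carrier act_mem)
      moreover have "pair_perm X (\<phi> g) r = wreath_action X \<phi> X \<phi> (?k, g)"
        using g l(2) by (auto simp: wreath_action_def pair_perm_def act_mem act_inv intro!: restrict_ext)
      ultimately show "pair_perm X (\<phi> g) r \<in> wreath_action X \<phi> X \<phi> ` carrier W" by blast
    qed
  qed
qed

context
  fixes H :: "('g, 'b) monoid_scheme" and X :: "'x set" and \<phi> :: "'g \<Rightarrow> 'x \<Rightarrow> 'x"
  assumes H: "finite_transitive_perm_group H X \<phi>"
begin

interpretation wreath_product_action H H X \<phi> X \<phi>
  by (rule wreath_product_actionI[OF H H])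

lemma two_step_image:
  "two_step X ` wreath_power H X \<phi> = wreath_power W (X \<times> X) act"
proof -
  let ?P = "\<phi> ` carrier H"
  note W1 = wreath_power_eq_portraits[OF hom]
  note W2 = wreath_power_eq_portraits[OF group_hom_wreath_action]
  note im = wreath_action_image[OF wreath_product_axioms]
  show ?thesis
  proof
    show "two_step X ` wreath_power H X \<phi> \<subseteq> wreath_power W (X \<times> X) act"
    proof clarify
      fix g assume "g \<in> wreath_power H X \<phi>"
      then obtain p where p: "g = portrait_aut X p" "\<forall>v\<in>lists X. p v \<in> ?P" unfolding W1 by blast
      let ?q = "\<lambda>v. pair_perm X (p (unpair_word v)) (\<lambda>a. p (unpair_word v @ [a]))"
      have "?q v \<in> act ` carrier W" if v: "v \<in> lists (X \<times> X)" for v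
      proof -
        have "p (unpair_word v) \<in> ?P" using p(2) unpair_word_lists[OF v] by blast
        moreover have "(\<lambda>a. p (unpair_word v @ [a])) \<in> X \<rightarrow> ?P"
          using p(2) unpair_word_lists[OF v] by auto
        ultimately show ?thesis unfolding im by blast
      qed
      then show "two_step X g \<in> wreath_power W (X \<times> X) act"
        unfolding p(1) two_step_portrait_aut W2 by blast
    qed
    show "wreath_power W (X \<times> X) act \<subseteq> two_step X ` wreath_power H X \<phi>"
    proof
      fix g assume "g \<in> wreath_power W (X \<times> X) act"
      then obtain q where q: "g = portrait_aut (X \<times> X) q" "\<forall>v\<in>lists (X \<times> X). q v \<in> act ` carrier W"
        unfolding W2 by blast
      have "\<forall>v\<in>lists (X \<times> X). \<exists>sr. q v = pair_perm X (fst sr) (snd sr) \<and> fst sr \<in> ?P \<and> snd sr \<in> X \<rightarrow> ?P"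
        using q(2) unfolding im by fastforce
      then obtain sr where sr: "\<And>v. v \<in> lists (X \<times> X) \<Longrightarrow> q v = pair_perm X (fst (sr v)) (snd (sr v)) \<and>
          fst (sr v) \<in> ?P \<and> snd (sr v) \<in> X \<rightarrow> ?P"
        by metis
      \<comment> \<open>A merged vertex permutation is unpacked: its first component goes to the
        vertex of even level, its second to the children, selected by their last letter.\<close>
      define p where "p u = (if even (length u) then fst (sr (pair_word u))
        else snd (sr (pair_word (butlast u))) (last u))" for u
      have pP: "p u \<in> ?P" if u: "u \<in> lists X" for u
      proof (cases "even (length u)")
        case True
        then show ?thesis using sr[OF pair_word_lists[OF u]] by (simp add: p_def)
      next
        case False
        then obtain v a where va: "u = v @ [a]" by (cases u rule: rev_cases) auto
        then have "v \<in> lists X" "a \<in> X" using u by auto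
        then show ?thesis using sr[OF pair_word_lists[of v X]] va False by (auto simp: p_def)
      qed
      have "g = two_step X (portrait_aut X p)"
        unfolding q(1) two_step_portrait_aut
        by (rule portrait_aut_cong) (simp add: p_def sr del: in_lists_conv_set)
      moreover have "portrait_aut X p \<in> wreath_power H X \<phi>" unfolding W1 using pP by blast
      ultimately show "g \<in> two_step X ` wreath_power H X \<phi>" by blast
    qed
  qed
qed

text \<open>Length \<open>n\<close> over \<open>X \<times> X\<close> is length \<open>2 * n\<close>
  over \<open>X\<close>. Words of even length are compared directly; an odd one is a prefix of an
  even one, and automorphisms preserve prefixes.\<close>

lemma two_step_agree:
  assumes g: "g \<in> carrier (AutT X)" and h: "h \<in> carrier (AutT X)"
  shows "agree_upto X (2 * n) g h \<longleftrightarrow> agree_upto (X \<times> X) n (two_step X g) (two_step X h)"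
proof
  assume *: "agree_upto X (2 * n) g h"
  then show "agree_upto (X \<times> X) n (two_step X g) (two_step X h)"
    unfolding agree_upto_def two_step_def
    by (simp add: unpair_word_lists del: in_lists_conv_set)
next
  assume *: "agree_upto (X \<times> X) n (two_step X g) (two_step X h)"
  have ev: "g u = h u" if u: "u \<in> lists X" "length u \<le> 2 * n" "even (length u)" for u
  proof -
    let ?w = "pair_word u"
    have w: "?w \<in> lists (X \<times> X)" by (rule pair_word_lists[OF u(1)])
    have uw: "unpair_word ?w = u" by (rule unpair_pair_word[OF u(3)])
    then have "length ?w \<le> n" using u(2) length_unpair_word[of ?w] by simp
    then have "two_step X g ?w = two_step X h ?w"
      using * w unfolding agree_upto_def by blast
    then have "pair_word (g u) = pair_word (h u)"
      using w uw by (simp add: two_step_def del: in_lists_conv_set)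
    moreover have "even (length (g u))" "even (length (h u))"
      using u(3) AutT_length[OF g u(1)] AutT_length[OF h u(1)] by simp_all
    ultimately show ?thesis using unpair_pair_word by metis
  qed
  have "g u = h u" if u: "u \<in> lists X" "length u \<le> 2 * n" for u
  proof (cases "u = [] \<or> even (length u)")
    case True
    then show ?thesis using ev u by auto
  next
    case False
    \<comment> \<open>An odd length stays strictly below \<open>2 * n\<close>, which leaves room for
      one more letter; \<open>u\<close> itself supplies it.\<close>
    then have "length u < 2 * n" using u(2) by (metis even_mult_iff even_numeral le_neq_implies_less)
    moreover obtain a where a: "a \<in> X" using False u(1) by (cases u) auto
    ultimately have "g (u @ [a]) = h (u @ [a])" using u(1) False by (intro ev) auto
    then show ?thesis using AutT_snoc(1)[OF g u(1) a] AutT_snoc(1)[OF h u(1) a] by simp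
  qed
  then show "agree_upto X (2 * n) g h" unfolding agree_upto_def by blast
qed

lemma inj_two_step: "inj_on (two_step X) (carrier (AutT X))"
proof (rule inj_onI)
  fix g h assume g: "g \<in> carrier (AutT X)" and h: "h \<in> carrier (AutT X)"
    and eq: "two_step X g = two_step X h"
  have agree: "agree_upto X (2 * n) g h" for n
    unfolding two_step_agree[OF g h] eq by (rule agree_upto_refl)
  have "g u = h u" if "u \<in> lists X" for u
    using agree[of "length u"] that unfolding agree_upto_def by simp
  then show "g = h"
    using Bij_imp_extensional[OF AutT_Bij[OF g]] Bij_imp_extensional[OF AutT_Bij[OF h]]
    by (intro extensionalityI[of _ "lists X"])
qed

text \<open>\<open>h\<close> preserves lengths, so its value on an unpaired word has even length and
  pairing loses nothing. For elements of the wreath power, \<open>two_step_image\<close> puts the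
  images into \<open>AutT (X \<times> X)\<close>.\<close>

lemma two_step_mult:
  assumes g: "g \<in> wreath_power H X \<phi>" and h: "h \<in> wreath_power H X \<phi>"
  shows "two_step X (g \<otimes>\<^bsub>AutT X\<^esub> h) = two_step X g \<otimes>\<^bsub>AutT (X \<times> X)\<^esub> two_step X h"
proof -
  have gT: "g \<in> carrier (AutT X)" "h \<in> carrier (AutT X)"
    using g h wreath_power_subset by blast+
  have tT: "two_step X g \<in> carrier (AutT (X \<times> X))" "two_step X h \<in> carrier (AutT (X \<times> X))"
    using g h two_step_image wreath_power_subset by blast+
  show ?thesis
    unfolding mult_AutT[OF gT] mult_AutT[OF tT]
  proof (rule extensionalityI[of _ "lists (X \<times> X)"])
    fix w assume w: "w \<in> lists (X \<times> X)"
    let ?u = "unpair_word w"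
    have u: "?u \<in> lists X" by (rule unpair_word_lists[OF w])
    have hu: "h ?u \<in> lists X" by (rule AutT_mem_lists[OF gT(2) u])
    have "even (length (h ?u))" using AutT_length[OF gT(2) u] by simp
    then have "unpair_word (pair_word (h ?u)) = h ?u" by (rule unpair_pair_word)
    then show "two_step X (compose (lists X) g h) w =
        compose (lists (X \<times> X)) (two_step X g) (two_step X h) w"
      using w u pair_word_lists[OF hu]
      by (simp add: two_step_def compose_eq del: in_lists_conv_set)
  qed (simp_all add: two_step_def)
qed

theorem two_step_iso:
  "two_step X \<in> iso (AutT X\<lparr>carrier := wreath_power H X \<phi>\<rparr>)
    (AutT (X \<times> X)\<lparr>carrier := wreath_power W (X \<times> X) act\<rparr>)"
  unfolding iso_def hom_def bij_betw_def carrier_update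
  using two_step_image two_step_mult inj_on_subset[OF inj_two_step wreath_power_subset]
  by auto

text \<open>Agreement up to \<open>n\<close> in the merged tree is agreement up to
  \<open>2 * n\<close> in the original one. Continuity uses this directly; openness also uses that
  agreement up to \<open>2 * n\<close> implies agreement up to \<open>n\<close>.\<close>

theorem two_step_homeomorphic:
  "homeomorphic_map (subtopology (AutT_topology X) (wreath_power H X \<phi>))
    (subtopology (AutT_topology (X \<times> X)) (wreath_power W (X \<times> X) act)) (two_step X)"
proof -
  let ?W1 = "wreath_power H X \<phi>" and ?W2 = "wreath_power W (X \<times> X) act"
  note sub1 = wreath_power_subset[of H X \<phi>] and sub2 = wreath_power_subset[of W "X \<times> X" act]
  note op1 = openin_subtopology_AutT[OF sub1] and op2 = openin_subtopology_AutT[OF sub2]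
  note agree = two_step_agree[OF subsetD[OF sub1] subsetD[OF sub1]]
  note im = two_step_image
  show ?thesis
  proof (rule bijective_open_imp_homeomorphic_map)
    show "continuous_map (subtopology (AutT_topology X) ?W1)
        (subtopology (AutT_topology (X \<times> X)) ?W2) (two_step X)"
      unfolding continuous_map topspace_subtopology_AutT[OF sub1] topspace_subtopology_AutT[OF sub2]
    proof (intro conjI allI impI)
      show "two_step X ` ?W1 \<subseteq> ?W2" using im by simp
      fix U assume U: "openin (subtopology (AutT_topology (X \<times> X)) ?W2) U"
      show "openin (subtopology (AutT_topology X) ?W1) {g \<in> ?W1. two_step X g \<in> U}"
        unfolding op1
      proof (intro conjI ballI)
        fix g assume g: "g \<in> {g \<in> ?W1. two_step X g \<in> U}"
        then obtain n where n: "\<forall>h\<in>?W2. agree_upto (X \<times> X) n (two_step X g) h \<longrightarrow> h \<in> U"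
          using U unfolding op2 by blast
        have "h \<in> {g \<in> ?W1. two_step X g \<in> U}" if h: "h \<in> ?W1" "agree_upto X (2 * n) g h" for h
        proof -
          have "two_step X h \<in> ?W2" using h(1) im by blast
          moreover have "agree_upto (X \<times> X) n (two_step X g) (two_step X h)"
            using agree[of g h n] g h by simp
          ultimately show ?thesis using n h(1) by blast
        qed
        then show "\<exists>n. \<forall>h\<in>?W1. agree_upto X n g h \<longrightarrow> h \<in> {g \<in> ?W1. two_step X g \<in> U}" by blast
      qed blast
    qed
    show "open_map (subtopology (AutT_topology X) ?W1)
        (subtopology (AutT_topology (X \<times> X)) ?W2) (two_step X)"
      unfolding open_map_def op2
    proof (intro allI impI conjI ballI)
      fix U assume U: "openin (subtopology (AutT_topology X) ?W1) U"
      then have UW: "U \<subseteq> ?W1" unfolding op1 by blast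
      then show "two_step X ` U \<subseteq> ?W2" using im by blast
      fix k assume "k \<in> two_step X ` U"
      then obtain g where g: "g \<in> U" "k = two_step X g" by blast
      obtain n where n: "\<forall>h\<in>?W1. agree_upto X n g h \<longrightarrow> h \<in> U"
        using U g(1) unfolding op1 by blast
      have "l \<in> two_step X ` U" if l: "l \<in> ?W2" "agree_upto (X \<times> X) n k l" for l
      proof -
        obtain h where h: "h \<in> ?W1" "l = two_step X h" using l(1) im by blast
        have "agree_upto X (2 * n) g h"
          using agree[of g h n] g h l(2) UW by blast
        then have "agree_upto X n g h" by (rule agree_upto_mono) simp
        then show ?thesis using n h by blast
      qed
      then show "\<exists>n. \<forall>h\<in>?W2. agree_upto (X \<times> X) n k h \<longrightarrow> h \<in> two_step X ` U" by blast
    qed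
    show "two_step X ` topspace (subtopology (AutT_topology X) ?W1) =
        topspace (subtopology (AutT_topology (X \<times> X)) ?W2)"
      unfolding topspace_subtopology_AutT[OF sub1] topspace_subtopology_AutT[OF sub2] by (rule im)
    show "inj_on (two_step X) (topspace (subtopology (AutT_topology X) ?W1))"
      unfolding topspace_subtopology_AutT[OF sub1] by (rule inj_on_subset[OF inj_two_step sub1])
  qed
qed

end

theorem mainTheorem5:
  fixes H :: "('g, 'b) monoid_scheme" and X :: "'x set" and \<phi> :: "'g \<Rightarrow> 'x \<Rightarrow> 'x"
  assumes "finite_transitive_perm_group H X \<phi>" and "perfect_group H"
  shows
    "(condition_star H X \<phi> \<longrightarrow>
        (\<forall>x y \<tau> \<pi> m h.
           x \<in> X \<and> y \<in> X \<and> \<tau> \<in> carrier H \<and> \<pi> \<in> carrier H \<and>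
           \<phi> \<tau> x = y \<and> \<phi> \<pi> x = x \<and> \<phi> \<pi> y \<noteq> y \<and>
           h ` {1..m} \<subseteq> carrier H \<and> generate H (h ` {1..m}) = carrier H \<longrightarrow>
           (let G = branch_construction X \<phi> x y m h in
              dense_subgroup X G (wreath_power H X \<phi>) \<and>
              branch_group X G \<and>
              (\<exists>M. maximal_subgroup (AutT X) G M \<and> \<not> finite_index (AutT X) G M)))) \<and>
     (carrier H \<noteq> {\<one>\<^bsub>H\<^esub>} \<and> \<not> condition_star H X \<phi> \<longrightarrow>
        (let H2 = wreath H H X \<phi>; X2 = X \<times> X; \<phi>2 = wreath_action X \<phi> X \<phi> in
           finite_transitive_perm_group H2 X2 \<phi>2 \<and> perfect_group H2 \<and>
           condition_star H2 X2 \<phi>2 \<and>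
           (\<forall>x y \<tau> \<pi> m h.
              x \<in> X2 \<and> y \<in> X2 \<and> \<tau> \<in> carrier H2 \<and> \<pi> \<in> carrier H2 \<and>
              \<phi>2 \<tau> x = y \<and> \<phi>2 \<pi> x = x \<and> \<phi>2 \<pi> y \<noteq> y \<and>
              h ` {1..m} \<subseteq> carrier H2 \<and> generate H2 (h ` {1..m}) = carrier H2 \<longrightarrow>
              (let G = branch_construction X2 \<phi>2 x y m h in
                 dense_subgroup X2 G (wreath_power H2 X2 \<phi>2) \<and>
                 branch_group X2 G \<and>
                 (\<exists>M. maximal_subgroup (AutT X2) G M \<and> \<not> finite_index (AutT X2) G M))) \<and>
           two_step X \<in> iso (AutT X\<lparr>carrier := wreath_power H X \<phi>\<rparr>)
                            (AutT X2\<lparr>carrier := wreath_power H2 X2 \<phi>2\<rparr>) \<and>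
           homeomorphic_map
             (subtopology (AutT_topology X) (wreath_power H X \<phi>))
             (subtopology (AutT_topology X2) (wreath_power H2 X2 \<phi>2))
             (two_step X)))"
proof (intro conjI impI)
  show "\<forall>x y \<tau> \<pi> m h.
      x \<in> X \<and> y \<in> X \<and> \<tau> \<in> carrier H \<and> \<pi> \<in> carrier H \<and>
      \<phi> \<tau> x = y \<and> \<phi> \<pi> x = x \<and> \<phi> \<pi> y \<noteq> y \<and>
      h ` {1..m} \<subseteq> carrier H \<and> generate H (h ` {1..m}) = carrier H \<longrightarrow>
      (let G = branch_construction X \<phi> x y m h in
         dense_subgroup X G (wreath_power H X \<phi>) \<and>
         branch_group X G \<and>
         (\<exists>M. maximal_subgroup (AutT X) G M \<and> \<not> finite_index (AutT X) G M))"
    unfolding Let_def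
    by (intro allI impI conjI; elim conjE; rule branch_construction_properties[OF assms])
next
  let ?H2 = "wreath H H X \<phi>" and ?X2 = "X \<times> X" and ?\<phi>2 = "wreath_action X \<phi> X \<phi>"
  assume "carrier H \<noteq> {\<one>\<^bsub>H\<^esub>} \<and> \<not> condition_star H X \<phi>"
  then have star: "condition_star ?H2 ?X2 ?\<phi>2"
    using condition_star_wreath[OF assms] by blast
  \<comment> \<open>Nonemptiness comes from the cardinality clause of \<open>condition_star\<close>;
    it is what faithfulness of the action on pairs rests on.\<close>
  then have "X \<noteq> {}" by (auto simp: condition_star_def)
  then have ftp: "finite_transitive_perm_group ?H2 ?X2 ?\<phi>2"
    using finite_transitive_wreath[OF assms(1,1)] by blast
  interpret wreath_product_action H H X \<phi> X \<phi>
    by (rule wreath_product_actionI[OF assms(1,1)])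
  have perf: "perfect_group ?H2"
    by (rule perfect_wreath[OF faithful_action_group_hom(3)[OF assms(1)] assms(2,2)])
  show "let H2 = ?H2; X2 = ?X2; \<phi>2 = ?\<phi>2 in
       finite_transitive_perm_group H2 X2 \<phi>2 \<and> perfect_group H2 \<and>
       condition_star H2 X2 \<phi>2 \<and>
       (\<forall>x y \<tau> \<pi> m h.
          x \<in> X2 \<and> y \<in> X2 \<and> \<tau> \<in> carrier H2 \<and> \<pi> \<in> carrier H2 \<and>
          \<phi>2 \<tau> x = y \<and> \<phi>2 \<pi> x = x \<and> \<phi>2 \<pi> y \<noteq> y \<and>
          h ` {1..m} \<subseteq> carrier H2 \<and> generate H2 (h ` {1..m}) = carrier H2 \<longrightarrow>
          (let G = branch_construction X2 \<phi>2 x y m h in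
             dense_subgroup X2 G (wreath_power H2 X2 \<phi>2) \<and>
             branch_group X2 G \<and>
             (\<exists>M. maximal_subgroup (AutT X2) G M \<and> \<not> finite_index (AutT X2) G M))) \<and>
       two_step X \<in> iso (AutT X\<lparr>carrier := wreath_power H X \<phi>\<rparr>)
                        (AutT X2\<lparr>carrier := wreath_power H2 X2 \<phi>2\<rparr>) \<and>
       homeomorphic_map
         (subtopology (AutT_topology X) (wreath_power H X \<phi>))
         (subtopology (AutT_topology X2) (wreath_power H2 X2 \<phi>2))
         (two_step X)"
    unfolding Let_def
    by (intro conjI allI impI ftp perf star two_step_iso[OF assms(1)]
        two_step_homeomorphic[OF assms(1)]; elim conjE;
        rule branch_construction_properties[OF ftp perf])
qed

end
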